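(* Consider the planted submatrix model: observe $Y=\lambda\theta\theta^{\top}+W\in\mathbb R^{n\times n}$, where $\lambda=\lambda_n\ge0$, $\theta\in\{0,1\}^n$ has i.i.d. $\mathrm{Ber}(\rho)$ entries with $\rho=\rho_n\in(0,1)$, and, independently, $W$ is symmetric with $\{W_{i,j}:i\le j\}$ independent, $W_{i,j}\sim\mathcal N(0,1)$ for $i<j$ and $W_{i,i}\sim\mathcal N(0,2)$. Suppose that $$\frac{(\log n)^2}{\sqrt n}\ll\rho\ll\frac1{\log n}\qquad\text{and}\qquad \lambda^2\rho^2 n\ll\frac1{(\log n)^2}.$$ Assume that the low-degree heuristic holds for the hidden informative sample problems associated with this model (see context). Then any algorithm which, given $Y$, outputs an estimator $\mathcal X=\mathcal X(Y)$ achieving weak recovery of $\Theta=\lambda\theta\theta^{\top}$, i.e. $\mathbb E\big[\langle\mathcal X,\Theta\rangle/(\|\mathcal X\|\,\|\Theta\|)\big]\ge c$ for some constant $c>0$, requires running time $\exp\big(\Omega(\lambda^{-2}(\log n)^{-4})\big)$.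
   Context: Asymptotic notation is with respect to $n\to\infty$; $x_n\ll y_n$ means $x_n/y_n\to0$. The parameters $\lambda,\rho$ are known. Inner product and norm are Frobenius; the ratio in weak recovery is read as $0$ when its denominator vanishes. Low-degree heuristic. Let $P=P_n,Q=Q_n$ be probability measures on $\mathbb R^{N}$, $N=N_n$. For a degree $D=D_n$ put $\mathsf{Adv}_{\le D}(P;Q)=\sup_f \mathbb E_P[f]/\sqrt{\mathbb E_Q[f^2]}$, the supremum over real polynomials $f$ on $\mathbb R^N$ of degree at most $D$. A $\{0,1\}$-valued algorithm $\mathcal A$ achieves strong detection if $Q(\mathcal A=1)+P(\mathcal A=0)\to0$, and weak detection if this sum is at most $1-\epsilon$ for some fixed $\epsilon>0$. The low-degree heuristic holds for testing $P$ against $Q$ if: (1) whenever $\mathsf{Adv}_{\le D}(P;Q)=O(1)$ there is a constant $C$ such that no algorithm with running time $N^{D/(C\log N)}$ achieves strong detection; (2) whenever $\mathsf{Adv}_{\le D}(P;Q)=1+o(1)$ there is a constant $C$ such that no algorithm with running time $N^{D/(C\log N)}$ achieves weak detection. Hidden informative sample problem with base pair $(P,Q)$ and sample number $M=M_n$: test between $\overline Q$, the law of $(\mathsf Y_1,\dots,\mathsf Y_M)$ i.i.d. from $Q$, and $\overline P$, the law of $(\mathsf Y_1,\dots,\mathsf Y_M)$ where $\kappa$ is uniform on $\{1,\dots,M\}$ and, given $\kappa$, the $\mathsf Y_j$ are independent with $\mathsf Y_\kappa\sim P$ and $\mathsf Y_j\sim Q$ for $j\ne\kappa$ (dimension $MN$).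 The associated problems: the base pair is ($P$ = law of $Y$ in dimension $m$, $Q$ = law of $W$ in dimension $m$), for any sequence of dimensions $m=m_n\to\infty$ and any parameters $\lambda,\rho$ satisfying the displayed assumptions with $m$ in place of $n$; the sample number is any $M$ with $\Delta\ll M\le N\Delta$, where $\Delta>1$ is an upper bound for $\mathsf{Adv}_{\le D}(P;Q)^2$ and $N$ is the dimension of the base pair. The constant $C$ in the heuristic may be taken independent of the choice of $M$. *)

theory Defs
  imports "HOL-Probability.Probability" "HOL-Library.Landau_Symbols"
begin

text \<open>
  The space \<open>\<real>\<^sup>N\<close> is rendered as the functions \<open>'i \<Rightarrow> real\<close> on a finite index set \<open>I\<close> with
  \<open>card I = N\<close>, i.e. as \<open>PiM I (\<lambda>_. borel)\<close>. Sequences indexed by \<open>n\<close> are functions on \<^typ>\<open>nat\<close>;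
  \<open>x\<^sub>n \<lless> y\<^sub>n\<close> is \<open>x \<in> o(y)\<close>, which is \<open>x\<^sub>n / y\<^sub>n \<longlonglongrightarrow> 0\<close> because all the sequences \<open>y\<close> used below
  are eventually nonzero.
\<close>


section \<open>Algorithms and running time\<close>

text \<open>
  The computational model is the non-uniform randomised real RAM in unrolled form: an algorithm is a
  family of programs, one for each value of \<open>n\<close> (so that it may depend on all the known
  parameters), where a program is a finite list of instructions on real registers. The operations
  are exact arithmetic, comparison (\<open>IfLe r a b c d\<close> stores \<open>c\<close> in \<open>r\<close> if \<open>a \<le> b\<close>, else \<open>d\<close>),
  reading an input coordinate, sampling (\<open>Gauss r s\<close> fetches cell \<open>s\<close> of a tape of independent standard
  Gaussians) and writing an output coordinate. Registers and outputs are initially 0. Since loops are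
  unrolled, the number of instructions is both the running time and the program size; branching, loops
  and indirect addressing can be simulated with polynomial overhead. Counting the program size is
  essential: charging only for the depth of a decision tree would allow exponentially large
  advice for free.
\<close>

datatype ('i, 'o) instr =
    Const nat real
  | Read nat 'i
  | Gauss nat nat
  | Add nat nat nat
  | Sub nat nat nat
  | Mul nat nat nat
  | Div nat nat nat
  | IfLe nat nat nat nat nat
  | Write 'o nat

type_synonym ('i, 'o) prog = "('i, 'o) instr list"

fun exec_instr ::
  "('i \<Rightarrow> real) \<Rightarrow> (nat \<Rightarrow> real) \<Rightarrow> ('i, 'o) instr \<Rightarrow> (nat \<Rightarrow> real) \<times> ('o \<Rightarrow> real) \<Rightarrow> (nat \<Rightarrow> real) \<times> ('o \<Rightarrow> real)"
where
  "exec_instr x \<omega> (Const r a) (v, out) = (v(r := a), out)"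
| "exec_instr x \<omega> (Read r i) (v, out) = (v(r := x i), out)"
| "exec_instr x \<omega> (Gauss r s) (v, out) = (v(r := \<omega> s), out)"
| "exec_instr x \<omega> (Add r a b) (v, out) = (v(r := v a + v b), out)"
| "exec_instr x \<omega> (Sub r a b) (v, out) = (v(r := v a - v b), out)"
| "exec_instr x \<omega> (Mul r a b) (v, out) = (v(r := v a * v b), out)"
| "exec_instr x \<omega> (Div r a b) (v, out) = (v(r := v a / v b), out)"
| "exec_instr x \<omega> (IfLe r a b c d) (v, out) = (v(r := (if v a \<le> v b then v c else v d)), out)"
| "exec_instr x \<omega> (Write k a) (v, out) = (v, out(k := v a))"

definition run_prog :: "('i, 'o) prog \<Rightarrow> ('i \<Rightarrow> real) \<Rightarrow> (nat \<Rightarrow> real) \<Rightarrow> ('o \<Rightarrow> real)" where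
  "run_prog p x \<omega> = snd (fold (exec_instr x \<omega>) p (\<lambda>_. 0, \<lambda>_. 0))"

definition run_time :: "('i, 'o) prog \<Rightarrow> nat" where
  "run_time p = length p"

definition gauss_tape :: "(nat \<Rightarrow> real) measure" where
  "gauss_tape = (\<Pi>\<^sub>M s\<in>UNIV. density lborel (normal_density 0 1))"


section \<open>Low-degree advantage, detection, and the low-degree heuristic\<close>

definition poly_funs :: "'i set \<Rightarrow> nat \<Rightarrow> (('i \<Rightarrow> real) \<Rightarrow> real) set" where
  "poly_funs I D = {f. \<exists>A c. finite A \<and> (\<forall>a\<in>A. (\<Sum>i\<in>I. a i) \<le> D) \<and>
     f = (\<lambda>x. \<Sum>a\<in>A. c a * (\<Prod>i\<in>I. x i ^ (a i :: nat)))}"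

text \<open>
  Polynomials with vanishing second moment under \<open>Q\<close> contribute \<open>0\<close>; this does not affect the
  supremum, as the constant polynomial \<open>1\<close> contributes \<open>1\<close>.
\<close>

definition Adv :: "'i set \<Rightarrow> nat \<Rightarrow> ('i \<Rightarrow> real) measure \<Rightarrow> ('i \<Rightarrow> real) measure \<Rightarrow> ereal" where
  "Adv I D P Q = (SUP f\<in>poly_funs I D. ereal ((\<integral>x. f x \<partial>P) / sqrt (\<integral>x. (f x)\<^sup>2 \<partial>Q)))"

definition binary_valued :: "('i, unit) prog \<Rightarrow> bool" where
  "binary_valued p \<longleftrightarrow> (\<forall>x \<omega>. run_prog p x \<omega> () \<in> {0, 1})"

definition prob_output :: "('i, unit) prog \<Rightarrow> ('i \<Rightarrow> real) measure \<Rightarrow> real \<Rightarrow> real" where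
  "prob_output p R b =
     measure (R \<Otimes>\<^sub>M gauss_tape) {(x, \<omega>) \<in> space (R \<Otimes>\<^sub>M gauss_tape). run_prog p x \<omega> () = b}"

definition error_sum :: "('i, unit) prog \<Rightarrow> ('i \<Rightarrow> real) measure \<Rightarrow> ('i \<Rightarrow> real) measure \<Rightarrow> real" where
  "error_sum p P Q = prob_output p Q 1 + prob_output p P 0"

definition strong_detection ::
  "(nat \<Rightarrow> ('i, unit) prog) \<Rightarrow> (nat \<Rightarrow> ('i \<Rightarrow> real) measure) \<Rightarrow> (nat \<Rightarrow> ('i \<Rightarrow> real) measure) \<Rightarrow> bool" where
  "strong_detection A P Q \<longleftrightarrow>
     (\<forall>n. binary_valued (A n)) \<and> (\<lambda>n. error_sum (A n) (P n) (Q n)) \<longlonglongrightarrow> 0"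

definition weak_detection ::
  "(nat \<Rightarrow> ('i, unit) prog) \<Rightarrow> (nat \<Rightarrow> ('i \<Rightarrow> real) measure) \<Rightarrow> (nat \<Rightarrow> ('i \<Rightarrow> real) measure) \<Rightarrow> bool" where
  "weak_detection A P Q \<longleftrightarrow>
     (\<forall>n. binary_valued (A n)) \<and>
     (\<exists>\<epsilon>>0. \<forall>\<^sub>F n in sequentially. error_sum (A n) (P n) (Q n) \<le> 1 - \<epsilon>)"

definition time_bound :: "real \<Rightarrow> nat \<Rightarrow> nat \<Rightarrow> real" where
  "time_bound C N D = real N powr (real D / (C * ln (real N)))"

definition runs_within :: "(nat \<Rightarrow> ('i, 'o) prog) \<Rightarrow> (nat \<Rightarrow> real) \<Rightarrow> bool" where
  "runs_within A T \<longleftrightarrow> (\<forall>\<^sub>F n in sequentially. real (run_time (A n)) \<le> T n)"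

text \<open>
  The low-degree heuristic with an explicit constant \<open>C\<close>, for the testing problems \<open>P n\<close> against \<open>Q n\<close>
  on \<open>\<real>\<^bsup>I n\<^esup>\<close>. A common \<open>C\<close> for both parts is no restriction, since increasing \<open>C\<close> decreases the time
  bound.
\<close>

definition low_degree_heuristic ::
  "real \<Rightarrow> (nat \<Rightarrow> 'i set) \<Rightarrow> (nat \<Rightarrow> nat) \<Rightarrow>
     (nat \<Rightarrow> ('i \<Rightarrow> real) measure) \<Rightarrow> (nat \<Rightarrow> ('i \<Rightarrow> real) measure) \<Rightarrow> bool" where
  "low_degree_heuristic C I D P Q \<longleftrightarrow>
     ((\<exists>B::real. \<forall>\<^sub>F n in sequentially. Adv (I n) (D n) (P n) (Q n) \<le> ereal B) \<longrightarrow>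
        \<not> (\<exists>A. runs_within A (\<lambda>n. time_bound C (card (I n)) (D n)) \<and> strong_detection A P Q)) \<and>
     ((\<lambda>n. Adv (I n) (D n) (P n) (Q n)) \<longlonglongrightarrow> 1 \<longrightarrow>
        \<not> (\<exists>A. runs_within A (\<lambda>n. time_bound C (card (I n)) (D n)) \<and> weak_detection A P Q))"


section \<open>Hidden informative sample problem\<close>

text \<open>
  Samples \<open>Y\<^sub>0, \<dots>, Y\<^bsub>M-1\<^esub>\<close> in \<open>\<real>\<^bsup>I\<^esup>\<close> are regarded as one point of \<open>\<real>\<^bsup>{..<M} \<times> I\<^esup>\<close>.
\<close>

definition flatten_samples :: "nat \<Rightarrow> 'i set \<Rightarrow> (nat \<Rightarrow> 'i \<Rightarrow> real) \<Rightarrow> nat \<times> 'i \<Rightarrow> real" where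
  "flatten_samples M I y = (\<lambda>(j, i)\<in>{..<M} \<times> I. y j i)"

definition samples_law :: "nat \<Rightarrow> 'i set \<Rightarrow> (nat \<Rightarrow> ('i \<Rightarrow> real) measure) \<Rightarrow> (nat \<times> 'i \<Rightarrow> real) measure" where
  "samples_law M I R =
     distr (\<Pi>\<^sub>M j\<in>{..<M}. R j) (\<Pi>\<^sub>M ji\<in>{..<M} \<times> I. borel) (flatten_samples M I)"

definition hidden_null :: "nat \<Rightarrow> 'i set \<Rightarrow> ('i \<Rightarrow> real) measure \<Rightarrow> (nat \<times> 'i \<Rightarrow> real) measure" where
  "hidden_null M I Q = samples_law M I (\<lambda>_. Q)"

definition hidden_planted ::
  "nat \<Rightarrow> 'i set \<Rightarrow> ('i \<Rightarrow> real) measure \<Rightarrow> ('i \<Rightarrow> real) measure \<Rightarrow> (nat \<times> 'i \<Rightarrow> real) measure" where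
  "hidden_planted M I P Q =
     measure_pmf (pmf_of_set {..<M}) \<bind> (\<lambda>\<kappa>. samples_law M I (\<lambda>j. if j = \<kappa> then P else Q))"


section \<open>Planted submatrix model\<close>

abbreviation entries :: "nat \<Rightarrow> (nat \<times> nat) set" where
  "entries n \<equiv> {..<n} \<times> {..<n}"

definition frob_inner :: "nat \<Rightarrow> (nat \<times> nat \<Rightarrow> real) \<Rightarrow> (nat \<times> nat \<Rightarrow> real) \<Rightarrow> real" where
  "frob_inner n X Z = (\<Sum>e\<in>entries n. X e * Z e)"

definition frob_norm :: "nat \<Rightarrow> (nat \<times> nat \<Rightarrow> real) \<Rightarrow> real" where
  "frob_norm n X = sqrt (frob_inner n X X)"

definition noise_law :: "nat \<Rightarrow> (nat \<times> nat \<Rightarrow> real) measure" where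
  "noise_law n =
     distr (\<Pi>\<^sub>M (i, j)\<in>{(i, j). i \<le> j \<and> j < n}.
              density lborel (normal_density 0 (if i = j then sqrt 2 else 1)))
       (\<Pi>\<^sub>M e\<in>entries n. borel)
       (\<lambda>g. \<lambda>(i, j)\<in>entries n. g (min i j, max i j))"

definition theta_pmf :: "nat \<Rightarrow> real \<Rightarrow> (nat \<Rightarrow> bool) pmf" where
  "theta_pmf n \<rho> = Pi_pmf {..<n} False (\<lambda>_. bernoulli_pmf \<rho>)"

definition signal :: "real \<Rightarrow> (nat \<Rightarrow> bool) \<Rightarrow> nat \<times> nat \<Rightarrow> real" where
  "signal lam \<theta> = (\<lambda>(i, j). lam * of_bool (\<theta> i) * of_bool (\<theta> j))"

definition observation :: "nat \<Rightarrow> real \<Rightarrow> (nat \<Rightarrow> bool) \<times> (nat \<times> nat \<Rightarrow> real) \<Rightarrow> nat \<times> nat \<Rightarrow> real" where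
  "observation n lam = (\<lambda>(\<theta>, W). \<lambda>e\<in>entries n. signal lam \<theta> e + W e)"

definition model_space :: "nat \<Rightarrow> real \<Rightarrow> ((nat \<Rightarrow> bool) \<times> (nat \<times> nat \<Rightarrow> real)) measure" where
  "model_space n \<rho> = measure_pmf (theta_pmf n \<rho>) \<Otimes>\<^sub>M noise_law n"

definition planted_law :: "nat \<Rightarrow> real \<Rightarrow> real \<Rightarrow> (nat \<times> nat \<Rightarrow> real) measure" where
  "planted_law n lam \<rho> = distr (model_space n \<rho>) (\<Pi>\<^sub>M e\<in>entries n. borel) (observation n lam)"

text \<open>
  The expectation is over \<open>\<theta>\<close>, \<open>W\<close> and the internal randomness of the estimator. The ratio is \<open>0\<close> when
  its denominator vanishes, by the library convention \<open>x / 0 = 0\<close>.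
\<close>

definition recovery_score :: "nat \<Rightarrow> real \<Rightarrow> real \<Rightarrow> (nat \<times> nat, nat \<times> nat) prog \<Rightarrow> real" where
  "recovery_score n lam \<rho> p =
     (\<integral>((\<theta>, W), \<omega>). (let X = run_prog p (observation n lam (\<theta>, W)) \<omega>; \<Theta> = signal lam \<theta>
                     in frob_inner n X \<Theta> / (frob_norm n X * frob_norm n \<Theta>))
        \<partial>(model_space n \<rho> \<Otimes>\<^sub>M gauss_tape))"

definition weak_recovery ::
  "(nat \<Rightarrow> real) \<Rightarrow> (nat \<Rightarrow> real) \<Rightarrow> (nat \<Rightarrow> (nat \<times> nat, nat \<times> nat) prog) \<Rightarrow> bool" where
  "weak_recovery lam \<rho> A \<longleftrightarrow>
     (\<exists>c>0. \<forall>\<^sub>F n in sequentially. recovery_score n (lam n) (\<rho> n) (A n) \<ge> c)"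

definition parameter_regime :: "(nat \<Rightarrow> nat) \<Rightarrow> (nat \<Rightarrow> real) \<Rightarrow> (nat \<Rightarrow> real) \<Rightarrow> bool" where
  "parameter_regime m lam \<rho> \<longleftrightarrow>
     (\<forall>n. 0 \<le> lam n \<and> 0 < \<rho> n \<and> \<rho> n < 1) \<and>
     (\<lambda>n. (ln (real (m n)))\<^sup>2 / sqrt (real (m n))) \<in> o(\<rho>) \<and>
     \<rho> \<in> o(\<lambda>n. 1 / ln (real (m n))) \<and>
     (\<lambda>n. (lam n)\<^sup>2 * (\<rho> n)\<^sup>2 * real (m n)) \<in> o(\<lambda>n. 1 / (ln (real (m n)))\<^sup>2)"

text \<open>
  The low-degree heuristic for all hidden informative sample problems associated with the model: the
  constant \<open>C\<close> is chosen before the sample number \<open>M\<close>, hence independent of it.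
\<close>

definition associated_heuristics :: bool where
  "associated_heuristics \<longleftrightarrow>
     (\<forall>m lam \<rho> D \<Delta>.
        filterlim m at_top sequentially \<and> parameter_regime m lam \<rho> \<and>
        (\<forall>n. 1 < \<Delta> n \<and>
             (Adv (entries (m n)) (D n) (planted_law (m n) (lam n) (\<rho> n)) (noise_law (m n)))\<^sup>2
               \<le> ereal (\<Delta> n)) \<longrightarrow>
        (\<exists>C>0. \<forall>M.
           (\<forall>n. 0 < M n \<and> real (M n) \<le> real (card (entries (m n))) * \<Delta> n) \<and>
           \<Delta> \<in> o(\<lambda>n. real (M n)) \<longrightarrow>
           low_degree_heuristic C (\<lambda>n. {..<M n} \<times> entries (m n)) D
             (\<lambda>n. hidden_planted (M n) (entries (m n))
                    (planted_law (m n) (lam n) (\<rho> n)) (noise_law (m n)))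
             (\<lambda>n. hidden_null (M n) (entries (m n)) (noise_law (m n)))))"

end

theory Submission
  imports Defs
begin

text \<open>
  Suppose that an estimator achieves weak recovery in time less than \<open>exp (\<lambda>\<^sup>-\<^sup>2 / (log n)\<^sup>4)\<close> along a
  subsequence. If \<open>\<lambda> \<rho> n \<le> log n\<close>, this is impossible for every estimator, by a second moment bound on the
  posterior correlation with \<open>\<theta>\<theta>\<^sup>T\<close>. Otherwise the estimator is turned into a weak detector for the
  hidden informative sample problem with signal strength \<open>\<surd>2 \<lambda>\<close>: a sample \<open>Y\<close> is split into the two
  clones \<open>(Y \<plusminus> Z) / \<surd>2\<close>, which have independent noise and signal strength \<open>\<lambda>\<close>; the estimate computed
  from one clone is correlated with the other, and an alarm is raised if some sample gives a correlation of
  order \<open>\<lambda> \<rho> n\<close>. Since \<open>\<rho> \<lless> 1 / log n\<close>, this survives a union bound over \<open>M \<approx> n \<Delta>\<close> samples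
  with \<open>\<Delta> = exp (O(\<lambda>\<^sup>2 \<rho>\<^sup>4 n\<^sup>2)) + 1\<close>, an upper bound on the squared advantage up to degree
  \<open>D \<approx> \<lambda>\<^sup>-\<^sup>2 / 800\<close>. The advantage of the hidden problem is then \<open>1 + o(1)\<close>, and the detector runs
  in time \<open>exp (o(D))\<close>, contradicting the heuristic. The programs are non-uniform, so that all randomness
  (the tape of the estimator and \<open>Z\<close>) can be fixed to a favourable value.
\<close>

section \<open>Product Gaussians\<close>

text \<open>Two exponents have to be balanced. With q = (\<lambda>\<rho>n)^2, the test errs with
  probability about exp (-const * q), while the union bound costs log M, about log n + 30 \<rho>^2
  q. The second summand is negligible because \<rho> tends to 0, the first because q exceeds (log
  n)^2; this is the origin of the case distinction at \<lambda>\<rho>n = log n. The same M enters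
  the running time, where it competes with D: since \<rho>^2 q = \<lambda>^-2 (\<lambda>^2 \<rho>^2
  n)^2, the smallness of \<lambda>^2 \<rho>^2 n makes M = exp (o(D)). On the other side, M must
  exceed \<Delta> by a diverging factor, because hiding the informative sample divides the excess of
  the squared advantage by M. Cloning divides the signal by sqrt 2, so the hidden problem is posed
  at sqrt 2 times \<lambda>, which stays in the regime. The estimator may be fast for infinitely
  many n only; since the heuristic covers every sequence of dimensions tending to infinity, it is
  applied along these n.\<close>

definition gauss_prod :: "('i \<Rightarrow> real) \<Rightarrow> 'i set \<Rightarrow> ('i \<Rightarrow> real) measure" where
  "gauss_prod \<sigma> J = PiM J (\<lambda>e. density lborel (normal_density 0 (\<sigma> e)))"

text \<open>The Cameron-Martin density: the likelihood ratio of the Gaussian product with mean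
  \<open>x\<close> against the centred one.\<close>

definition tilt :: "('i \<Rightarrow> real) \<Rightarrow> 'i set \<Rightarrow> ('i \<Rightarrow> real) \<Rightarrow> ('i \<Rightarrow> real) \<Rightarrow> real" where
  "tilt \<sigma> J x w = exp (\<Sum>e\<in>J. x e * w e / (\<sigma> e)\<^sup>2 - (x e)\<^sup>2 / (2 * (\<sigma> e)\<^sup>2))"

text \<open>The Cameron-Martin inner product, Euclidean up to the inverse covariance. The mixed
  moment of two tilts is its exponential.\<close>

definition gauss_inner :: "('i \<Rightarrow> real) \<Rightarrow> 'i set \<Rightarrow> ('i \<Rightarrow> real) \<Rightarrow> ('i \<Rightarrow> real) \<Rightarrow> real" where
  "gauss_inner \<sigma> J x y = (\<Sum>e\<in>J. x e * y e / (\<sigma> e)\<^sup>2)"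

section \<open>Pushforwards and densities of finite products\<close>

lemma distr_PiM_finite:
  assumes fin: "finite I"
  assumes M: "\<And>i. i \<in> I \<Longrightarrow> prob_space (M i)"
  assumes f: "\<And>i. i \<in> I \<Longrightarrow> f i \<in> measurable (M i) (M' i)"
  shows "distr (PiM I M) (PiM I M') (\<lambda>w. \<lambda>i\<in>I. f i (w i)) = PiM I (\<lambda>i. distr (M i) (M' i) (f i))"
proof -
  \<comment> \<open>The locale \<open>product_prob_space\<close> speaks about all indices, the
    hypotheses only about \<open>I\<close>. Outside \<open>I\<close> both families are padded with a
    point mass, which a product over \<open>I\<close> does not see.\<close>
  define N where "N = (\<lambda>i. if i \<in> I then distr (M i) (M' i) (f i) else return (count_space UNIV) undefined)"
  define K where "K = (\<lambda>i. if i \<in> I then M i else return (count_space UNIV) undefined)"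
  interpret N: product_prob_space N
    by (rule product_prob_spaceI) (auto simp: N_def intro!: prob_space_return prob_space.prob_space_distr M f)
  interpret K: product_prob_space K
    by (rule product_prob_spaceI) (auto simp: K_def intro!: prob_space_return M)
  have PK: "PiM I K = PiM I M" and PN: "PiM I N = PiM I (\<lambda>i. distr (M i) (M' i) (f i))"
    by (intro PiM_cong; simp add: K_def N_def)+
  have meas: "(\<lambda>w. \<lambda>i\<in>I. f i (w i)) \<in> measurable (PiM I M) (PiM I M')"
  proof (rule measurable_restrict)
    fix i assume i: "i \<in> I"
    show "(\<lambda>w. f i (w i)) \<in> measurable (PiM I M) (M' i)"
      by (rule measurable_compose[OF measurable_component_singleton[OF i, where M=M] f[OF i]])
  qed
  have "distr (PiM I K) (PiM I M') (\<lambda>w. \<lambda>i\<in>I. f i (w i)) = PiM I N"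
  proof (rule N.PiM_eqI[OF fin])
    have "sets (PiM I N) = sets (PiM I M')"
      by (intro sets_PiM_cong) (auto simp: N_def)
    then show "sets (distr (PiM I K) (PiM I M') (\<lambda>w. \<lambda>i\<in>I. f i (w i))) = sets (PiM I N)"
      by simp
    fix A assume A: "\<And>i. i \<in> I \<Longrightarrow> A i \<in> sets (N i)"
    then have A': "\<And>i. i \<in> I \<Longrightarrow> A i \<in> sets (M' i)" by (auto simp: N_def)
    have "emeasure (distr (PiM I K) (PiM I M') (\<lambda>w. \<lambda>i\<in>I. f i (w i))) (Pi\<^sub>E I A)
        = emeasure (PiM I K) (Pi\<^sub>E I (\<lambda>i. f i -` A i \<inter> space (M i)))"
      using fin A' f meas unfolding PK
      by (subst emeasure_distr) (auto intro!: sets_PiM_I_finite arg_cong2[where f=emeasure] simp: space_PiM PiE_iff)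
    also have "\<dots> = (\<Prod>i\<in>I. emeasure (K i) (f i -` A i \<inter> space (M i)))"
      using A' f by (intro K.emeasure_PiM fin) (auto simp: K_def)
    also have "\<dots> = (\<Prod>i\<in>I. emeasure (N i) (A i))"
      using A' f by (intro prod.cong refl) (auto simp: K_def N_def emeasure_distr)
    finally show "emeasure (distr (PiM I K) (PiM I M') (\<lambda>w. \<lambda>i\<in>I. f i (w i))) (Pi\<^sub>E I A) = (\<Prod>i\<in>I. emeasure (N i) (A i))" .
  qed
  then show ?thesis by (simp add: PK PN)
qed

lemma density_PiM_finite:
  assumes fin: "finite I"
  assumes M: "product_prob_space M" and N: "product_prob_space (\<lambda>i. density (M i) (f i))"
  assumes f: "\<And>i. i \<in> I \<Longrightarrow> f i \<in> borel_measurable (M i)"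
  shows "density (PiM I M) (\<lambda>w. \<Prod>i\<in>I. f i (w i)) = PiM I (\<lambda>i. density (M i) (f i))"
proof -
  interpret M: product_prob_space M by (rule M)
  interpret N: product_prob_space "\<lambda>i. density (M i) (f i)" by (rule N)
  have meas: "(\<lambda>w. \<Prod>i\<in>I. f i (w i)) \<in> borel_measurable (PiM I M)"
  proof (rule borel_measurable_prod_ennreal)
    fix i assume i: "i \<in> I"
    show "(\<lambda>w. f i (w i)) \<in> borel_measurable (PiM I M)"
      by (rule measurable_compose[OF measurable_component_singleton[OF i, where M=M] f[OF i]])
  qed
  show ?thesis
  proof (rule N.PiM_eqI[OF fin])
    have "sets (PiM I (\<lambda>i. density (M i) (f i))) = sets (PiM I M)"
      by (intro sets_PiM_cong) auto
    then show "sets (density (PiM I M) (\<lambda>w. \<Prod>i\<in>I. f i (w i))) = sets (PiM I (\<lambda>i. density (M i) (f i)))"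
      by simp
    fix A assume A: "\<And>i. i \<in> I \<Longrightarrow> A i \<in> sets (density (M i) (f i))"
    then have A': "\<And>i. i \<in> I \<Longrightarrow> A i \<in> sets (M i)" by auto
    have "emeasure (density (PiM I M) (\<lambda>w. \<Prod>i\<in>I. f i (w i))) (Pi\<^sub>E I A)
        = (\<integral>\<^sup>+ w. (\<Prod>i\<in>I. f i (w i)) * indicator (Pi\<^sub>E I A) w \<partial>PiM I M)"
      using A' meas fin by (intro emeasure_density) (auto intro!: sets_PiM_I_finite)
    also have "\<dots> = (\<integral>\<^sup>+ w. (\<Prod>i\<in>I. f i (w i) * indicator (A i) (w i)) \<partial>PiM I M)"
    proof (intro nn_integral_cong)
      fix w assume "w \<in> space (PiM I M)"
      then have "indicator (Pi\<^sub>E I A) w = (\<Prod>i\<in>I. indicator (A i) (w i) :: ennreal)"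
        using fin by (auto simp: indicator_def PiE_iff space_PiM)
      then show "(\<Prod>i\<in>I. f i (w i)) * indicator (Pi\<^sub>E I A) w = (\<Prod>i\<in>I. f i (w i) * indicator (A i) (w i))"
        by (simp add: prod.distrib)
    qed
    also have "\<dots> = (\<Prod>i\<in>I. \<integral>\<^sup>+ w. f i w * indicator (A i) w \<partial>M i)"
      using f A' by (intro M.product_nn_integral_prod fin) auto
    also have "\<dots> = (\<Prod>i\<in>I. emeasure (density (M i) (f i)) (A i))"
      using f A' by (intro prod.cong refl) (simp add: emeasure_density)
    finally show "emeasure (density (PiM I M) (\<lambda>w. \<Prod>i\<in>I. f i (w i))) (Pi\<^sub>E I A)
        = (\<Prod>i\<in>I. emeasure (density (M i) (f i)) (A i))" .
  qed
qed

lemma normal_density_tilt: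
  fixes s :: real assumes s: "0 < s"
  shows "normal_density m s w = normal_density 0 s w * exp (m * w / s\<^sup>2 - m\<^sup>2 / (2 * s\<^sup>2))"
proof -
  have "- (w - m)\<^sup>2 / (2 * s\<^sup>2) = - (w - 0)\<^sup>2 / (2 * s\<^sup>2) + (m * w / s\<^sup>2 - m\<^sup>2 / (2 * s\<^sup>2))"
    using s by (simp add: field_simps power2_eq_square)
  then have "exp (- (w - m)\<^sup>2 / (2 * s\<^sup>2)) = exp (- (w - 0)\<^sup>2 / (2 * s\<^sup>2)) * exp (m * w / s\<^sup>2 - m\<^sup>2 / (2 * s\<^sup>2))"
    by (simp only: exp_add)
  then show ?thesis
    unfolding normal_density_def by simp
qed

lemma distr_normal_shift:
  fixes s :: real assumes s: "0 < s"
  shows "distr (density lborel (normal_density 0 s)) borel (\<lambda>w. m + w) = density lborel (normal_density m s)"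
proof -
  interpret prob_space "density lborel (normal_density 0 s)"
    by (rule prob_space_normal_density[OF s])
  have "distributed (density lborel (normal_density 0 s)) lborel (\<lambda>w. w) (normal_density 0 s)"
    unfolding distributed_def by (auto intro!: measure_eqI simp: emeasure_distr)
  from normal_density_affine[OF this s, of 1 m]
  have "distributed (density lborel (normal_density 0 s)) lborel (\<lambda>w. m + w) (normal_density m s)"
    by simp
  from distributed_distr_eq_density[OF this]
  have "distr (density lborel (normal_density 0 s)) lborel (\<lambda>w. m + w) = density lborel (normal_density m s)" .
  moreover have "distr (density lborel (normal_density 0 s)) lborel (\<lambda>w. m + w)
      = distr (density lborel (normal_density 0 s)) borel (\<lambda>w. m + w)"
    by (intro distr_cong) auto
  ultimately show ?thesis by simp
qed

lemma sets_gauss_prod[simp]: "sets (gauss_prod \<sigma> J) = sets (PiM J (\<lambda>_. borel))"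
  unfolding gauss_prod_def by (intro sets_PiM_cong) auto

lemma space_gauss_prod: "space (gauss_prod \<sigma> J) = space (PiM J (\<lambda>_. borel))"
  by (rule sets_eq_imp_space_eq) simp

lemma measurable_gauss_prod1: "measurable (gauss_prod \<sigma> J) N = measurable (PiM J (\<lambda>_. borel)) N"
  by (rule measurable_cong_sets) auto

lemma tilt_pos: "0 < tilt \<sigma> J x w" by (simp add: tilt_def)

lemma borel_measurable_tilt[measurable]: "tilt \<sigma> J x \<in> borel_measurable (PiM J (\<lambda>_. borel))"
  unfolding tilt_def by measurable

context
  fixes \<sigma> :: "'i \<Rightarrow> real"
  assumes \<sigma>: "\<And>e. 0 < \<sigma> e"
begin

lemma product_prob_space_gauss: "product_prob_space (\<lambda>e. density lborel (normal_density (m e) (\<sigma> e)))"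
  by (rule product_prob_spaceI) (rule prob_space_normal_density[OF \<sigma>])

lemma prob_space_gauss_prod: "prob_space (gauss_prod \<sigma> J)"
  unfolding gauss_prod_def by (intro prob_space_PiM prob_space_normal_density \<sigma>)

text \<open>Completing the square. Products of tilts are tilts up to a scalar, so second moments can
  be read off from the fact that a tilt has mean 1.\<close>

lemma tilt_mult: "tilt \<sigma> J x w * tilt \<sigma> J y w = exp (gauss_inner \<sigma> J x y) * tilt \<sigma> J (\<lambda>e. x e + y e) w"
proof -
  have "(x e * w e / (\<sigma> e)\<^sup>2 - (x e)\<^sup>2 / (2 * (\<sigma> e)\<^sup>2)) + (y e * w e / (\<sigma> e)\<^sup>2 - (y e)\<^sup>2 / (2 * (\<sigma> e)\<^sup>2))
    = x e * y e / (\<sigma> e)\<^sup>2 + ((x e + y e) * w e / (\<sigma> e)\<^sup>2 - (x e + y e)\<^sup>2 / (2 * (\<sigma> e)\<^sup>2))" for e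
    using \<sigma>[of e] by (simp add: field_simps power2_eq_square)
  then show ?thesis
    unfolding tilt_def gauss_inner_def by (simp add: exp_add[symmetric] sum.distrib[symmetric])
qed

end

context
  fixes \<sigma> :: "'i \<Rightarrow> real" and J :: "'i set"
  assumes \<sigma>: "\<And>e. 0 < \<sigma> e" and J: "finite J"
begin

text \<open>Cameron-Martin, coordinate by coordinate: a shift acts on each factor separately, every
  shifted factor has the density \<open>?t\<close>, and the product of these densities is the
  exponential of a sum.\<close>

lemma distr_gauss_prod_shift:
  "distr (gauss_prod \<sigma> J) (PiM J (\<lambda>_. borel)) (\<lambda>w. \<lambda>e\<in>J. x e + w e) = density (gauss_prod \<sigma> J) (tilt \<sigma> J x)"
proof -
  let ?M = "\<lambda>e. density lborel (normal_density 0 (\<sigma> e))"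
  let ?t = "\<lambda>e w. ennreal (exp (x e * w / (\<sigma> e)\<^sup>2 - (x e)\<^sup>2 / (2 * (\<sigma> e)\<^sup>2)))"
  have dd: "density (?M e) (?t e) = density lborel (normal_density (x e) (\<sigma> e))" for e
    by (subst density_density_eq)
       (auto intro!: arg_cong2[where f=density] simp: normal_density_tilt[OF \<sigma>, of "x e"] ennreal_mult')
  have "distr (gauss_prod \<sigma> J) (PiM J (\<lambda>_. borel)) (\<lambda>w. \<lambda>e\<in>J. x e + w e)
      = PiM J (\<lambda>e. distr (?M e) borel (\<lambda>w. x e + w))"
    unfolding gauss_prod_def by (intro distr_PiM_finite J prob_space_normal_density \<sigma>) auto
  also have "\<dots> = PiM J (\<lambda>e. density lborel (normal_density (x e) (\<sigma> e)))"
    by (simp add: distr_normal_shift[OF \<sigma>])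
  also have "\<dots> = PiM J (\<lambda>e. density (?M e) (?t e))"
    by (simp add: dd)
  also have "\<dots> = density (PiM J ?M) (\<lambda>w. \<Prod>e\<in>J. ?t e (w e))"
    by (rule density_PiM_finite[symmetric])
       (auto simp: dd intro!: J product_prob_space_gauss[OF \<sigma>] product_prob_space_gauss[OF \<sigma>, where m="\<lambda>_. 0"])
  also have "\<dots> = density (gauss_prod \<sigma> J) (tilt \<sigma> J x)"
    unfolding gauss_prod_def[symmetric]
    by (intro density_cong) (auto simp: measurable_gauss_prod1 tilt_def exp_sum J prod_ennreal)
  finally show ?thesis .
qed

text \<open>The integral is the total mass of a shifted probability measure, so no Gaussian integral
  has to be evaluated.\<close>

lemma nn_integral_tilt: "(\<integral>\<^sup>+w. tilt \<sigma> J x w \<partial>gauss_prod \<sigma> J) = 1"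
proof -
  interpret prob_space "gauss_prod \<sigma> J" by (rule prob_space_gauss_prod[OF \<sigma>])
  interpret D: prob_space "density (gauss_prod \<sigma> J) (tilt \<sigma> J x)"
    unfolding distr_gauss_prod_shift[symmetric]
    by (intro prob_space_distr) (simp add: measurable_gauss_prod1)
  have "(\<integral>\<^sup>+w. tilt \<sigma> J x w \<partial>gauss_prod \<sigma> J) = emeasure (density (gauss_prod \<sigma> J) (tilt \<sigma> J x)) (space (gauss_prod \<sigma> J))"
    by (subst emeasure_density) (auto simp: space_gauss_prod measurable_gauss_prod1 intro!: nn_integral_cong)
  then show ?thesis using D.emeasure_space_1 by simp
qed

lemma has_bochner_integral_tilt: "has_bochner_integral (gauss_prod \<sigma> J) (tilt \<sigma> J x) 1"
  by (rule has_bochner_integral_nn_integral)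
     (auto simp: nn_integral_tilt measurable_gauss_prod1 tilt_pos[THEN less_imp_le])

lemma has_bochner_integral_tilt_mult:
  "has_bochner_integral (gauss_prod \<sigma> J) (\<lambda>w. tilt \<sigma> J x w * tilt \<sigma> J y w) (exp (gauss_inner \<sigma> J x y))"
  using has_bochner_integral_mult_right[OF has_bochner_integral_tilt, of "exp (gauss_inner \<sigma> J x y)"]
  by (simp add: tilt_mult[OF \<sigma>])

end

section \<open>Low-degree advantage of a Gaussian mixture\<close>

text \<open>
  The weights are the Lagrange basis polynomials of the nodes \<open>0, \<epsilon>, \<dots>, D \<epsilon>\<close>, evaluated at \<open>1\<close>.
\<close>

lemma extrapolation_weights:
  fixes \<epsilon> :: real
  assumes \<epsilon>: "0 < \<epsilon>" "\<epsilon> \<le> 1"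
  obtains w :: "nat \<Rightarrow> real" where
    "\<And>p. degree p \<le> D \<Longrightarrow> (\<Sum>j\<le>D. w j * poly p (\<epsilon> * real j)) = poly p 1"
    "\<And>j. j \<le> D \<Longrightarrow> \<bar>w j\<bar> \<le> (real (Suc D) / \<epsilon>) ^ D"
proof -
  define l where "l j = (\<Prod>k\<in>{..D} - {j}. [:- real k / (real j - real k), 1 / (real j - real k):])" for j
  have poly_l: "poly (l j) u = (\<Prod>k\<in>{..D} - {j}. (u - real k) / (real j - real k))" for j u
    by (auto simp: l_def poly_prod diff_divide_distrib intro!: prod.cong)
  have deg_l: "degree (l j) \<le> D" if "j \<le> D" for j
  proof -
    have "degree (l j) \<le> (\<Sum>k\<in>{..D} - {j}. degree [:- real k / (real j - real k), 1 / (real j - real k):])"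
      unfolding l_def
      using degree_prod_sum_le[of "{..D} - {j}" "\<lambda>k. [:- real k / (real j - real k), 1 / (real j - real k):]"]
      by (simp only: comp_def finite_Diff finite_atMost)
    also have "\<dots> \<le> (\<Sum>k\<in>{..D} - {j}. 1)"
      by (intro sum_mono) auto
    also have "\<dots> = D" using that by simp
    finally show ?thesis .
  qed
  have l_node: "poly (l j) (real k) = (if j = k then 1 else 0)" if "j \<le> D" "k \<le> D" for j k
    using that by (auto simp: poly_l)
  \<comment> \<open>The difference would vanish at the D + 1 nodes 0, ..., D although its degree is
    at most D.\<close>
  have interp: "p = (\<Sum>j\<le>D. smult (poly p (real j)) (l j))" if p: "degree p \<le> D" for p
  proof (rule ccontr)
    let ?q = "p - (\<Sum>j\<le>D. smult (poly p (real j)) (l j))"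
    assume "\<not> ?thesis"
    then have nz: "?q \<noteq> 0" by simp
    have "poly ?q (real k) = 0" if "k \<le> D" for k
      using that by (simp add: poly_sum l_node if_distrib cong: if_cong)
    then have "real ` {..D} \<subseteq> {x. poly ?q x = 0}" by auto
    then have "card (real ` {..D}) \<le> card {x. poly ?q x = 0}"
      by (intro card_mono poly_roots_finite nz)
    also have "\<dots> \<le> degree ?q" by (rule card_poly_roots_bound[OF nz])
    also have "\<dots> \<le> D"
      by (intro degree_diff_le p degree_sum_le) (auto simp: deg_l)
    finally show False by (simp add: card_image)
  qed
  show thesis
  proof
    fix p :: "real poly" assume p: "degree p \<le> D"
    \<comment> \<open>Rescaling turns the nodes \<epsilon> j into the integers j and the evaluation
      point 1 into 1 / \<epsilon>.\<close>
    define q where "q = pcompose p [:0, \<epsilon>:]"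
    have "degree q \<le> D" using p \<epsilon> by (simp add: q_def degree_pcompose)
    from interp[OF this] have "poly q (1 / \<epsilon>) = (\<Sum>j\<le>D. poly q (real j) * poly (l j) (1 / \<epsilon>))"
      by (metis (mono_tags, lifting) poly_smult poly_sum sum.cong)
    then show "(\<Sum>j\<le>D. poly (l j) (1 / \<epsilon>) * poly p (\<epsilon> * real j)) = poly p 1"
      using \<epsilon> by (simp add: q_def poly_pcompose mult_ac)
  next
    fix j assume j: "j \<le> D"
    have "\<bar>poly (l j) (1 / \<epsilon>)\<bar> = (\<Prod>k\<in>{..D} - {j}. \<bar>1 / \<epsilon> - real k\<bar> / \<bar>real j - real k\<bar>)"
      by (simp add: poly_l abs_prod)
    also have "\<dots> \<le> (\<Prod>k\<in>{..D} - {j}. real (Suc D) / \<epsilon>)"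
    proof (intro prod_mono conjI)
      fix k assume k: "k \<in> {..D} - {j}"
      have "\<bar>1 / \<epsilon> - real k\<bar> \<le> 1 / \<epsilon> + real k / \<epsilon>"
      proof -
        have "real k \<le> real k / \<epsilon>" using \<epsilon> mult_left_le_one_le[of "real k" \<epsilon>] by (simp add: field_simps)
        moreover have "0 \<le> 1 / \<epsilon>" using \<epsilon> by simp
        ultimately show ?thesis by linarith
      qed
      also have "\<dots> \<le> real (Suc D) / \<epsilon>" using k \<epsilon> by (simp add: field_simps)
      finally have *: "\<bar>1 / \<epsilon> - real k\<bar> \<le> real (Suc D) / \<epsilon>" .
      have "1 \<le> \<bar>real j - real k\<bar>" using k by auto
      then have "\<bar>1 / \<epsilon> - real k\<bar> / \<bar>real j - real k\<bar> \<le> \<bar>1 / \<epsilon> - real k\<bar> / 1"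
        by (intro divide_left_mono) auto
      with * show "\<bar>1 / \<epsilon> - real k\<bar> / \<bar>real j - real k\<bar> \<le> real (Suc D) / \<epsilon>" by simp
    qed simp
    also have "\<dots> = (real (Suc D) / \<epsilon>) ^ D" using j by simp
    finally show "\<bar>poly (l j) (1 / \<epsilon>)\<bar> \<le> (real (Suc D) / \<epsilon>) ^ D" .
  qed
qed

text \<open>
  The weights reproduce the powers up to \<open>D\<close> and nearly annihilate the higher ones, so they truncate the
  exponential series; this replaces an expansion into Hermite polynomials.
\<close>

lemma weighted_exp_bound:
  fixes \<epsilon> K :: real and w :: "nat \<Rightarrow> real"
  assumes \<epsilon>: "0 < \<epsilon>" "\<epsilon> \<le> 1" and K: "0 \<le> K"
    and w1: "\<And>d. d \<le> D \<Longrightarrow> (\<Sum>j\<le>D. w j * (\<epsilon> * real j) ^ d) = 1"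
    and w2: "\<And>j. j \<le> D \<Longrightarrow> \<bar>w j\<bar> \<le> (real (Suc D) / \<epsilon>) ^ D"
  shows "(\<Sum>j\<le>D. \<Sum>k\<le>D. w j * w k * exp ((\<epsilon> * real j) * (\<epsilon> * real k) * K))
     \<le> (\<Sum>d\<le>D. K ^ d / fact d) + \<epsilon>\<^sup>2 * ((real (Suc D) ^ Suc D)\<^sup>2 * exp (K * (real D)\<^sup>2))"
proof -
  define S where "S d = (\<Sum>j\<le>D. w j * (\<epsilon> * real j) ^ d)" for d
  let ?t = "\<lambda>j. \<epsilon> * real j"
  \<comment> \<open>A weight can be as large as \<epsilon>^-D, but the power of the node contributes
    \<epsilon>^d. For d > D at least one factor \<epsilon> survives.\<close>
  have tail: "\<bar>S d\<bar> \<le> \<epsilon> * (real (Suc D) ^ Suc D * real D ^ d)" if d: "D < d" for d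
  proof -
    have "\<bar>S d\<bar> \<le> (\<Sum>j\<le>D. \<bar>w j * ?t j ^ d\<bar>)" unfolding S_def by (rule sum_abs)
    also have "\<dots> \<le> (\<Sum>j\<le>D. (real (Suc D) / \<epsilon>) ^ D * (\<epsilon> * real D) ^ d)"
      using \<epsilon> by (intro sum_mono) (auto simp: abs_mult simp del: of_nat_Suc intro!: mult_mono w2 power_mono)
    also have "\<dots> = real (Suc D) * ((real (Suc D) / \<epsilon>) ^ D * (\<epsilon> * real D) ^ d)"
      by simp
    also have "\<dots> = real (Suc D) ^ Suc D * real D ^ d * (\<epsilon> ^ d / \<epsilon> ^ D)"
      by (simp add: power_mult_distrib power_divide)
    also have "\<epsilon> ^ d / \<epsilon> ^ D = \<epsilon> ^ (d - D)"
      using \<epsilon> d by (simp add: power_diff)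
    also have "real (Suc D) ^ Suc D * real D ^ d * \<epsilon> ^ (d - D) \<le> real (Suc D) ^ Suc D * real D ^ d * \<epsilon>"
    proof (intro mult_left_mono)
      have "\<epsilon> ^ (d - D) \<le> \<epsilon> ^ 1" using \<epsilon> d by (intro power_decreasing) auto
      then show "\<epsilon> ^ (d - D) \<le> \<epsilon>" by simp
    qed auto
    finally show ?thesis by (simp add: mult_ac)
  qed
  have exps: "(\<lambda>d. x ^ d / fact d) sums exp x" for x :: real
    using exp_converges[of x] by (simp add: divide_inverse mult.commute)
  have "(\<lambda>d. \<Sum>j\<le>D. \<Sum>k\<le>D. w j * w k * ((?t j * ?t k * K) ^ d / fact d))
     sums (\<Sum>j\<le>D. \<Sum>k\<le>D. w j * w k * exp (?t j * ?t k * K))"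
    by (intro sums_sum sums_mult exps)
  \<comment> \<open>In each degree the kernel is a product in j and k, so the double sum is a
    square. Degrees up to D then enter with coefficient exactly 1, the higher ones with a
    coefficient of order \<epsilon>^2.\<close>
  moreover have "(\<Sum>j\<le>D. \<Sum>k\<le>D. w j * w k * ((?t j * ?t k * K) ^ d / fact d)) = K ^ d / fact d * (S d)\<^sup>2" for d
  proof -
    have "(S d)\<^sup>2 = (\<Sum>j\<le>D. \<Sum>k\<le>D. (w j * ?t j ^ d) * (w k * ?t k ^ d))"
      unfolding S_def power2_eq_square by (rule sum_product)
    then show ?thesis
      by (simp only: sum_distrib_left) (intro sum.cong refl, simp add: power_mult_distrib)
  qed
  ultimately have L: "(\<lambda>d. K ^ d / fact d * (S d)\<^sup>2) sums (\<Sum>j\<le>D. \<Sum>k\<le>D. w j * w k * exp (?t j * ?t k * K))"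
    by simp
  have "(\<lambda>d. if d \<in> {..D} then K ^ d / fact d else 0) sums (\<Sum>d\<le>D. K ^ d / fact d)"
    by (rule sums_If_finite_set) simp
  moreover have "(\<lambda>d. \<epsilon>\<^sup>2 * ((real (Suc D) ^ Suc D)\<^sup>2 * ((K * (real D)\<^sup>2) ^ d / fact d)))
      sums (\<epsilon>\<^sup>2 * ((real (Suc D) ^ Suc D)\<^sup>2 * exp (K * (real D)\<^sup>2)))"
    by (intro sums_mult exps)
  ultimately have R: "(\<lambda>d. (if d \<in> {..D} then K ^ d / fact d else 0)
        + \<epsilon>\<^sup>2 * ((real (Suc D) ^ Suc D)\<^sup>2 * ((K * (real D)\<^sup>2) ^ d / fact d)))
      sums ((\<Sum>d\<le>D. K ^ d / fact d) + \<epsilon>\<^sup>2 * ((real (Suc D) ^ Suc D)\<^sup>2 * exp (K * (real D)\<^sup>2)))"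
    by (rule sums_add)
  show ?thesis
  proof (rule sums_le[OF _ L R])
    fix d
    show "K ^ d / fact d * (S d)\<^sup>2 \<le> (if d \<in> {..D} then K ^ d / fact d else 0)
        + \<epsilon>\<^sup>2 * ((real (Suc D) ^ Suc D)\<^sup>2 * ((K * (real D)\<^sup>2) ^ d / fact d))"
    proof (cases "d \<le> D")
      case True
      then have "S d = 1" by (simp add: S_def w1)
      then show ?thesis using True K by simp
    next
      case False
      then have "(S d)\<^sup>2 \<le> (\<epsilon> * (real (Suc D) ^ Suc D * real D ^ d))\<^sup>2"
        using tail[of d] by (intro abs_le_square_iff[THEN iffD1] order.trans[OF _ abs_ge_self]) simp
      then have "K ^ d / fact d * (S d)\<^sup>2 \<le> K ^ d / fact d * (\<epsilon> * (real (Suc D) ^ Suc D * real D ^ d))\<^sup>2"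
        using K by (intro mult_left_mono) auto
      also have "\<dots> = \<epsilon>\<^sup>2 * ((real (Suc D) ^ Suc D)\<^sup>2 * ((K * (real D)\<^sup>2) ^ d / fact d))"
        by (simp only: power_mult_distrib) (simp add: power_mult[symmetric] mult.commute[of 2])
      finally show ?thesis using False by simp
    qed
  qed
qed

text \<open>Along a line a polynomial in many variables becomes one in \<open>t\<close> of no larger
  degree. The extrapolation weights can therefore express its value at mean \<open>x\<close> through
  its values at the shrunken means \<epsilon> j x.\<close>

lemma poly_funs_along_line:
  assumes f: "f \<in> poly_funs I D" and I: "finite I"
  obtains p :: "real poly" where "degree p \<le> D" "\<And>t. f (\<lambda>i\<in>I. t * x i + w i) = poly p t"
proof -
  from f obtain A c where A: "finite A" "\<And>a. a \<in> A \<Longrightarrow> (\<Sum>i\<in>I. a i) \<le> D"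
    and f: "f = (\<lambda>x. \<Sum>a\<in>A. c a * (\<Prod>i\<in>I. x i ^ a i))"
    unfolding poly_funs_def by auto
  define p where "p = (\<Sum>a\<in>A. smult (c a) (\<Prod>i\<in>I. [:w i, x i:] ^ a i))"
  show thesis
  proof
    have "degree (\<Prod>i\<in>I. [:w i, x i:] ^ a i) \<le> D" if a: "a \<in> A" for a
    proof -
      have "degree (\<Prod>i\<in>I. [:w i, x i:] ^ a i) \<le> (\<Sum>i\<in>I. degree ([:w i, x i:] ^ a i))"
        using degree_prod_sum_le[OF I] by (simp add: comp_def)
      also have "\<dots> \<le> (\<Sum>i\<in>I. a i)"
      proof (intro sum_mono)
        fix i
        have "degree ([:w i, x i:] ^ a i) \<le> degree [:w i, x i:] * a i" by (rule degree_power_le)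
        also have "\<dots> \<le> 1 * a i" by (intro mult_right_mono) auto
        finally show "degree ([:w i, x i:] ^ a i) \<le> a i" by simp
      qed
      finally show ?thesis using A(2)[OF a] by simp
    qed
    then show "degree p \<le> D"
      unfolding p_def by (intro degree_sum_le A) (auto intro: order.trans[OF degree_smult_le])
    show "f (\<lambda>i\<in>I. t * x i + w i) = poly p t" for t
      by (simp add: f p_def poly_sum poly_prod add.commute)
  qed
qed

lemma Cauchy_Schwarz_integral:
  fixes f g :: "'a \<Rightarrow> real"
  assumes f: "integrable M (\<lambda>x. (f x)\<^sup>2)" and g: "integrable M (\<lambda>x. (g x)\<^sup>2)"
    and fg: "integrable M (\<lambda>x. f x * g x)"
  shows "(\<integral>x. f x * g x \<partial>M)\<^sup>2 \<le> (\<integral>x. (f x)\<^sup>2 \<partial>M) * (\<integral>x. (g x)\<^sup>2 \<partial>M)"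
proof -
  let ?A = "\<integral>x. (f x)\<^sup>2 \<partial>M" and ?B = "\<integral>x. f x * g x \<partial>M" and ?C = "\<integral>x. (g x)\<^sup>2 \<partial>M"
  have q: "0 \<le> ?A * t\<^sup>2 + 2 * t * ?B * u + ?C * u\<^sup>2" for t u
  proof -
    have "0 \<le> (\<integral>x. (t * f x + u * g x)\<^sup>2 \<partial>M)" by simp
    also have "(\<integral>x. (t * f x + u * g x)\<^sup>2 \<partial>M) = (\<integral>x. t\<^sup>2 * (f x)\<^sup>2 + (2 * t * u) * (f x * g x) + u\<^sup>2 * (g x)\<^sup>2 \<partial>M)"
      by (intro Bochner_Integration.integral_cong refl) (simp add: power2_eq_square algebra_simps)
    also have "\<dots> = t\<^sup>2 * ?A + (2 * t * u) * ?B + u\<^sup>2 * ?C"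
      using f g fg by simp
    finally show ?thesis by (simp add: algebra_simps)
  qed
  have C: "0 \<le> ?C" and A: "0 \<le> ?A" by auto
  show ?thesis
  proof (cases "?C = 0")
    case True
    have "?B = 0"
    proof (rule ccontr)
      assume "?B \<noteq> 0"
      \<comment> \<open>At t = 1 and u = -(A + 1) / (2 B) the quadratic form takes the value
        -1.\<close>
      have "0 \<le> ?A * 1\<^sup>2 + 2 * 1 * ?B * (- (?A + 1) / (2 * ?B)) + ?C * (- (?A + 1) / (2 * ?B))\<^sup>2"
        by (rule q)
      with True \<open>?B \<noteq> 0\<close> show False by (simp add: field_simps)
    qed
    then show ?thesis using True by simp
  next
    case False
    then have "0 < ?C" using C by linarith
    have "0 \<le> ?A * ?C\<^sup>2 + 2 * ?C * ?B * (- ?B) + ?C * (- ?B)\<^sup>2" by (rule q)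
    also have "\<dots> = ?C * (?A * ?C - ?B\<^sup>2)" by (simp add: power2_eq_square algebra_simps)
    finally show ?thesis using \<open>0 < ?C\<close> by (simp add: zero_le_mult_iff)
  qed
qed

section \<open>Polynomials under Gaussian mixtures\<close>

lemma integrable_poly_normal:
  fixes s :: real and p :: "real poly"
  assumes s: "0 < s"
  shows "integrable (density lborel (normal_density 0 s)) (\<lambda>x. poly p x)"
proof -
  have "integrable lborel (\<lambda>x. \<Sum>i\<le>degree p. coeff p i * (normal_density 0 s x * (x - 0) ^ i))"
    by (intro Bochner_Integration.integrable_sum integrable_mult_right integrable_normal_moment s)
  also have "(\<lambda>x. \<Sum>i\<le>degree p. coeff p i * (normal_density 0 s x * (x - 0) ^ i)) = (\<lambda>x. normal_density 0 s x *\<^sub>R poly p x)"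
    by (intro ext) (simp add: poly_altdef sum_distrib_left mult_ac)
  finally show ?thesis
    by (subst integrable_density) (auto intro!: borel_measurable_continuous_onI continuous_intros)
qed

text \<open>Integration against a bind is first carried out for nonnegative functions. The signed
  case is assembled from the positive and negative parts, each of which is a finite sum because the
  mixing law has finite support.\<close>

lemma integral_bind_pmf_finite:
  fixes f :: "'b \<Rightarrow> real"
  assumes fin: "finite (set_pmf \<pi>)"
    and K: "\<And>a. prob_space (K a)" "\<And>a. sets (K a) = sets N"
    and f: "\<And>a. integrable (K a) f"
  shows "(\<integral>x. f x \<partial>(measure_pmf \<pi> \<bind> K)) = (\<Sum>a\<in>set_pmf \<pi>. pmf \<pi> a * (\<integral>x. f x \<partial>K a))"
proof -
  have meas: "f \<in> borel_measurable N"
    using borel_measurable_integrable[OF f[of undefined]] measurable_cong_sets[OF K(2) refl] by blast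
  have "K \<in> UNIV \<rightarrow> space (subprob_algebra N)"
    by (auto simp: space_subprob_algebra K intro: prob_space_imp_subprob_space)
  then have KN: "K \<in> measurable (measure_pmf \<pi>) (subprob_algebra N)"
    by simp
  have pos: "(\<integral>\<^sup>+x. ennreal (g x) \<partial>(measure_pmf \<pi> \<bind> K)) = ennreal (\<Sum>a\<in>set_pmf \<pi>. pmf \<pi> a * (\<integral>x. max 0 (g x) \<partial>K a))"
    if g: "\<And>a. integrable (K a) g" "g \<in> borel_measurable N" for g
  proof -
    have "(\<integral>\<^sup>+x. ennreal (g x) \<partial>(measure_pmf \<pi> \<bind> K)) = (\<integral>\<^sup>+a. \<integral>\<^sup>+x. ennreal (g x) \<partial>K a \<partial>measure_pmf \<pi>)"
      using g by (intro nn_integral_bind[OF _ KN]) auto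
    also have "\<dots> = (\<integral>\<^sup>+a. ennreal (\<integral>x. max 0 (g x) \<partial>K a) \<partial>measure_pmf \<pi>)"
    proof (intro nn_integral_cong)
      fix a
      have "(\<integral>\<^sup>+x. ennreal (g x) \<partial>K a) = (\<integral>\<^sup>+x. ennreal (max 0 (g x)) \<partial>K a)"
        by (intro nn_integral_cong) (simp add: max_def ennreal_neg)
      also have "\<dots> = ennreal (\<integral>x. max 0 (g x) \<partial>K a)"
        by (intro nn_integral_eq_integral integrable_max) (auto simp: g)
      finally show "(\<integral>\<^sup>+x. ennreal (g x) \<partial>K a) = ennreal (\<integral>x. max 0 (g x) \<partial>K a)" .
    qed
    also have "\<dots> = (\<Sum>a\<in>set_pmf \<pi>. ennreal (\<integral>x. max 0 (g x) \<partial>K a) * ennreal (pmf \<pi> a))"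
      by (intro nn_integral_measure_pmf_finite fin) simp
    also have "\<dots> = ennreal (\<Sum>a\<in>set_pmf \<pi>. pmf \<pi> a * (\<integral>x. max 0 (g x) \<partial>K a))"
      by (subst sum_ennreal[symmetric]) (auto simp: ennreal_mult' mult.commute intro!: sum.cong)
    finally show ?thesis .
  qed
  have int: "integrable (measure_pmf \<pi> \<bind> K) f"
  proof (rule integrableI_bounded)
    show "f \<in> borel_measurable (measure_pmf \<pi> \<bind> K)"
      using meas by (subst measurable_cong_sets[OF sets_bind[where N=N]]) (auto simp: K)
    show "(\<integral>\<^sup>+x. ennreal (norm (f x)) \<partial>(measure_pmf \<pi> \<bind> K)) < \<infinity>"
      using f meas by (subst pos) auto
  qed
  have "(\<integral>x. f x \<partial>(measure_pmf \<pi> \<bind> K)) =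
      (\<Sum>a\<in>set_pmf \<pi>. pmf \<pi> a * (\<integral>x. max 0 (f x) \<partial>K a)) - (\<Sum>a\<in>set_pmf \<pi>. pmf \<pi> a * (\<integral>x. max 0 (- f x) \<partial>K a))"
    unfolding real_lebesgue_integral_def[OF int] using f meas
    by (simp add: pos sum_nonneg)
  also have "\<dots> = (\<Sum>a\<in>set_pmf \<pi>. pmf \<pi> a * (\<integral>x. f x \<partial>K a))"
    unfolding sum_subtractf[symmetric]
  proof (intro sum.cong refl)
    fix a
    have "(\<integral>x. max 0 (f x) \<partial>K a) - (\<integral>x. max 0 (- f x) \<partial>K a) = (\<integral>x. max 0 (f x) - max 0 (- f x) \<partial>K a)"
      using f[of a] by (intro Bochner_Integration.integral_diff[symmetric] integrable_max) auto
    also have "\<dots> = (\<integral>x. f x \<partial>K a)" by (intro Bochner_Integration.integral_cong) auto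
    finally show "pmf \<pi> a * (\<integral>x. max 0 (f x) \<partial>K a) - pmf \<pi> a * (\<integral>x. max 0 (- f x) \<partial>K a) = pmf \<pi> a * (\<integral>x. f x \<partial>K a)"
      by (simp add: right_diff_distrib[symmetric])
  qed
  finally show ?thesis .
qed

text \<open>\<open>J\<close> indexes the independent Gaussian variables, \<open>I\<close> the
  observed coordinates, and \<open>s\<close> tells which variable a coordinate displays. In a
  symmetric matrix two coordinates may display the same variable; the observed law is then singular,
  which is why densities are always taken on \<open>J\<close>.\<close>

definition gauss_image :: "('j \<Rightarrow> real) \<Rightarrow> 'j set \<Rightarrow> 'i set \<Rightarrow> ('i \<Rightarrow> 'j) \<Rightarrow> ('j \<Rightarrow> real) \<Rightarrow> ('i \<Rightarrow> real) measure" where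
  "gauss_image \<sigma> J I s x = distr (gauss_prod \<sigma> J) (PiM I (\<lambda>_. borel)) (\<lambda>w. \<lambda>i\<in>I. x (s i) + w (s i))"

lemma sets_gauss_image[simp]: "sets (gauss_image \<sigma> J I s x) = sets (PiM I (\<lambda>_. borel))"
  by (simp add: gauss_image_def)

lemma borel_measurable_poly_funs:
  assumes "f \<in> poly_funs I D" shows "f \<in> borel_measurable (PiM I (\<lambda>_. borel))"
  using assms unfolding poly_funs_def by auto

context
  fixes \<sigma> :: "'j \<Rightarrow> real" and J :: "'j set" and I :: "'i set" and s :: "'i \<Rightarrow> 'j"
  assumes \<sigma>: "\<And>e. 0 < \<sigma> e" and J: "finite J" and I: "finite I" and s: "s \<in> I \<rightarrow> J"
begin

lemma measurable_feature[measurable]: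
  "(\<lambda>w. \<lambda>i\<in>I. x (s i) + w (s i)) \<in> measurable (gauss_prod \<sigma> J) (PiM I (\<lambda>_. borel))"
  unfolding measurable_gauss_prod1
proof (rule measurable_restrict)
  fix i assume "i \<in> I"
  then have "s i \<in> J" using s by auto
  then show "(\<lambda>w. x (s i) + w (s i)) \<in> borel_measurable (PiM J (\<lambda>_. borel))"
    by measurable
qed

lemma prob_space_gauss_image: "prob_space (gauss_image \<sigma> J I s x)"
  unfolding gauss_image_def
  by (intro prob_space.prob_space_distr prob_space_gauss_prod[OF \<sigma>] measurable_feature)

text \<open>The mean factors through \<open>s\<close> as well, so it may be added before the
  coordinates are duplicated. Laws with different means become images of one Gaussian space under
  one map and differ only in the tilt.\<close>

lemma gauss_image_tilt:
  "gauss_image \<sigma> J I s x = distr (density (gauss_prod \<sigma> J) (tilt \<sigma> J x)) (PiM I (\<lambda>_. borel)) (\<lambda>w. \<lambda>i\<in>I. w (s i))"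
  unfolding distr_gauss_prod_shift[OF \<sigma> J, symmetric] gauss_image_def
  apply (subst distr_distr)
  subgoal using measurable_feature[of "\<lambda>_. 0"] by (simp add: measurable_gauss_prod1)
  subgoal by (simp add: measurable_gauss_prod1)
  subgoal using s by (intro distr_cong) (auto simp: fun_eq_iff)
  done

text \<open>Collecting the factors along the fibres of \<open>s\<close> gives a product over
  \<open>J\<close> of univariate polynomials, one for each independent variable.\<close>

lemma integrable_monomial:
  "integrable (gauss_prod \<sigma> J) (\<lambda>w. \<Prod>i\<in>I. (x (s i) + w (s i)) ^ a i)"
proof -
  define p where "p e = (\<Prod>i\<in>{i\<in>I. s i = e}. [:x e, 1:] ^ a i)" for e
  interpret P: product_prob_space "\<lambda>e. density lborel (normal_density 0 (\<sigma> e))" J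
    by (rule product_prob_space_gauss[OF \<sigma>])
  have "integrable (gauss_prod \<sigma> J) (\<lambda>w. \<Prod>e\<in>J. poly (p e) (w e))"
    unfolding gauss_prod_def by (intro P.product_integrable_prod J integrable_poly_normal \<sigma>)
  also have "(\<lambda>w. \<Prod>e\<in>J. poly (p e) (w e)) = (\<lambda>w. \<Prod>i\<in>I. (x (s i) + w (s i)) ^ a i)"
  proof
    fix w :: "'j \<Rightarrow> real"
    have "(\<Prod>e\<in>J. poly (p e) (w e)) = (\<Prod>e\<in>J. \<Prod>i\<in>{i\<in>I. s i = e}. (x (s i) + w (s i)) ^ a i)"
      unfolding p_def by (intro prod.cong refl) (auto simp: poly_prod intro!: prod.cong)
    also have "\<dots> = (\<Prod>i\<in>I. (x (s i) + w (s i)) ^ a i)"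
      using s by (intro prod.group I J) auto
    finally show "(\<Prod>e\<in>J. poly (p e) (w e)) = (\<Prod>i\<in>I. (x (s i) + w (s i)) ^ a i)" .
  qed
  finally show ?thesis .
qed

lemma integrable_poly_funs:
  assumes f: "f \<in> poly_funs I D"
  shows "integrable (gauss_image \<sigma> J I s x) f" "integrable (gauss_image \<sigma> J I s x) (\<lambda>y. (f y)\<^sup>2)"
proof -
  from f obtain A c where A: "finite A" and f: "f = (\<lambda>x. \<Sum>a\<in>A. c a * (\<Prod>i\<in>I. x i ^ a i))"
    unfolding poly_funs_def by auto
  have f2: "(f y)\<^sup>2 = (\<Sum>a\<in>A. \<Sum>b\<in>A. c a * c b * (\<Prod>i\<in>I. y i ^ (a i + b i)))" for y
    unfolding f power2_eq_square sum_product
    by (intro sum.cong refl) (simp add: power_add prod.distrib)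
  have m: "integrable (gauss_image \<sigma> J I s x) (\<lambda>y. \<Prod>i\<in>I. y i ^ a i)" for a
    unfolding gauss_image_def
    by (subst integrable_distr_eq[OF measurable_feature]) (auto cong: prod.cong intro: integrable_monomial)
  show "integrable (gauss_image \<sigma> J I s x) f"
    unfolding f by (intro Bochner_Integration.integrable_sum integrable_mult_right m)
  show "integrable (gauss_image \<sigma> J I s x) (\<lambda>y. (f y)\<^sup>2)"
    unfolding f2 by (intro Bochner_Integration.integrable_sum integrable_mult_right m)
qed

text \<open>The right-hand side is the norm of the degree-\<open>D\<close> part of the likelihood
  ratio. That projection is never formed: integrated against polynomials of degree at most
  \<open>D\<close>, the likelihood ratio has the same effect as a weighted sum \<open>g\<close> of
  tilts at the shrunken means \<epsilon> j x, and the second moment of \<open>g\<close> is bounded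
  by the truncated exponentials up to an error of order \<epsilon>^2. Cauchy-Schwarz and \<epsilon>
  \<rightarrow> 0 finish the argument.\<close>

theorem Adv_gauss_mixture_le:
  fixes \<pi> :: "'a pmf" and x :: "'a \<Rightarrow> 'j \<Rightarrow> real"
  assumes fin: "finite (set_pmf \<pi>)"
    and K: "\<And>a b. a \<in> set_pmf \<pi> \<Longrightarrow> b \<in> set_pmf \<pi> \<Longrightarrow> 0 \<le> gauss_inner \<sigma> J (x a) (x b)"
  shows "Adv I D (measure_pmf \<pi> \<bind> (\<lambda>a. gauss_image \<sigma> J I s (x a))) (gauss_image \<sigma> J I s (\<lambda>_. 0))
    \<le> ereal (sqrt (\<Sum>a\<in>set_pmf \<pi>. \<Sum>b\<in>set_pmf \<pi>. pmf \<pi> a * pmf \<pi> b *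
          (\<Sum>d\<le>D. gauss_inner \<sigma> J (x a) (x b) ^ d / fact d)))"
  unfolding Adv_def
proof (rule SUP_least, simp only: ereal_less_eq)
  fix f assume f: "f \<in> poly_funs I D"
  let ?\<gamma> = "gauss_prod \<sigma> J" and ?P = "measure_pmf \<pi> \<bind> (\<lambda>a. gauss_image \<sigma> J I s (x a))"
  let ?Q = "gauss_image \<sigma> J I s (\<lambda>_. 0)"
  let ?S = "set_pmf \<pi>"
  let ?K = "\<lambda>a b. gauss_inner \<sigma> J (x a) (x b)"
  define A where "A = (\<Sum>a\<in>?S. \<Sum>b\<in>?S. pmf \<pi> a * pmf \<pi> b * (\<Sum>d\<le>D. ?K a b ^ d / fact d))"
  \<comment> \<open>What matters about \<open>B\<close> is that it does not depend on \<epsilon>: it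
    is the coefficient of the error term that disappears in the limit.\<close>
  define B where "B = (\<Sum>a\<in>?S. \<Sum>b\<in>?S. pmf \<pi> a * pmf \<pi> b * ((real (Suc D) ^ Suc D)\<^sup>2 * exp (?K a b * (real D)\<^sup>2)))"
  define h where "h w = f (\<lambda>i\<in>I. w (s i))" for w
  have fm: "f \<in> borel_measurable (PiM I (\<lambda>_. borel))" by (rule borel_measurable_poly_funs[OF f])
  have m0: "(\<lambda>w. \<lambda>i\<in>I. w (s i)) \<in> measurable ?\<gamma> (PiM I (\<lambda>_. borel))"
    using measurable_feature[of "\<lambda>_. 0"] by simp
  have m0': "(\<lambda>w. \<lambda>i\<in>I. w (s i) :: real) \<in> measurable (PiM J (\<lambda>_. borel)) (PiM I (\<lambda>_. borel))"
    using m0 by (simp add: measurable_gauss_prod1)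
  have hm: "h \<in> borel_measurable ?\<gamma>"
    unfolding h_def using measurable_compose[OF m0 fm] by simp
  have hm': "h \<in> borel_measurable (PiM J (\<lambda>_. borel))"
    using hm by (simp add: measurable_gauss_prod1)
  have Qh: "(\<integral>y. (f y)\<^sup>2 \<partial>?Q) = (\<integral>w. (h w)\<^sup>2 \<partial>?\<gamma>)"
    unfolding gauss_image_def using m0 fm by (subst integral_distr) (auto simp: h_def)
  have h2: "integrable ?\<gamma> (\<lambda>w. (h w)\<^sup>2)"
    using integrable_poly_funs(2)[OF f, of "\<lambda>_. 0"] m0 fm unfolding gauss_image_def
    by (subst (asm) integrable_distr_eq) (auto simp: h_def)
  have tm: "tilt \<sigma> J y \<in> borel_measurable ?\<gamma>" for y
    using borel_measurable_tilt[where x=y] by (simp add: measurable_gauss_prod1)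
  have ht: "integrable ?\<gamma> (\<lambda>w. h w * tilt \<sigma> J y w)"
    and hi: "(\<integral>w. h w * tilt \<sigma> J y w \<partial>?\<gamma>) = (\<integral>w. f (\<lambda>i\<in>I. y (s i) + w (s i)) \<partial>?\<gamma>)"
    and fi: "integrable ?\<gamma> (\<lambda>w. f (\<lambda>i\<in>I. y (s i) + w (s i)))" for y
  proof -
    have 1: "integrable (gauss_image \<sigma> J I s y) f" by (rule integrable_poly_funs(1)[OF f])
    then show "integrable ?\<gamma> (\<lambda>w. f (\<lambda>i\<in>I. y (s i) + w (s i)))"
      unfolding gauss_image_def by (subst (asm) integrable_distr_eq) (auto simp: fm)
    from 1 have "integrable (density ?\<gamma> (tilt \<sigma> J y)) h"
      unfolding gauss_image_tilt using m0' fm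
      by (subst (asm) integrable_distr_eq) (auto simp: h_def[abs_def] measurable_gauss_prod1)
    then show "integrable ?\<gamma> (\<lambda>w. h w * tilt \<sigma> J y w)"
      using hm tm by (subst (asm) integrable_density) (auto simp: mult.commute tilt_pos[THEN less_imp_le])
    have "(\<integral>w. f (\<lambda>i\<in>I. y (s i) + w (s i)) \<partial>?\<gamma>) = (\<integral>v. f v \<partial>gauss_image \<sigma> J I s y)"
      unfolding gauss_image_def by (rule integral_distr[OF measurable_feature fm, symmetric])
    also have "\<dots> = (\<integral>w. h w \<partial>density ?\<gamma> (tilt \<sigma> J y))"
      unfolding gauss_image_tilt h_def using m0' fm
      by (subst integral_distr) (auto simp: measurable_gauss_prod1)
    also have "\<dots> = (\<integral>w. h w * tilt \<sigma> J y w \<partial>?\<gamma>)"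
      using hm tm by (subst integral_density) (auto simp: mult.commute tilt_pos[THEN less_imp_le])
    finally show "(\<integral>w. h w * tilt \<sigma> J y w \<partial>?\<gamma>) = (\<integral>w. f (\<lambda>i\<in>I. y (s i) + w (s i)) \<partial>?\<gamma>)" by simp
  qed
  have EP: "(\<integral>y. f y \<partial>?P) = (\<Sum>a\<in>?S. pmf \<pi> a * (\<integral>w. f (\<lambda>i\<in>I. x a (s i) + w (s i)) \<partial>?\<gamma>))"
  proof -
    have "(\<integral>y. f y \<partial>?P) = (\<Sum>a\<in>?S. pmf \<pi> a * (\<integral>y. f y \<partial>gauss_image \<sigma> J I s (x a)))"
      by (rule integral_bind_pmf_finite[OF fin, where N="PiM I (\<lambda>_. borel)"])
         (auto intro: prob_space_gauss_image integrable_poly_funs[OF f])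
    then show ?thesis
      unfolding gauss_image_def by (simp add: integral_distr[OF measurable_feature fm])
  qed
  have main: "(\<integral>y. f y \<partial>?P)\<^sup>2 \<le> (\<integral>w. (h w)\<^sup>2 \<partial>?\<gamma>) * (A + \<epsilon>\<^sup>2 * B)" if \<epsilon>: "0 < \<epsilon>" "\<epsilon> \<le> 1" for \<epsilon> :: real
  proof -
    obtain w :: "nat \<Rightarrow> real" where w: "\<And>p. degree p \<le> D \<Longrightarrow> (\<Sum>j\<le>D. w j * poly p (\<epsilon> * real j)) = poly p 1"
      and w2: "\<And>j. j \<le> D \<Longrightarrow> \<bar>w j\<bar> \<le> (real (Suc D) / \<epsilon>) ^ D"
      using extrapolation_weights[OF \<epsilon>, of D] by metis
    have w1: "(\<Sum>j\<le>D. w j * (\<epsilon> * real j) ^ d) = 1" if "d \<le> D" for d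
      using w[of "monom 1 d"] that by (simp add: poly_monom degree_monom_eq)
    let ?y = "\<lambda>a j e. (\<epsilon> * real j) * x a e"
    let ?c = "\<lambda>u. pmf \<pi> (fst u) * w (snd u)"
    let ?U = "?S \<times> {..D}"
    let ?T = "\<lambda>u. tilt \<sigma> J (?y (fst u) (snd u))"
    define g where "g v = (\<Sum>u\<in>?U. ?c u * ?T u v)" for v
    have "(\<integral>v. f (\<lambda>i\<in>I. x a (s i) + v (s i)) \<partial>?\<gamma>) = (\<Sum>j\<le>D. w j * (\<integral>v. h v * tilt \<sigma> J (?y a j) v \<partial>?\<gamma>))" for a
    proof -
      have "f (\<lambda>i\<in>I. x a (s i) + v (s i)) = (\<Sum>j\<le>D. w j * f (\<lambda>i\<in>I. ?y a j (s i) + v (s i)))" for v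
      proof -
        obtain p where p: "degree p \<le> D" "\<And>t. f (\<lambda>i\<in>I. t * x a (s i) + v (s i)) = poly p t"
          by (rule poly_funs_along_line[OF f I, of "\<lambda>i. x a (s i)" "\<lambda>i. v (s i)"]) blast
        from w[OF p(1)] show ?thesis by (simp add: p(2)[symmetric])
      qed
      then have "(\<integral>v. f (\<lambda>i\<in>I. x a (s i) + v (s i)) \<partial>?\<gamma>)
          = (\<integral>v. (\<Sum>j\<le>D. w j * f (\<lambda>i\<in>I. ?y a j (s i) + v (s i))) \<partial>?\<gamma>)"
        by simp
      also have "\<dots> = (\<Sum>j\<le>D. w j * (\<integral>v. f (\<lambda>i\<in>I. ?y a j (s i) + v (s i)) \<partial>?\<gamma>))"
        by (subst Bochner_Integration.integral_sum) (auto intro!: integrable_mult_right fi[of "?y a _"])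
      finally show ?thesis by (simp only: hi)
    qed
    then have "(\<integral>y. f y \<partial>?P) = (\<Sum>a\<in>?S. \<Sum>j\<le>D. ?c (a, j) * (\<integral>v. h v * ?T (a, j) v \<partial>?\<gamma>))"
      unfolding EP by (simp add: sum_distrib_left mult_ac)
    also have "\<dots> = (\<Sum>u\<in>?U. ?c u * (\<integral>v. h v * ?T u v \<partial>?\<gamma>))"
      by (simp add: sum.cartesian_product case_prod_unfold)
    also have "\<dots> = (\<integral>v. h v * g v \<partial>?\<gamma>)"
    proof -
      have "(\<integral>v. h v * g v \<partial>?\<gamma>) = (\<integral>v. (\<Sum>u\<in>?U. ?c u * (h v * ?T u v)) \<partial>?\<gamma>)"
        unfolding g_def by (intro Bochner_Integration.integral_cong refl) (simp add: sum_distrib_left mult_ac)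
      also have "\<dots> = (\<Sum>u\<in>?U. ?c u * (\<integral>v. h v * ?T u v \<partial>?\<gamma>))"
        by (subst Bochner_Integration.integral_sum) (auto intro!: integrable_mult_right ht)
      finally show ?thesis by simp
    qed
    finally have 1: "(\<integral>y. f y \<partial>?P) = (\<integral>v. h v * g v \<partial>?\<gamma>)" .
    have hg: "integrable ?\<gamma> (\<lambda>v. h v * g v)"
    proof -
      have "(\<lambda>v. h v * g v) = (\<lambda>v. \<Sum>u\<in>?U. ?c u * (h v * ?T u v))"
        unfolding g_def by (intro ext) (simp add: sum_distrib_left mult_ac)
      then show ?thesis by (simp only:) (intro Bochner_Integration.integrable_sum integrable_mult_right ht)
    qed
    have g2: "(g v)\<^sup>2 = (\<Sum>u\<in>?U. \<Sum>u'\<in>?U. (?c u * ?c u') * (?T u v * ?T u' v))" for v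
      unfolding g_def power2_eq_square sum_product by (intro sum.cong refl) (simp add: mult_ac)
    have G: "has_bochner_integral ?\<gamma> (\<lambda>v. (g v)\<^sup>2)
       (\<Sum>u\<in>?U. \<Sum>u'\<in>?U. (?c u * ?c u') * exp (gauss_inner \<sigma> J (?y (fst u) (snd u)) (?y (fst u') (snd u'))))"
      unfolding g2 by (intro has_bochner_integral_sum has_bochner_integral_mult_right has_bochner_integral_tilt_mult \<sigma> J)
    have inn: "gauss_inner \<sigma> J (?y a j) (?y b k) = (\<epsilon> * real j) * (\<epsilon> * real k) * ?K a b" for a b j k
      unfolding gauss_inner_def by (simp add: sum_distrib_left mult_ac)
    have "(\<integral>v. (g v)\<^sup>2 \<partial>?\<gamma>) = (\<Sum>a\<in>?S. \<Sum>b\<in>?S. pmf \<pi> a * pmf \<pi> b *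
        (\<Sum>j\<le>D. \<Sum>k\<le>D. w j * w k * exp ((\<epsilon> * real j) * (\<epsilon> * real k) * ?K a b)))"
    proof -
      have "(\<integral>v. (g v)\<^sup>2 \<partial>?\<gamma>) = (\<Sum>a\<in>?S. \<Sum>j\<le>D. \<Sum>b\<in>?S. \<Sum>k\<le>D. pmf \<pi> a * pmf \<pi> b *
        (w j * w k * exp ((\<epsilon> * real j) * (\<epsilon> * real k) * ?K a b)))"
        unfolding has_bochner_integral_integral_eq[OF G] inn
        by (simp add: sum.cartesian_product' mult_ac)
      also have "\<dots> = (\<Sum>a\<in>?S. \<Sum>b\<in>?S. \<Sum>j\<le>D. \<Sum>k\<le>D. pmf \<pi> a * pmf \<pi> b *
        (w j * w k * exp ((\<epsilon> * real j) * (\<epsilon> * real k) * ?K a b)))"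
        by (intro sum.cong refl sum.swap)
      finally show ?thesis by (simp add: sum_distrib_left)
    qed
    also have "\<dots> \<le> (\<Sum>a\<in>?S. \<Sum>b\<in>?S. pmf \<pi> a * pmf \<pi> b *
        ((\<Sum>d\<le>D. ?K a b ^ d / fact d) + \<epsilon>\<^sup>2 * ((real (Suc D) ^ Suc D)\<^sup>2 * exp (?K a b * (real D)\<^sup>2))))"
      by (intro sum_mono mult_left_mono weighted_exp_bound \<epsilon> K w1 w2) auto
    also have "\<dots> = A + \<epsilon>\<^sup>2 * B"
      unfolding A_def B_def sum_distrib_left sum.distrib[symmetric]
      by (intro sum.cong refl) (simp add: distrib_left sum_distrib_left mult_ac)
    finally have 2: "(\<integral>v. (g v)\<^sup>2 \<partial>?\<gamma>) \<le> A + \<epsilon>\<^sup>2 * B" .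
    have "(\<integral>v. h v * g v \<partial>?\<gamma>)\<^sup>2 \<le> (\<integral>v. (h v)\<^sup>2 \<partial>?\<gamma>) * (\<integral>v. (g v)\<^sup>2 \<partial>?\<gamma>)"
      using G by (intro Cauchy_Schwarz_integral h2 hg) (auto simp: has_bochner_integral_iff)
    also have "\<dots> \<le> (\<integral>v. (h v)\<^sup>2 \<partial>?\<gamma>) * (A + \<epsilon>\<^sup>2 * B)"
      by (intro mult_left_mono 2) simp
    finally show ?thesis unfolding 1 .
  qed
  have sq: "(\<integral>y. f y \<partial>?P)\<^sup>2 \<le> (\<integral>w. (h w)\<^sup>2 \<partial>?\<gamma>) * A"
  proof (rule tendsto_lowerbound)
    show "((\<lambda>\<epsilon>. (\<integral>w. (h w)\<^sup>2 \<partial>?\<gamma>) * (A + \<epsilon>\<^sup>2 * B)) \<longlongrightarrow> (\<integral>w. (h w)\<^sup>2 \<partial>?\<gamma>) * A) (at_right 0)"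
      by (auto intro!: tendsto_eq_intros)
    show "\<forall>\<^sub>F \<epsilon> in at_right 0. (\<integral>y. f y \<partial>?P)\<^sup>2 \<le> (\<integral>w. (h w)\<^sup>2 \<partial>?\<gamma>) * (A + \<epsilon>\<^sup>2 * B)"
      using main by (intro eventually_at_rightI[of 0 1]) auto
  qed simp
  have A0: "0 \<le> A" unfolding A_def using K by (auto intro!: sum_nonneg mult_nonneg_nonneg)
  show "(\<integral>y. f y \<partial>?P) / sqrt (\<integral>y. (f y)\<^sup>2 \<partial>?Q) \<le> sqrt (\<Sum>a\<in>?S. \<Sum>b\<in>?S. pmf \<pi> a * pmf \<pi> b * (\<Sum>d\<le>D. ?K a b ^ d / fact d))"
    unfolding A_def[symmetric] Qh
  \<comment> \<open>If the second moment of \<open>h\<close> vanishes, the quotient is 0 by the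
    convention for division, and \<open>A0\<close> suffices.\<close>
  proof (cases "(\<integral>w. (h w)\<^sup>2 \<partial>?\<gamma>) = 0")
    case False
    then have "0 < (\<integral>w. (h w)\<^sup>2 \<partial>?\<gamma>)" by (simp add: order.strict_iff_order)
    moreover have "(\<integral>y. f y \<partial>?P) \<le> sqrt ((\<integral>w. (h w)\<^sup>2 \<partial>?\<gamma>) * A)"
      using sq by (rule real_le_rsqrt)
    ultimately show "(\<integral>y. f y \<partial>?P) / sqrt (\<integral>w. (h w)\<^sup>2 \<partial>?\<gamma>) \<le> sqrt A"
      by (simp add: real_sqrt_mult field_simps)
  qed (simp add: A0)
qed

end

section \<open>The hidden informative sample problem as a Gaussian mixture\<close>

lemma measurable_pmf_kernel:
  assumes "\<And>a. prob_space (K a)" "\<And>a. sets (K a) = sets N"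
  shows "K \<in> measurable (measure_pmf \<pi>) (subprob_algebra N)"
  using assms by (auto simp: space_subprob_algebra intro: prob_space_imp_subprob_space)

lemma emeasure_bind_pmf:
  assumes "\<And>a. prob_space (K a)" "\<And>a. sets (K a) = sets N" "A \<in> sets N"
  shows "emeasure (measure_pmf \<pi> \<bind> K) A = (\<integral>\<^sup>+a. emeasure (K a) A \<partial>measure_pmf \<pi>)"
  by (intro emeasure_bind[OF _ measurable_pmf_kernel]) (use assms in auto)

lemma sets_bind_pmf:
  assumes "\<And>a. prob_space (K a)" "\<And>a. sets (K a) = sets N"
  shows "sets (measure_pmf \<pi> \<bind> K) = sets N"
  by (rule sets_bind) (use assms in auto)

lemma prob_space_bind_pmf:
  assumes "\<And>a. prob_space (K a)" "\<And>a. sets (K a) = sets N"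
  shows "prob_space (measure_pmf \<pi> \<bind> K)"
  by (rule prob_space.prob_space_bind[OF prob_space_measure_pmf _ measurable_pmf_kernel])
     (use assms in auto)

lemma measurable_flatten_samples:
  "flatten_samples M I \<in> measurable (PiM {..<M} (\<lambda>_. PiM I (\<lambda>_. borel))) (PiM ({..<M} \<times> I) (\<lambda>_. borel))"
  unfolding flatten_samples_def
proof (rule measurable_restrict)
  fix ji assume "ji \<in> {..<M} \<times> I"
  then obtain j i where ji: "ji = (j, i)" "j \<in> {..<M}" "i \<in> I" by auto
  show "(\<lambda>y. case ji of (j, i) \<Rightarrow> y j i) \<in> borel_measurable (PiM {..<M} (\<lambda>_. PiM I (\<lambda>_. borel)))"
    unfolding ji(1) prod.case
    by (rule measurable_compose[OF measurable_component_singleton[OF ji(2)] measurable_component_singleton[OF ji(3)]])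
qed

lemma measurable_flatten_samples':
  assumes "\<And>j. j < M \<Longrightarrow> sets (R j) = sets (PiM I (\<lambda>_. borel))"
  shows "flatten_samples M I \<in> measurable (PiM {..<M} R) (PiM ({..<M} \<times> I) (\<lambda>_. borel))"
  using measurable_flatten_samples
  by (subst measurable_cong_sets[OF sets_PiM_cong[OF refl] refl]) (use assms in auto)

text \<open>The two measures are compared on boxes. There only the factor of component
  \<open>k\<close> depends on \<open>a\<close>, so the average over \<open>a\<close> passes through
  the product.\<close>

lemma PiM_bind_pmf_component:
  fixes \<pi> :: "'a pmf" and K :: "'a \<Rightarrow> 'b measure"
  assumes fin: "finite L" and k: "k \<in> L"
    and K: "\<And>a. prob_space (K a)" "\<And>a. sets (K a) = sets N"
    and Q: "prob_space Q" "sets Q = sets N"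
  shows "PiM L (\<lambda>j. if j = k then measure_pmf \<pi> \<bind> K else Q)
       = measure_pmf \<pi> \<bind> (\<lambda>a. PiM L (\<lambda>j. if j = k then K a else Q))"
proof -
  let ?R = "\<lambda>j. if j = k then measure_pmf \<pi> \<bind> K else Q"
  let ?Ra = "\<lambda>a j. if j = k then K a else Q"
  note B = prob_space_bind_pmf[of K N \<pi>, OF K] sets_bind_pmf[of K N \<pi>, OF K]
  interpret R: product_prob_space ?R L
    by (rule product_prob_spaceI) (use B Q in auto)
  have Ra: "product_prob_space (?Ra a)" for a
    by (rule product_prob_spaceI) (use K Q in auto)
  have pr: "prob_space (PiM L (?Ra a))" for a
    by (rule prob_space_PiM) (use K Q in auto)
  have se: "sets (PiM L (?Ra a)) = sets (PiM L (\<lambda>_. N))" for a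
    by (rule sets_PiM_cong) (use K Q in auto)
  have se': "sets (PiM L ?R) = sets (PiM L (\<lambda>_. N))"
    by (rule sets_PiM_cong) (use B Q in auto)
  show ?thesis
  proof (rule R.PiM_eqI[OF fin, symmetric])
    show "sets (measure_pmf \<pi> \<bind> (\<lambda>a. PiM L (?Ra a))) = sets (PiM L ?R)"
      unfolding se' by (rule sets_bind_pmf[OF pr se])
    fix A assume A: "\<And>i. i \<in> L \<Longrightarrow> A i \<in> sets (?R i)"
    then have A': "A i \<in> sets N" if "i \<in> L" for i
      using that B Q by (metis (full_types))
    have box: "Pi\<^sub>E L A \<in> sets (PiM L (\<lambda>_. N))"
      using A' fin by (intro sets_PiM_I_finite) auto
    have "emeasure (measure_pmf \<pi> \<bind> (\<lambda>a. PiM L (?Ra a))) (Pi\<^sub>E L A)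
        = (\<integral>\<^sup>+a. emeasure (PiM L (?Ra a)) (Pi\<^sub>E L A) \<partial>measure_pmf \<pi>)"
      by (rule emeasure_bind_pmf[OF pr se box])
    also have "\<dots> = (\<integral>\<^sup>+a. emeasure (K a) (A k) * (\<Prod>j\<in>L - {k}. emeasure Q (A j)) \<partial>measure_pmf \<pi>)"
    proof (intro nn_integral_cong)
      fix a
      interpret Ra: product_prob_space "?Ra a" L by (rule Ra)
      have "emeasure (PiM L (?Ra a)) (Pi\<^sub>E L A) = (\<Prod>j\<in>L. emeasure (?Ra a j) (A j))"
        using A' K Q by (intro Ra.emeasure_PiM fin) auto
      also have "\<dots> = emeasure (K a) (A k) * (\<Prod>j\<in>L - {k}. emeasure (?Ra a j) (A j))"
        by (subst prod.remove[OF fin k]) simp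
      also have "(\<Prod>j\<in>L - {k}. emeasure (?Ra a j) (A j)) = (\<Prod>j\<in>L - {k}. emeasure Q (A j))"
        by (intro prod.cong) auto
      finally show "emeasure (PiM L (?Ra a)) (Pi\<^sub>E L A) = emeasure (K a) (A k) * (\<Prod>j\<in>L - {k}. emeasure Q (A j))" .
    qed
    also have "\<dots> = emeasure (measure_pmf \<pi> \<bind> K) (A k) * (\<Prod>j\<in>L - {k}. emeasure Q (A j))"
      by (simp add: nn_integral_multc emeasure_bind_pmf[OF K A'[OF k]])
    also have "\<dots> = emeasure (?R k) (A k) * (\<Prod>j\<in>L - {k}. emeasure (?R j) (A j))"
      by (intro arg_cong2[where f="(*)"] prod.cong) auto
    also have "\<dots> = (\<Prod>j\<in>L. emeasure (?R j) (A j))"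
      by (rule prod.remove[OF fin k, symmetric])
    finally show "emeasure (measure_pmf \<pi> \<bind> (\<lambda>a. PiM L (?Ra a))) (Pi\<^sub>E L A) = (\<Prod>j\<in>L. emeasure (?R j) (A j))" .
  qed
qed

lemma sets_samples_law[simp]: "sets (samples_law M I R) = sets (PiM ({..<M} \<times> I) (\<lambda>_. borel))"
  by (simp add: samples_law_def)

lemma prob_space_samples_law:
  assumes "\<And>j. j < M \<Longrightarrow> prob_space (R j)" "\<And>j. j < M \<Longrightarrow> sets (R j) = sets (PiM I (\<lambda>_. borel))"
  shows "prob_space (samples_law M I R)"
  unfolding samples_law_def
  by (intro prob_space.prob_space_distr prob_space_PiM measurable_flatten_samples') (use assms in auto)

context
  fixes \<sigma> :: "'j \<Rightarrow> real" and J :: "'j set" and I :: "'i set" and s :: "'i \<Rightarrow> 'j"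
  assumes \<sigma>: "\<And>e. 0 < \<sigma> e" and J: "finite J" and I: "finite I" and s: "s \<in> I \<rightarrow> J"
begin

text \<open>A box in the flattened space pulls back to a product of boxes, and both measures assign
  to it the same double product.\<close>

lemma distr_flatten_gauss_prod:
  "distr (PiM {..<M} (\<lambda>_. gauss_prod \<sigma> J)) (PiM ({..<M} \<times> J) (\<lambda>_. borel)) (flatten_samples M J)
     = gauss_prod (\<lambda>(j, e). \<sigma> e) ({..<M} \<times> J)"
proof -
  let ?N = "\<lambda>e. density lborel (normal_density 0 (\<sigma> e))"
  let ?\<sigma>' = "\<lambda>(j :: nat, e). \<sigma> e"
  let ?N' = "\<lambda>ji. density lborel (normal_density 0 (?\<sigma>' ji))"
  interpret N': product_prob_space ?N' "{..<M} \<times> J"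
    by (rule product_prob_spaceI, rule prob_space_normal_density) (auto simp: \<sigma>)
  interpret N: product_prob_space ?N J
    by (rule product_prob_space_gauss[OF \<sigma>])
  interpret G: product_prob_space "\<lambda>_ :: nat. gauss_prod \<sigma> J" "{..<M}"
    by (rule product_prob_spaceI) (rule prob_space_gauss_prod[OF \<sigma>])
  have fl: "flatten_samples M J \<in> measurable (PiM {..<M} (\<lambda>_. gauss_prod \<sigma> J)) (PiM ({..<M} \<times> J) (\<lambda>_. borel))"
    by (rule measurable_flatten_samples') (simp add: sets_gauss_prod)
  show ?thesis
    unfolding gauss_prod_def[of "\<lambda>(j, e). \<sigma> e"]
  proof (rule N'.PiM_eqI)
    show "finite ({..<M} \<times> J)" using J by simp
    show "sets (distr (PiM {..<M} (\<lambda>_. gauss_prod \<sigma> J)) (PiM ({..<M} \<times> J) (\<lambda>_. borel)) (flatten_samples M J))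
        = sets (PiM ({..<M} \<times> J) ?N')"
      unfolding sets_distr by (rule sets_PiM_cong) auto
    fix A assume "\<And>i. i \<in> {..<M} \<times> J \<Longrightarrow> A i \<in> sets (?N' i)"
    then have A: "\<And>i. i \<in> {..<M} \<times> J \<Longrightarrow> A i \<in> sets borel" by simp
    have Aj: "Pi\<^sub>E J (\<lambda>e. A (j, e)) \<in> sets (PiM J (\<lambda>_. borel))" if "j < M" for j
      using A that J by (intro sets_PiM_I_finite) auto
    have "emeasure (distr (PiM {..<M} (\<lambda>_. gauss_prod \<sigma> J)) (PiM ({..<M} \<times> J) (\<lambda>_. borel)) (flatten_samples M J)) (Pi\<^sub>E ({..<M} \<times> J) A)
       = emeasure (PiM {..<M} (\<lambda>_. gauss_prod \<sigma> J)) (flatten_samples M J -` (Pi\<^sub>E ({..<M} \<times> J) A) \<inter> space (PiM {..<M} (\<lambda>_. gauss_prod \<sigma> J)))"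
      using A J by (intro emeasure_distr fl sets_PiM_I_finite) auto
    also have "flatten_samples M J -` (Pi\<^sub>E ({..<M} \<times> J) A) \<inter> space (PiM {..<M} (\<lambda>_. gauss_prod \<sigma> J))
       = Pi\<^sub>E {..<M} (\<lambda>j. Pi\<^sub>E J (\<lambda>e. A (j, e)))"
      unfolding flatten_samples_def space_PiM space_gauss_prod
      by (auto simp: PiE_iff extensional_def)
    also have "emeasure (PiM {..<M} (\<lambda>_. gauss_prod \<sigma> J)) \<dots> = (\<Prod>j<M. emeasure (gauss_prod \<sigma> J) (Pi\<^sub>E J (\<lambda>e. A (j, e))))"
      using Aj by (intro G.emeasure_PiM) (auto simp: sets_gauss_prod)
    also have "\<dots> = (\<Prod>j<M. \<Prod>e\<in>J. emeasure (?N e) (A (j, e)))"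
      unfolding gauss_prod_def using A by (intro prod.cong refl N.emeasure_PiM J) auto
    also have "\<dots> = (\<Prod>i\<in>{..<M} \<times> J. emeasure (?N' i) (A i))"
      by (simp add: prod.cartesian_product case_prod_unfold)
    finally show "emeasure (distr (PiM {..<M} (\<lambda>_. gauss_prod \<sigma> J)) (PiM ({..<M} \<times> J) (\<lambda>_. borel)) (flatten_samples M J)) (Pi\<^sub>E ({..<M} \<times> J) A)
      = (\<Prod>i\<in>{..<M} \<times> J. emeasure (?N' i) (A i))" .
  qed
qed

text \<open>Independent Gaussian samples form one Gaussian image again, now with pairs of a sample
  and a variable as the independent variables. This is what makes the advantage bound for mixtures
  applicable to the hidden problem.\<close>

lemma samples_law_gauss_image:
  "samples_law M I (\<lambda>j. gauss_image \<sigma> J I s (y j))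
    = gauss_image (\<lambda>(j, e). \<sigma> e) ({..<M} \<times> J) ({..<M} \<times> I) (\<lambda>(j, i). (j, s i)) (\<lambda>(j, e). y j e)"
proof -
  let ?\<Gamma> = "PiM {..<M} (\<lambda>_. gauss_prod \<sigma> J)"
  let ?F = "\<lambda>g. \<lambda>j\<in>{..<M}. (\<lambda>w. \<lambda>i\<in>I. y j (s i) + w (s i)) (g j)"
  have fm: "(\<lambda>w. \<lambda>i\<in>I. y j (s i) + w (s i)) \<in> measurable (gauss_prod \<sigma> J) (PiM I (\<lambda>_. borel))" for j
    by (rule measurable_feature[OF \<sigma> J I s])
  have 1: "PiM {..<M} (\<lambda>j. gauss_image \<sigma> J I s (y j)) = distr ?\<Gamma> (PiM {..<M} (\<lambda>_. PiM I (\<lambda>_. borel))) ?F"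
    unfolding gauss_image_def
    by (rule distr_PiM_finite[symmetric]) (auto intro: prob_space_gauss_prod[OF \<sigma>] fm)
  have Fm: "?F \<in> measurable ?\<Gamma> (PiM {..<M} (\<lambda>_. PiM I (\<lambda>_. borel)))"
  proof (rule measurable_restrict)
    fix j assume "j \<in> {..<M}"
    then show "(\<lambda>g. (\<lambda>w. \<lambda>i\<in>I. y j (s i) + w (s i)) (g j)) \<in> measurable ?\<Gamma> (PiM I (\<lambda>_. borel))"
      by (rule measurable_compose[OF measurable_component_singleton[where M="\<lambda>_. gauss_prod \<sigma> J"] fm[of j]])
  qed
  have fl: "flatten_samples M J \<in> measurable ?\<Gamma> (PiM ({..<M} \<times> J) (\<lambda>_. borel))"
    by (rule measurable_flatten_samples') (simp add: sets_gauss_prod)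
  have Gm: "(\<lambda>w. \<lambda>i\<in>{..<M} \<times> I. (case (case i of (j, i) \<Rightarrow> (j, s i)) of (j, e) \<Rightarrow> y j e) + w (case i of (j, i) \<Rightarrow> (j, s i)))
       \<in> measurable (PiM ({..<M} \<times> J) (\<lambda>_. borel)) (PiM ({..<M} \<times> I) (\<lambda>_. borel))"
  proof (rule measurable_restrict)
    fix i assume "i \<in> {..<M} \<times> I"
    then have "(case i of (j, i) \<Rightarrow> (j, s i)) \<in> {..<M} \<times> J" using s by auto
    then show "(\<lambda>w. (case (case i of (j, i) \<Rightarrow> (j, s i)) of (j, e) \<Rightarrow> y j e) + w (case i of (j, i) \<Rightarrow> (j, s i)))
       \<in> borel_measurable (PiM ({..<M} \<times> J) (\<lambda>_. borel))"
      by measurable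
  qed
  have "samples_law M I (\<lambda>j. gauss_image \<sigma> J I s (y j)) = distr ?\<Gamma> (PiM ({..<M} \<times> I) (\<lambda>_. borel)) (flatten_samples M I \<circ> ?F)"
    unfolding samples_law_def 1 by (rule distr_distr[OF measurable_flatten_samples Fm])
  also have "\<dots> = distr ?\<Gamma> (PiM ({..<M} \<times> I) (\<lambda>_. borel))
     ((\<lambda>w. \<lambda>i\<in>{..<M} \<times> I. (case (case i of (j, i) \<Rightarrow> (j, s i)) of (j, e) \<Rightarrow> y j e) + w (case i of (j, i) \<Rightarrow> (j, s i))) \<circ> flatten_samples M J)"
    using s by (intro distr_cong refl) (auto simp: flatten_samples_def fun_eq_iff)
  also have "\<dots> = gauss_image (\<lambda>(j, e). \<sigma> e) ({..<M} \<times> J) ({..<M} \<times> I) (\<lambda>(j, i). (j, s i)) (\<lambda>(j, e). y j e)"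
    unfolding gauss_image_def distr_flatten_gauss_prod[symmetric]
    by (rule distr_distr[OF Gm fl, symmetric])
  finally show ?thesis .
qed

lemma hidden_null_gauss_image:
  "hidden_null M I (gauss_image \<sigma> J I s (\<lambda>_. 0))
    = gauss_image (\<lambda>(j, e). \<sigma> e) ({..<M} \<times> J) ({..<M} \<times> I) (\<lambda>(j, i). (j, s i)) (\<lambda>_. 0)"
  using samples_law_gauss_image[of M "\<lambda>_ _. 0"] by (simp add: hidden_null_def case_prod_unfold)

text \<open>The hidden position and the random mean merge into a single mixing law; the mean
  belonging to (\<kappa>, a) is supported on block \<kappa>.\<close>

lemma hidden_planted_gauss_image:
  assumes M: "0 < M"
  shows "hidden_planted M I (measure_pmf \<pi> \<bind> (\<lambda>a. gauss_image \<sigma> J I s (x a))) (gauss_image \<sigma> J I s (\<lambda>_. 0))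
    = measure_pmf (pair_pmf (pmf_of_set {..<M}) \<pi>) \<bind> (\<lambda>(\<kappa>, a).
        gauss_image (\<lambda>(j, e). \<sigma> e) ({..<M} \<times> J) ({..<M} \<times> I) (\<lambda>(j, i). (j, s i)) (\<lambda>(j, e). if j = \<kappa> then x a e else 0))"
    (is "_ = measure_pmf _ \<bind> (\<lambda>(\<kappa>, a). ?G \<kappa> a)")
proof -
  let ?K = "\<lambda>a. gauss_image \<sigma> J I s (x a)" and ?Q = "gauss_image \<sigma> J I s (\<lambda>_. 0)"
  let ?P = "measure_pmf \<pi> \<bind> ?K"
  let ?S = "\<lambda>\<kappa>. samples_law M I (\<lambda>j. if j = \<kappa> then ?P else ?Q)"
  note pg = prob_space_gauss_image[OF \<sigma> J I s]
  have Pp: "prob_space ?P" and Ps: "sets ?P = sets (PiM I (\<lambda>_. borel))"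
    by (rule prob_space_bind_pmf[OF pg sets_gauss_image], rule sets_bind_pmf[OF pg sets_gauss_image])
  have pg': "prob_space (?G \<kappa> a)" for \<kappa> a
    by (rule prob_space_gauss_image) (use \<sigma> J I s in auto)
  have pS: "prob_space (?S \<kappa>)" for \<kappa>
    by (rule prob_space_samples_law) (auto simp: Pp Ps pg)
  have S: "?S \<kappa> = measure_pmf \<pi> \<bind> ?G \<kappa>" if \<kappa>: "\<kappa> < M" for \<kappa>
  proof -
    let ?Ra = "\<lambda>a j. if j = \<kappa> then ?K a else ?Q"
    have "PiM {..<M} (\<lambda>j. if j = \<kappa> then ?P else ?Q) = measure_pmf \<pi> \<bind> (\<lambda>a. PiM {..<M} (?Ra a))"
      using \<kappa> by (intro PiM_bind_pmf_component[where N="PiM I (\<lambda>_. borel)"] pg) auto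
    moreover have "distr (measure_pmf \<pi> \<bind> (\<lambda>a. PiM {..<M} (?Ra a))) (PiM ({..<M} \<times> I) (\<lambda>_. borel)) (flatten_samples M I)
        = measure_pmf \<pi> \<bind> (\<lambda>a. distr (PiM {..<M} (?Ra a)) (PiM ({..<M} \<times> I) (\<lambda>_. borel)) (flatten_samples M I))"
    proof (rule distr_bind)
      show "(\<lambda>a. PiM {..<M} (?Ra a)) \<in> measurable (measure_pmf \<pi>) (subprob_algebra (PiM {..<M} (\<lambda>_. PiM I (\<lambda>_. borel))))"
        by (rule measurable_pmf_kernel) (auto intro!: prob_space_PiM pg sets_PiM_cong split: if_splits)
    qed (auto intro: measurable_flatten_samples)
    ultimately have "?S \<kappa> = measure_pmf \<pi> \<bind> (\<lambda>a. samples_law M I (?Ra a))"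
      by (simp add: samples_law_def)
    also have "(\<lambda>a. samples_law M I (?Ra a)) = ?G \<kappa>"
    proof
      fix a
      have "?Ra a = (\<lambda>j. gauss_image \<sigma> J I s (if j = \<kappa> then x a else (\<lambda>_. 0)))" by auto
      then have "samples_law M I (?Ra a) = gauss_image (\<lambda>(j, e). \<sigma> e) ({..<M} \<times> J) ({..<M} \<times> I) (\<lambda>(j, i). (j, s i))
          (\<lambda>(j, e). (if j = \<kappa> then x a else (\<lambda>_. 0)) e)"
        by (simp only: samples_law_gauss_image)
      also have "(\<lambda>(j, e). (if j = \<kappa> then x a else (\<lambda>_. 0)) e) = (\<lambda>(j, e). if j = \<kappa> then x a e else 0)"
        by auto
      finally show "samples_law M I (?Ra a) = ?G \<kappa> a" .
    qed
    finally show ?thesis .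
  qed
  show ?thesis
  proof (rule measure_eqI)
    let ?N = "PiM ({..<M} \<times> I) (\<lambda>_. borel) :: (nat \<times> 'i \<Rightarrow> real) measure"
    show s1: "sets (hidden_planted M I ?P ?Q) = sets (measure_pmf (pair_pmf (pmf_of_set {..<M}) \<pi>) \<bind> (\<lambda>(\<kappa>, a). ?G \<kappa> a))"
      unfolding hidden_planted_def
      by (subst (1 2) sets_bind_pmf[where N="?N"]) (auto intro: pS pg')
    fix A assume "A \<in> sets (hidden_planted M I ?P ?Q)"
    then have A: "A \<in> sets ?N"
      unfolding hidden_planted_def by (subst (asm) sets_bind_pmf[where N="?N"]) (auto intro: pS)
    have "emeasure (hidden_planted M I ?P ?Q) A = (\<integral>\<^sup>+\<kappa>. emeasure (?S \<kappa>) A \<partial>measure_pmf (pmf_of_set {..<M}))"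
      unfolding hidden_planted_def by (rule emeasure_bind_pmf[OF pS sets_samples_law A])
    also have "\<dots> = (\<integral>\<^sup>+\<kappa>. \<integral>\<^sup>+a. emeasure (?G \<kappa> a) A \<partial>measure_pmf \<pi> \<partial>measure_pmf (pmf_of_set {..<M}))"
    \<comment> \<open>The decomposition \<open>S\<close> is available for \<kappa> < M only, so the
      integrands are compared on the support of the uniform law.\<close>
    proof (rule nn_integral_cong_AE, rule AE_pmfI)
      fix \<kappa> assume "\<kappa> \<in> set_pmf (pmf_of_set {..<M})"
      then have \<kappa>: "\<kappa> < M" using M by (subst (asm) set_pmf_of_set) auto
      show "emeasure (?S \<kappa>) A = (\<integral>\<^sup>+a. emeasure (?G \<kappa> a) A \<partial>measure_pmf \<pi>)"
        unfolding S[OF \<kappa>] by (intro emeasure_bind_pmf[OF pg' _ A]) simp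
    qed
    also have "\<dots> = emeasure (measure_pmf (pair_pmf (pmf_of_set {..<M}) \<pi>) \<bind> (\<lambda>(\<kappa>, a). ?G \<kappa> a)) A"
      by (subst emeasure_bind_pmf[where N="?N"]) (auto intro: pg' A simp: nn_integral_pair_pmf')
    finally show "emeasure (hidden_planted M I ?P ?Q) A = emeasure (measure_pmf (pair_pmf (pmf_of_set {..<M}) \<pi>) \<bind> (\<lambda>(\<kappa>, a). ?G \<kappa> a)) A" .
  qed
qed

end

section \<open>Advantage in the planted submatrix model\<close>

definition entry_sd :: "nat \<times> nat \<Rightarrow> real" where
  "entry_sd = (\<lambda>(i, j). if i = j then sqrt 2 else 1)"

definition upper :: "nat \<Rightarrow> (nat \<times> nat) set" where
  "upper n = {(i, j). i \<le> j \<and> j < n}"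

definition sort_pair :: "nat \<times> nat \<Rightarrow> nat \<times> nat" where
  "sort_pair = (\<lambda>(i, j). (min i j, max i j))"

definition overlap :: "nat \<Rightarrow> (nat \<Rightarrow> bool) \<Rightarrow> (nat \<Rightarrow> bool) \<Rightarrow> real" where
  "overlap n \<theta> \<theta>' = (\<Sum>i<n. of_bool (\<theta> i \<and> \<theta>' i))"

text \<open>Expectation over two independent replicas \<theta> and \<theta>'. As a finite sum it can
  be exchanged freely with the sums over degrees and matrix entries.\<close>

definition pair_mean :: "nat \<Rightarrow> real \<Rightarrow> ((nat \<Rightarrow> bool) \<Rightarrow> (nat \<Rightarrow> bool) \<Rightarrow> real) \<Rightarrow> real" where
  "pair_mean n \<rho> f = (\<Sum>\<theta>\<in>set_pmf (theta_pmf n \<rho>). \<Sum>\<theta>'\<in>set_pmf (theta_pmf n \<rho>).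
     pmf (theta_pmf n \<rho>) \<theta> * pmf (theta_pmf n \<rho>) \<theta>' * f \<theta> \<theta>')"

lemma entry_sd_pos: "0 < entry_sd e"
  by (auto simp: entry_sd_def split: prod.splits)

lemma finite_upper: "finite (upper n)"
  by (rule finite_subset[of _ "{..<n} \<times> {..<n}"]) (auto simp: upper_def)

lemma sort_pair_entries: "sort_pair \<in> entries n \<rightarrow> upper n"
  by (auto simp: sort_pair_def upper_def)

lemma finite_set_theta_pmf: "finite (set_pmf (theta_pmf n \<rho>))"
  unfolding theta_pmf_def by (rule finite_subset[OF set_Pi_pmf_subset']) auto

lemma signal_sort_pair: "signal lam \<theta> (sort_pair e) = signal lam \<theta> e"
  by (cases e) (auto simp: signal_def sort_pair_def min_def max_def)

lemma noise_law_gauss_image: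
  "noise_law n = gauss_image entry_sd (upper n) (entries n) sort_pair (\<lambda>_. 0)"
proof -
  have "(\<lambda>(i, j). density lborel (\<lambda>x. ennreal (normal_density 0 (if i = j then sqrt 2 else 1) x)))
     = (\<lambda>e. density lborel (\<lambda>x. ennreal (normal_density 0 (entry_sd e) x)))"
    by (auto simp: entry_sd_def)
  then show ?thesis
    unfolding noise_law_def gauss_image_def gauss_prod_def upper_def
    by (simp only:) (rule arg_cong3[where f=distr], auto simp: sort_pair_def fun_eq_iff)
qed

lemma prob_space_noise_law: "prob_space (noise_law n)"
  unfolding noise_law_gauss_image
  by (rule prob_space_gauss_image[OF entry_sd_pos finite_upper _ sort_pair_entries]) simp

lemma sets_noise_law[simp]: "sets (noise_law n) = sets (PiM (entries n) (\<lambda>_. borel))"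
  by (simp add: noise_law_def)

lemma observation_shift_measurable:
  "(\<lambda>W. observation n lam (\<theta>, W)) \<in> measurable (noise_law n) (PiM (entries n) (\<lambda>_. borel))"
  unfolding observation_def prod.case
  by (subst measurable_cong_sets[OF sets_noise_law refl]) (rule measurable_restrict, auto)

lemma noise_law_shift:
  "distr (noise_law n) (PiM (entries n) (\<lambda>_. borel)) (\<lambda>W. observation n lam (\<theta>, W))
     = gauss_image entry_sd (upper n) (entries n) sort_pair (signal lam \<theta>)"
proof -
  have m0: "(\<lambda>w. \<lambda>i\<in>entries n. (0 :: real) + w (sort_pair i)) \<in> measurable (gauss_prod entry_sd (upper n)) (PiM (entries n) (\<lambda>_. borel))"
    using measurable_feature[OF entry_sd_pos finite_upper _ sort_pair_entries, of n "\<lambda>_. 0"] by simp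
  have m1: "(\<lambda>W. observation n lam (\<theta>, W)) \<in> measurable (PiM (entries n) (\<lambda>_. borel)) (PiM (entries n) (\<lambda>_. borel))"
    using observation_shift_measurable by (subst (asm) measurable_cong_sets[OF sets_noise_law refl])
  show ?thesis
    unfolding noise_law_gauss_image gauss_image_def
    by (subst distr_distr[OF m1 m0]) (auto intro!: distr_cong simp: fun_eq_iff observation_def signal_sort_pair)
qed

lemma observation_measurable:
  "observation n lam \<in> measurable (model_space n \<rho>) (PiM (entries n) (\<lambda>_. borel))"
proof -
  have "(\<lambda>p. \<lambda>e\<in>entries n. signal lam (fst p) e + snd p e) \<in> measurable (model_space n \<rho>) (PiM (entries n) (\<lambda>_. borel))"
  proof (rule measurable_restrict)
    fix e assume e: "e \<in> entries n"
    have "(\<lambda>p. signal lam (fst p) e) \<in> borel_measurable (model_space n \<rho>)"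
      unfolding model_space_def by (rule measurable_compose[OF measurable_fst]) simp
    moreover have "(\<lambda>p. snd p e) \<in> borel_measurable (model_space n \<rho>)"
      unfolding model_space_def
    proof (rule measurable_compose[OF measurable_snd])
      show "(\<lambda>W. W e) \<in> borel_measurable (noise_law n)"
        using e by (subst measurable_cong_sets[OF sets_noise_law refl]) auto
    qed
    ultimately show "(\<lambda>p. signal lam (fst p) e + snd p e) \<in> borel_measurable (model_space n \<rho>)"
      by (rule borel_measurable_add)
  qed
  also have "(\<lambda>p. \<lambda>e\<in>entries n. signal lam (fst p) e + snd p e) = observation n lam"
    by (auto simp: observation_def fun_eq_iff)
  finally show ?thesis .
qed

lemma planted_law_gauss_image:
  "planted_law n lam \<rho> = measure_pmf (theta_pmf n \<rho>) \<bind>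
     (\<lambda>\<theta>. gauss_image entry_sd (upper n) (entries n) sort_pair (signal lam \<theta>))"
proof (rule measure_eqI)
  let ?G = "\<lambda>\<theta>. gauss_image entry_sd (upper n) (entries n) sort_pair (signal lam \<theta>)"
  let ?N = "PiM (entries n) (\<lambda>_. borel) :: (nat \<times> nat \<Rightarrow> real) measure"
  have pG: "prob_space (?G \<theta>)" for \<theta>
    by (rule prob_space_gauss_image[OF entry_sd_pos finite_upper _ sort_pair_entries]) simp
  interpret W: prob_space "noise_law n" by (rule prob_space_noise_law)
  show "sets (planted_law n lam \<rho>) = sets (measure_pmf (theta_pmf n \<rho>) \<bind> ?G)"
    by (subst sets_bind_pmf[where N="?N"]) (auto simp: planted_law_def pG)
  fix A assume "A \<in> sets (planted_law n lam \<rho>)"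
  then have A: "A \<in> sets ?N" by (simp add: planted_law_def)
  have B: "observation n lam -` A \<inter> space (model_space n \<rho>) \<in> sets (model_space n \<rho>)"
    by (rule measurable_sets[OF observation_measurable A])
  have "emeasure (planted_law n lam \<rho>) A = emeasure (model_space n \<rho>) (observation n lam -` A \<inter> space (model_space n \<rho>))"
    unfolding planted_law_def by (rule emeasure_distr[OF observation_measurable A])
  also have "\<dots> = (\<integral>\<^sup>+\<theta>. emeasure (noise_law n) (Pair \<theta> -` (observation n lam -` A \<inter> space (model_space n \<rho>))) \<partial>measure_pmf (theta_pmf n \<rho>))"
    using B unfolding model_space_def by (rule W.emeasure_pair_measure_alt)
  also have "\<dots> = (\<integral>\<^sup>+\<theta>. emeasure (?G \<theta>) A \<partial>measure_pmf (theta_pmf n \<rho>))"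
    unfolding noise_law_shift[symmetric]
    by (intro nn_integral_cong)
       (auto simp: emeasure_distr[OF observation_shift_measurable A] model_space_def space_pair_measure intro!: arg_cong2[where f=emeasure])
  also have "\<dots> = emeasure (measure_pmf (theta_pmf n \<rho>) \<bind> ?G) A"
    by (rule emeasure_bind_pmf[OF pG _ A, symmetric]) simp
  finally show "emeasure (planted_law n lam \<rho>) A = emeasure (measure_pmf (theta_pmf n \<rho>) \<bind> ?G) A" .
qed

text \<open>An off-diagonal variable has variance 1 and is displayed twice, a diagonal one has
  variance 2 and is displayed once. Multiplicity times variance is always 2, which makes the noise
  isotropic in the Frobenius geometry of symmetric matrices.\<close>

lemma sort_pair_fiber:
  assumes "e \<in> upper n"
  shows "real (card {x \<in> entries n. sort_pair x = e}) = 2 / (entry_sd e)\<^sup>2"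
proof -
  obtain i j where e: "e = (i, j)" "i \<le> j" "j < n" using assms by (auto simp: upper_def)
  have "{x \<in> entries n. sort_pair x = e} = {(i, j), (j, i)}"
  proof (rule set_eqI)
    fix x :: "nat \<times> nat"
    obtain a b where x: "x = (a, b)" by (cases x)
    show "x \<in> {x \<in> entries n. sort_pair x = e} \<longleftrightarrow> x \<in> {(i, j), (j, i)}"
      unfolding x e(1) sort_pair_def using e(2,3) by (cases "a \<le> b") (auto simp: min_def max_def)
  qed
  then show ?thesis by (cases "i = j") (simp_all add: e entry_sd_def)
qed

lemma sum_entries_upper:
  fixes F :: "nat \<times> nat \<Rightarrow> real"
  assumes "\<And>e. F (sort_pair e) = F e"
  shows "(\<Sum>e\<in>entries n. F e) = 2 * (\<Sum>e\<in>upper n. F e / (entry_sd e)\<^sup>2)"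
proof -
  have "(\<Sum>e\<in>entries n. F e) = (\<Sum>e\<in>upper n. \<Sum>x\<in>{x \<in> entries n. sort_pair x = e}. F x)"
  proof (rule sum.group[symmetric])
    show "sort_pair ` entries n \<subseteq> upper n"
      using sort_pair_entries by (simp only: image_subset_iff_funcset)
  qed (simp_all add: finite_upper)
  also have "\<dots> = (\<Sum>e\<in>upper n. \<Sum>x\<in>{x \<in> entries n. sort_pair x = e}. F e)"
    by (intro sum.cong refl) (use assms in auto)
  also have "\<dots> = (\<Sum>e\<in>upper n. 2 / (entry_sd e)\<^sup>2 * F e)"
    by (intro sum.cong refl) (simp add: sort_pair_fiber)
  finally show ?thesis by (simp add: sum_distrib_left mult_ac)
qed

text \<open>By the fibre count the Gaussian inner product is half the Frobenius one, and for two
  rank-one signals the latter is \<lambda>^2 times the squared overlap.\<close>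

lemma gauss_inner_signal:
  "gauss_inner entry_sd (upper n) (signal lam \<theta>) (signal lam \<theta>') = lam\<^sup>2 * (overlap n \<theta> \<theta>')\<^sup>2 / 2"
proof -
  have "(\<Sum>e\<in>entries n. signal lam \<theta> e * signal lam \<theta>' e)
      = 2 * gauss_inner entry_sd (upper n) (signal lam \<theta>) (signal lam \<theta>')"
    unfolding gauss_inner_def by (rule sum_entries_upper) (simp add: signal_sort_pair)
  moreover have "(\<Sum>e\<in>entries n. signal lam \<theta> e * signal lam \<theta>' e) = lam\<^sup>2 * (overlap n \<theta> \<theta>')\<^sup>2"
  proof -
    have "(overlap n \<theta> \<theta>')\<^sup>2 = (\<Sum>i<n. \<Sum>j<n. of_bool (\<theta> i \<and> \<theta>' i) * of_bool (\<theta> j \<and> \<theta>' j))"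
      unfolding overlap_def power2_eq_square by (rule sum_product)
    then show ?thesis
      unfolding sum.cartesian_product'
      by (simp only: sum_distrib_left) (intro sum.cong refl, simp add: signal_def power2_eq_square)
  qed
  ultimately show ?thesis by simp
qed

lemma Adv_planted_le:
  "Adv (entries n) D (planted_law n lam \<rho>) (noise_law n)
    \<le> ereal (sqrt (pair_mean n \<rho> (\<lambda>\<theta> \<theta>'. \<Sum>d\<le>D. (lam\<^sup>2 * (overlap n \<theta> \<theta>')\<^sup>2 / 2) ^ d / fact d)))"
  unfolding planted_law_gauss_image noise_law_gauss_image pair_mean_def gauss_inner_signal[symmetric]
  by (rule Adv_gauss_mixture_le[OF entry_sd_pos finite_upper _ sort_pair_entries finite_set_theta_pmf])
     (simp_all add: gauss_inner_signal)

section \<open>Averages over two replicas\<close>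

lemma pair_mean_mono:
  assumes "\<And>\<theta> \<theta>'. f \<theta> \<theta>' \<le> g \<theta> \<theta>'" shows "pair_mean n \<rho> f \<le> pair_mean n \<rho> g"
  unfolding pair_mean_def by (intro sum_mono mult_left_mono assms) auto

lemma pair_mean_add: "pair_mean n \<rho> (\<lambda>\<theta> \<theta>'. f \<theta> \<theta>' + g \<theta> \<theta>') = pair_mean n \<rho> f + pair_mean n \<rho> g"
  unfolding pair_mean_def by (simp add: distrib_left sum.distrib)

lemma pair_mean_cmult: "pair_mean n \<rho> (\<lambda>\<theta> \<theta>'. c * f \<theta> \<theta>') = c * pair_mean n \<rho> f"
  unfolding pair_mean_def by (simp add: sum_distrib_left mult_ac)

lemma pair_mean_sum: "pair_mean n \<rho> (\<lambda>\<theta> \<theta>'. \<Sum>i\<in>A. f i \<theta> \<theta>') = (\<Sum>i\<in>A. pair_mean n \<rho> (f i))"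
proof -
  have "pair_mean n \<rho> (\<lambda>\<theta> \<theta>'. \<Sum>i\<in>A. f i \<theta> \<theta>') = (\<Sum>\<theta>\<in>set_pmf (theta_pmf n \<rho>). \<Sum>i\<in>A. \<Sum>\<theta>'\<in>set_pmf (theta_pmf n \<rho>).
     pmf (theta_pmf n \<rho>) \<theta> * pmf (theta_pmf n \<rho>) \<theta>' * f i \<theta> \<theta>')"
    unfolding pair_mean_def sum_distrib_left by (intro sum.cong refl sum.swap)
  also have "\<dots> = (\<Sum>i\<in>A. pair_mean n \<rho> (f i))"
    unfolding pair_mean_def by (rule sum.swap)
  finally show ?thesis .
qed

lemma pair_mean_const: "pair_mean n \<rho> (\<lambda>_ _. c) = c"
proof -
  have "(\<Sum>\<theta>\<in>set_pmf (theta_pmf n \<rho>). pmf (theta_pmf n \<rho>) \<theta>) = 1"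
    by (rule sum_pmf_eq_1[OF finite_set_theta_pmf]) simp
  then show ?thesis
    unfolding pair_mean_def by (simp add: sum_distrib_left[symmetric] sum_distrib_right[symmetric])
qed

text \<open>Means hidden in different samples have disjoint supports, hence inner product 0, and
  such pairs of replicas contribute 1. The two positions agree with probability 1 / M, and only then
  does the base problem enter.\<close>

lemma Adv_hidden_le:
  assumes M: "0 < M"
  shows "Adv ({..<M} \<times> entries n) D
      (hidden_planted M (entries n) (planted_law n lam \<rho>) (noise_law n)) (hidden_null M (entries n) (noise_law n))
    \<le> ereal (sqrt (1 + pair_mean n \<rho> (\<lambda>\<theta> \<theta>'. \<Sum>d\<le>D. (lam\<^sup>2 * (overlap n \<theta> \<theta>')\<^sup>2 / 2) ^ d / fact d) / real M))"
proof -
  let ?\<pi> = "theta_pmf n \<rho>"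
  let ?\<kappa> = "pmf_of_set {..<M}"
  let ?x = "\<lambda>(\<kappa>, \<theta>). \<lambda>(j :: nat, e). if j = \<kappa> then signal lam \<theta> e else 0"
  let ?\<sigma> = "\<lambda>(j :: nat, e). entry_sd e"
  let ?K = "\<lambda>\<theta> \<theta>'. lam\<^sup>2 * (overlap n \<theta> \<theta>')\<^sup>2 / 2"
  have S: "set_pmf ?\<kappa> = {..<M}" using M by (subst set_pmf_of_set) auto
  have pm: "pmf ?\<kappa> k = 1 / real M" if "k < M" for k
    using that M by (subst pmf_of_set) auto
  have inner: "gauss_inner ?\<sigma> ({..<M} \<times> upper n) (?x (k, \<theta>)) (?x (k', \<theta>')) = (if k = k' then ?K \<theta> \<theta>' else 0)" if "k < M" "k' < M" for k k' \<theta> \<theta>'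
  proof -
    have "gauss_inner ?\<sigma> ({..<M} \<times> upper n) (?x (k, \<theta>)) (?x (k', \<theta>'))
       = (\<Sum>j<M. if j = k then (if k = k' then gauss_inner entry_sd (upper n) (signal lam \<theta>) (signal lam \<theta>') else 0) else 0)"
      unfolding gauss_inner_def sum.cartesian_product'
      by (intro sum.cong refl) auto
    also have "\<dots> = (if k = k' then ?K \<theta> \<theta>' else 0)"
      using that by (simp add: gauss_inner_signal)
    finally show ?thesis .
  qed
  let ?A = "pair_mean n \<rho> (\<lambda>\<theta> \<theta>'. \<Sum>d\<le>D. ?K \<theta> \<theta>' ^ d / fact d)"
  let ?B = "\<Sum>u\<in>set_pmf (pair_pmf ?\<kappa> ?\<pi>). \<Sum>v\<in>set_pmf (pair_pmf ?\<kappa> ?\<pi>). pmf (pair_pmf ?\<kappa> ?\<pi>) u * pmf (pair_pmf ?\<kappa> ?\<pi>) v *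
          (\<Sum>d\<le>D. gauss_inner ?\<sigma> ({..<M} \<times> upper n) (?x u) (?x v) ^ d / fact d)"
  let ?G = "gauss_image ?\<sigma> ({..<M} \<times> upper n) ({..<M} \<times> entries n) (\<lambda>(j, i). (j, sort_pair i))"
  have fin: "finite (entries n)" by simp
  have hp: "hidden_planted M (entries n) (planted_law n lam \<rho>) (noise_law n) = measure_pmf (pair_pmf ?\<kappa> ?\<pi>) \<bind> (\<lambda>p. ?G (?x p))"
    unfolding planted_law_gauss_image noise_law_gauss_image
      hidden_planted_gauss_image[OF entry_sd_pos finite_upper fin sort_pair_entries M]
    by (rule arg_cong[where f="\<lambda>k. measure_pmf (pair_pmf ?\<kappa> ?\<pi>) \<bind> k"]) (rule ext, simp split: prod.split)
  have hn: "hidden_null M (entries n) (noise_law n) = ?G (\<lambda>_. 0)"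
    unfolding noise_law_gauss_image
    by (rule hidden_null_gauss_image[OF entry_sd_pos finite_upper fin sort_pair_entries])
  have "Adv ({..<M} \<times> entries n) D (measure_pmf (pair_pmf ?\<kappa> ?\<pi>) \<bind> (\<lambda>p. ?G (?x p))) (?G (\<lambda>_. 0)) \<le> ereal (sqrt ?B)"
  proof (rule Adv_gauss_mixture_le)
    show "(\<lambda>(j, i). (j, sort_pair i)) \<in> {..<M} \<times> entries n \<rightarrow> {..<M} \<times> upper n"
      using sort_pair_entries by auto
    show "finite (set_pmf (pair_pmf ?\<kappa> ?\<pi>))"
      by (simp add: S finite_set_theta_pmf)
    fix a b assume "a \<in> set_pmf (pair_pmf ?\<kappa> ?\<pi>)" "b \<in> set_pmf (pair_pmf ?\<kappa> ?\<pi>)"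
    then obtain k \<theta> k' \<theta>' where "a = (k, \<theta>)" "b = (k', \<theta>')" "k < M" "k' < M" by (auto simp: S)
    then show "0 \<le> gauss_inner ?\<sigma> ({..<M} \<times> upper n) (?x a) (?x b)"
      using inner[of k k' \<theta> \<theta>'] by simp
  qed (auto simp: entry_sd_pos finite_upper)
  then have "Adv ({..<M} \<times> entries n) D
      (hidden_planted M (entries n) (planted_law n lam \<rho>) (noise_law n)) (hidden_null M (entries n) (noise_law n)) \<le> ereal (sqrt ?B)"
    by (simp only: hp hn)
  also have "?B = (\<Sum>k<M. \<Sum>k'<M. pair_mean n \<rho> (\<lambda>\<theta> \<theta>'. 1 / (real M)\<^sup>2 * (\<Sum>d\<le>D. (if k = k' then ?K \<theta> \<theta>' else 0) ^ d / fact d)))"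
  proof -
    have "?B = (\<Sum>k<M. \<Sum>\<theta>\<in>set_pmf ?\<pi>. \<Sum>k'<M. \<Sum>\<theta>'\<in>set_pmf ?\<pi>. pmf ?\<pi> \<theta> * pmf ?\<pi> \<theta>' * (1 / (real M)\<^sup>2 * (\<Sum>d\<le>D. (if k = k' then ?K \<theta> \<theta>' else 0) ^ d / fact d)))"
      unfolding set_pair_pmf S sum.cartesian_product'
    proof (intro sum.cong refl)
      fix k \<theta> k' \<theta>' assume "k \<in> {..<M}" "k' \<in> {..<M}"
      then show "pmf (pair_pmf ?\<kappa> ?\<pi>) (k, \<theta>) * pmf (pair_pmf ?\<kappa> ?\<pi>) (k', \<theta>') * (\<Sum>d\<le>D. gauss_inner ?\<sigma> ({..<M} \<times> upper n) (?x (k, \<theta>)) (?x (k', \<theta>')) ^ d / fact d)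
        = pmf ?\<pi> \<theta> * pmf ?\<pi> \<theta>' * (1 / (real M)\<^sup>2 * (\<Sum>d\<le>D. (if k = k' then ?K \<theta> \<theta>' else 0) ^ d / fact d))"
        using inner[of k k' \<theta> \<theta>'] by (simp add: pmf_pair pm power2_eq_square)
    qed
    also have "\<dots> = (\<Sum>k<M. \<Sum>k'<M. \<Sum>\<theta>\<in>set_pmf ?\<pi>. \<Sum>\<theta>'\<in>set_pmf ?\<pi>. pmf ?\<pi> \<theta> * pmf ?\<pi> \<theta>' * (1 / (real M)\<^sup>2 * (\<Sum>d\<le>D. (if k = k' then ?K \<theta> \<theta>' else 0) ^ d / fact d)))"
      by (intro sum.cong refl sum.swap)
    finally show ?thesis by (simp add: pair_mean_def)
  qed
  also have "\<dots> = (\<Sum>k<M. \<Sum>k'<M. 1 / (real M)\<^sup>2 * (if k = k' then ?A else 1))"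
  proof (intro sum.cong refl)
    fix k k'
    \<comment> \<open>For different positions only the term d = 0 survives, as 0 ^ 0 = 1.\<close>
    have "(\<Sum>d\<le>D. 0 ^ d / fact d) = (1 :: real)"
      by (simp add: power_0_left if_distrib[where f="\<lambda>x. x / _"] cong: if_cong)
    then show "pair_mean n \<rho> (\<lambda>\<theta> \<theta>'. 1 / (real M)\<^sup>2 * (\<Sum>d\<le>D. (if k = k' then ?K \<theta> \<theta>' else 0) ^ d / fact d)) = 1 / (real M)\<^sup>2 * (if k = k' then ?A else 1)"
      unfolding pair_mean_cmult by (simp add: pair_mean_const)
  qed
  also have "\<dots> \<le> (\<Sum>k<M. \<Sum>k'<M. 1 / (real M)\<^sup>2 * ((if k = k' then ?A else 0) + 1))"
    by (intro sum_mono mult_left_mono) auto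
  also have "\<dots> = 1 + ?A / real M"
    using M by (simp add: distrib_left sum.distrib power2_eq_square sum_divide_distrib[symmetric])
  finally show ?thesis by (simp add: real_sqrt_le_iff)
qed

section \<open>Moments of the overlap\<close>

lemma sum_pmf_theta:
  "(\<Sum>\<theta>\<in>set_pmf (theta_pmf n \<rho>). pmf (theta_pmf n \<rho>) \<theta> * f \<theta>) = measure_pmf.expectation (theta_pmf n \<rho>) f"
  by (subst integral_measure_pmf[OF finite_set_theta_pmf]) auto

lemma expectation_theta_prod:
  assumes \<rho>: "0 < \<rho>" "\<rho> < 1" and f: "\<And>i b. 0 \<le> f i b"
  shows "measure_pmf.expectation (theta_pmf n \<rho>) (\<lambda>\<theta>. \<Prod>i<n. f i (\<theta> i)) = (\<Prod>i<n. f i True * \<rho> + f i False * (1 - \<rho>))"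
proof -
  have "measure_pmf.expectation (theta_pmf n \<rho>) (\<lambda>\<theta>. \<Prod>i<n. f i (\<theta> i)) = (\<Prod>i<n. measure_pmf.expectation (bernoulli_pmf \<rho>) (f i))"
    unfolding theta_pmf_def
    by (rule expectation_prod_Pi_pmf) (auto intro: f integrable_measure_pmf_finite)
  then show ?thesis using \<rho> by (simp add: mult.commute)
qed

lemma overlap_self_mgf:
  assumes \<rho>: "0 < \<rho>" "\<rho> < 1"
  shows "measure_pmf.expectation (theta_pmf n \<rho>) (\<lambda>\<theta>. exp (r * overlap n \<theta> \<theta>)) \<le> exp (real n * \<rho> * (exp r - 1))"
proof -
  have "exp (r * overlap n \<theta> \<theta>) = (\<Prod>i<n. exp (r * of_bool (\<theta> i)))" for \<theta>
    by (simp only: overlap_def sum_distrib_left exp_sum[OF finite_lessThan] conj_absorb)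
  then have "measure_pmf.expectation (theta_pmf n \<rho>) (\<lambda>\<theta>. exp (r * overlap n \<theta> \<theta>)) = (1 + \<rho> * (exp r - 1)) ^ n"
    using \<rho> by (simp add: expectation_theta_prod[where f="\<lambda>_ b. exp (r * of_bool b)"] algebra_simps)
  also have "\<dots> \<le> exp (\<rho> * (exp r - 1)) ^ n"
  proof (rule power_mono)
    have "0 \<le> (1 - \<rho>) + \<rho> * exp r" using \<rho> by (intro add_nonneg_nonneg mult_nonneg_nonneg) auto
    then show "0 \<le> 1 + \<rho> * (exp r - 1)" by (simp add: algebra_simps)
  qed (rule exp_ge_add_one_self)
  also have "\<dots> = exp (real n * \<rho> * (exp r - 1))"
    by (simp add: exp_of_nat_mult[symmetric] mult_ac)
  finally show ?thesis .
qed

text \<open>The overlap is binomial with success probability \<rho>^2. Averaging over \<theta>'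
  first leaves a product of functions of the single coordinates of \<theta>, which the second
  average evaluates; 1 + x \<le> exp x gives the exponential form.\<close>

lemma overlap_mgf:
  assumes \<rho>: "0 < \<rho>" "\<rho> < 1"
  shows "pair_mean n \<rho> (\<lambda>\<theta> \<theta>'. exp (r * overlap n \<theta> \<theta>')) \<le> exp (real n * \<rho>\<^sup>2 * (exp r - 1))"
proof -
  let ?E = "measure_pmf.expectation (theta_pmf n \<rho>)"
  have inner: "?E (\<lambda>\<theta>'. exp (r * overlap n \<theta> \<theta>')) = (\<Prod>i<n. 1 + \<rho> * (exp r - 1) * of_bool (\<theta> i))" for \<theta>
  proof -
    have "exp (r * overlap n \<theta> \<theta>') = (\<Prod>i<n. exp (r * of_bool (\<theta> i \<and> \<theta>' i)))" for \<theta>'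
      by (simp only: overlap_def sum_distrib_left exp_sum[OF finite_lessThan] conj_absorb)
    then have "?E (\<lambda>\<theta>'. exp (r * overlap n \<theta> \<theta>')) = (\<Prod>i<n. exp (r * of_bool (\<theta> i \<and> True)) * \<rho> + exp (r * of_bool (\<theta> i \<and> False)) * (1 - \<rho>))"
      using expectation_theta_prod[OF \<rho>, where f="\<lambda>i b. exp (r * of_bool (\<theta> i \<and> b))"] by simp
    also have "\<dots> = (\<Prod>i<n. 1 + \<rho> * (exp r - 1) * of_bool (\<theta> i))"
      by (intro prod.cong refl) (auto simp: algebra_simps)
    finally show ?thesis .
  qed
  have nn: "0 \<le> 1 + \<rho> * (exp r - 1)"
  proof -
    have "0 \<le> (1 - \<rho>) + \<rho> * exp r" using \<rho> by (intro add_nonneg_nonneg mult_nonneg_nonneg) auto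
    then show ?thesis by (simp add: algebra_simps)
  qed
  have "pair_mean n \<rho> (\<lambda>\<theta> \<theta>'. exp (r * overlap n \<theta> \<theta>'))
      = (\<Sum>\<theta>\<in>set_pmf (theta_pmf n \<rho>). pmf (theta_pmf n \<rho>) \<theta> * ?E (\<lambda>\<theta>'. exp (r * overlap n \<theta> \<theta>')))"
    unfolding pair_mean_def sum_pmf_theta[symmetric] by (simp add: sum_distrib_left mult_ac)
  also have "\<dots> = ?E (\<lambda>\<theta>. \<Prod>i<n. 1 + \<rho> * (exp r - 1) * of_bool (\<theta> i))"
    unfolding sum_pmf_theta inner ..
  also have "\<dots> = (\<Prod>i<n. (1 + \<rho> * (exp r - 1) * of_bool True) * \<rho> + (1 + \<rho> * (exp r - 1) * of_bool False) * (1 - \<rho>))"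
    by (rule expectation_theta_prod[OF \<rho>, where f="\<lambda>i b. 1 + \<rho> * (exp r - 1) * of_bool b"]) (use nn in auto)
  also have "\<dots> = (1 + \<rho>\<^sup>2 * (exp r - 1)) ^ n"
    by (simp add: algebra_simps power2_eq_square)
  also have "\<dots> \<le> exp (\<rho>\<^sup>2 * (exp r - 1)) ^ n"
  proof (rule power_mono)
    have "\<rho>\<^sup>2 \<le> 1" using \<rho> by (simp add: power_le_one)
    then have "0 \<le> (1 - \<rho>\<^sup>2) + \<rho>\<^sup>2 * exp r" by (intro add_nonneg_nonneg mult_nonneg_nonneg) auto
    then show "0 \<le> 1 + \<rho>\<^sup>2 * (exp r - 1)" by (simp add: algebra_simps)
  qed (rule exp_ge_add_one_self)
  also have "\<dots> = exp (real n * \<rho>\<^sup>2 * (exp r - 1))"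
    by (simp add: exp_of_nat_mult[symmetric] mult_ac)
  finally show ?thesis .
qed

lemma overlap_nonneg: "0 \<le> overlap n \<theta> \<theta>'"
  by (auto simp: overlap_def intro: sum_nonneg)

lemma overlap_le: "overlap n \<theta> \<theta>' \<le> real n"
proof -
  have "overlap n \<theta> \<theta>' \<le> (\<Sum>i<n. 1)" unfolding overlap_def by (intro sum_mono) auto
  then show ?thesis by simp
qed

lemma overlap_le_self: "overlap n \<theta> \<theta>' \<le> overlap n \<theta> \<theta>" "overlap n \<theta> \<theta>' \<le> overlap n \<theta>' \<theta>'"
  unfolding overlap_def by (intro sum_mono; auto)+

text \<open>The inequality 1 + t \<le> exp t at t = y / k - 1, raised to the power k. Equality holds
  at y = k.\<close>

lemma power_le_exp:
  fixes y :: real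
  assumes "0 \<le> y" "0 < k"
  shows "y ^ k \<le> real k ^ k * exp (y - real k)"
proof -
  have "y / real k \<le> exp (y / real k - 1)"
    using exp_ge_add_one_self[of "y / real k - 1"] by simp
  then have "(y / real k) ^ k \<le> exp (y / real k - 1) ^ k"
    using assms by (intro power_mono) auto
  also have "\<dots> = exp (y - real k)"
    using assms by (simp add: exp_of_nat_mult[symmetric] right_diff_distrib)
  finally show ?thesis
    using assms by (simp add: power_divide field_simps)
qed

text \<open>The moment is bounded by an exponential moment. The sum n \<rho>^2 + 2 d covers two
  regimes at once: for small d the mean overlap dominates, for large d the upper tail.\<close>

lemma overlap_moment:
  assumes \<rho>: "0 < \<rho>" "\<rho> < 1" and d: "0 < d"
  shows "pair_mean n \<rho> (\<lambda>\<theta> \<theta>'. overlap n \<theta> \<theta>' ^ (2 * d)) \<le> (exp 1 * (real n * \<rho>\<^sup>2 + 2 * real d)) ^ (2 * d)"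
proof -
  define a where "a = real n * \<rho>\<^sup>2"
  define r where "r = 2 * real d / (a + 2 * real d)"
  have a: "0 \<le> a" by (simp add: a_def)
  have r: "0 < r" "r \<le> 1" using a d by (auto simp: r_def)
  \<comment> \<open>\<open>r\<close> minimises the exponential moment bound up to constants, uniformly in \<open>d\<close>.\<close>
  have 1: "overlap n \<theta> \<theta>' ^ (2 * d) \<le> ((a + 2 * real d) ^ (2 * d) * exp (- 2 * real d)) * exp (r * overlap n \<theta> \<theta>')" for \<theta> \<theta>'
  proof -
    have "(r * overlap n \<theta> \<theta>') ^ (2 * d) \<le> real (2 * d) ^ (2 * d) * exp (r * overlap n \<theta> \<theta>' - real (2 * d))"
      using d r overlap_nonneg by (intro power_le_exp) auto
    \<comment> \<open>Writing 2 d as r (a + 2 d) produces the same power of \<open>r\<close> on both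
      sides, where it cancels.\<close>
    also have "real (2 * d) = r * (a + 2 * real d)"
      using d a by (simp add: r_def)
    finally have "r ^ (2 * d) * overlap n \<theta> \<theta>' ^ (2 * d) \<le> r ^ (2 * d) * ((a + 2 * real d) ^ (2 * d) * exp (r * overlap n \<theta> \<theta>' - r * (a + 2 * real d)))"
      by (simp add: power_mult_distrib mult_ac)
    then have "overlap n \<theta> \<theta>' ^ (2 * d) \<le> (a + 2 * real d) ^ (2 * d) * exp (r * overlap n \<theta> \<theta>' - r * (a + 2 * real d))"
      using r by (simp add: mult_le_cancel_left_pos)
    also have "r * (a + 2 * real d) = 2 * real d"
      using d a by (simp add: r_def)
    also have "exp (r * overlap n \<theta> \<theta>' - 2 * real d) = exp (- 2 * real d) * exp (r * overlap n \<theta> \<theta>')"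
      by (simp add: exp_add[symmetric])
    finally show ?thesis by (simp add: mult_ac)
  qed
  have "pair_mean n \<rho> (\<lambda>\<theta> \<theta>'. overlap n \<theta> \<theta>' ^ (2 * d)) \<le> ((a + 2 * real d) ^ (2 * d) * exp (- 2 * real d)) * pair_mean n \<rho> (\<lambda>\<theta> \<theta>'. exp (r * overlap n \<theta> \<theta>'))"
    unfolding pair_mean_cmult[symmetric] by (rule pair_mean_mono[OF 1])
  also have "\<dots> \<le> ((a + 2 * real d) ^ (2 * d) * exp (- 2 * real d)) * exp (4 * real d)"
  proof (intro mult_left_mono)
    have "pair_mean n \<rho> (\<lambda>\<theta> \<theta>'. exp (r * overlap n \<theta> \<theta>')) \<le> exp (a * (exp r - 1))"
      unfolding a_def by (rule overlap_mgf[OF \<rho>])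
    also have "\<dots> \<le> exp (4 * real d)"
    proof -
      have "exp r \<le> 1 + r + r\<^sup>2" using r by (intro exp_bound) auto
      moreover have "r\<^sup>2 \<le> r" using r by (simp add: power2_eq_square mult_left_le)
      ultimately have "exp r - 1 \<le> 2 * r" by linarith
      then have "a * (exp r - 1) \<le> a * (2 * r)" using a by (intro mult_left_mono)
      also have "\<dots> \<le> (a + 2 * real d) * (2 * r)" using r by (intro mult_right_mono) auto
      also have "\<dots> = 4 * real d" using a d by (simp add: r_def)
      finally show ?thesis by simp
    qed
    finally show "pair_mean n \<rho> (\<lambda>\<theta> \<theta>'. exp (r * overlap n \<theta> \<theta>')) \<le> exp (4 * real d)" .
  qed (use a in auto)
  also have "\<dots> = (a + 2 * real d) ^ (2 * d) * exp (2 * real d)"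
    by (simp add: exp_add[symmetric] mult.assoc)
  also have "\<dots> = (exp 1 * (a + 2 * real d)) ^ (2 * d)"
    using exp_of_nat_mult[of "2 * d" "1 :: real"] by (simp only: power_mult_distrib) (simp add: mult.commute)
  finally show ?thesis by (simp add: a_def)
qed

text \<open>Numerical roundings. The first gives the 15 in the exponent of the truncated chi-square
  bound. The second gives the factor 200, which the degree condition with 400 brings down to 1 /
  2.\<close>

lemma exp_1_powers: "2 * (exp 1)\<^sup>2 \<le> (15 :: real)" "8 * exp 1 ^ 3 \<le> (200 :: real)"
proof -
  have e: "exp 1 \<le> (2.72 :: real)" using e_less_272 by simp
  have "exp 1 ^ 2 \<le> (2.72 :: real) ^ 2" by (rule power_mono[OF e]) simp
  then show "2 * (exp 1)\<^sup>2 \<le> (15 :: real)" by (simp add: power2_eq_square)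
  have "exp 1 ^ 3 \<le> (2.72 :: real) ^ 3" by (rule power_mono[OF e]) simp
  then show "8 * exp 1 ^ 3 \<le> (200 :: real)" by (simp add: power3_eq_cube)
qed

text \<open>A single term of the exponential series at \<open>real d\<close> is at most the whole
  sum.\<close>

lemma power_le_fact_exp: "real d ^ d \<le> fact d * exp 1 ^ d"
proof -
  have "(\<lambda>k. real d ^ k / fact k) sums exp (real d)"
    using exp_converges[of "real d"] by (simp add: divide_inverse mult.commute)
  then have "(\<Sum>k\<in>{d}. real d ^ k / fact k) \<le> exp (real d)"
    by (metis (no_types, lifting) finite.emptyI finite_insert sum_le_suminf sums_summable sums_unique
        divide_nonneg_nonneg fact_ge_zero of_nat_0_le_iff zero_le_power)
  then have "real d ^ d / fact d \<le> exp 1 ^ d"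
    using exp_of_nat_mult[of d "1 :: real"] by simp
  then show ?thesis by (simp add: field_simps)
qed

lemma add_power_le:
  fixes u v :: real
  assumes "0 \<le> u" "0 \<le> v"
  shows "(u + v) ^ d \<le> (2 * u) ^ d + (2 * v) ^ d"
proof (cases "u \<le> v")
  case True
  then have "(u + v) ^ d \<le> (2 * v) ^ d" using assms by (intro power_mono) auto
  moreover have "0 \<le> (2 * u) ^ d" using assms by simp
  ultimately show ?thesis by linarith
next
  case False
  then have "(u + v) ^ d \<le> (2 * u) ^ d" using assms by (intro power_mono) auto
  moreover have "0 \<le> (2 * v) ^ d" using assms by simp
  ultimately show ?thesis by linarith
qed

text \<open>Each degree d > 0 splits into two parts by \<open>add_power_le\<close>. The part
  governed by the mean overlap is at most U^d / d! and sums to at most exp U. The part governed by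
  fluctuations contains d^(2 d) / d!, at most (e d)^d; the degree condition keeps \<lambda>^2 d so
  small that this part is at most 2^-d, which sums to at most 1. This is where the degree is limited
  to the order \<lambda>^-2.\<close>

lemma truncated_chi_square:
  assumes \<rho>: "0 < \<rho>" "\<rho> < 1" and D: "400 * lam\<^sup>2 * real D \<le> 1"
  shows "pair_mean n \<rho> (\<lambda>\<theta> \<theta>'. \<Sum>d\<le>D. (lam\<^sup>2 * (overlap n \<theta> \<theta>')\<^sup>2 / 2) ^ d / fact d)
     \<le> exp (15 * (lam\<^sup>2 * (real n * \<rho>\<^sup>2)\<^sup>2)) + 1"
proof -
  define a where "a = real n * \<rho>\<^sup>2"
  define U where "U = 15 * (lam\<^sup>2 * a\<^sup>2)"
  have U: "0 \<le> U" by (simp add: U_def)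
  have summand: "pair_mean n \<rho> (\<lambda>\<theta> \<theta>'. (lam\<^sup>2 * (overlap n \<theta> \<theta>')\<^sup>2 / 2) ^ d / fact d) \<le> U ^ d / fact d + (if d = 0 then 0 else (1 / 2) ^ d)"
    if d: "d \<le> D" for d
  proof (cases "d = 0")
    case True
    then show ?thesis by (simp add: pair_mean_const)
  next
    case False
    have "pair_mean n \<rho> (\<lambda>\<theta> \<theta>'. (lam\<^sup>2 * (overlap n \<theta> \<theta>')\<^sup>2 / 2) ^ d / fact d)
       = pair_mean n \<rho> (\<lambda>\<theta> \<theta>'. ((lam\<^sup>2 / 2) ^ d / fact d) * overlap n \<theta> \<theta>' ^ (2 * d))"
      by (simp only: power_mult power_mult_distrib power_divide) (simp add: mult_ac)
    also have "\<dots> = ((lam\<^sup>2 / 2) ^ d / fact d) * pair_mean n \<rho> (\<lambda>\<theta> \<theta>'. overlap n \<theta> \<theta>' ^ (2 * d))"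
      by (rule pair_mean_cmult)
    also have "\<dots> \<le> ((lam\<^sup>2 / 2) ^ d / fact d) * (exp 1 * (a + 2 * real d)) ^ (2 * d)"
      unfolding a_def using False by (intro mult_left_mono overlap_moment \<rho>) auto
    also have "\<dots> = (lam\<^sup>2 / 2 * ((exp 1)\<^sup>2 * (a + 2 * real d)\<^sup>2)) ^ d / fact d"
      by (simp only: power_mult power_mult_distrib) simp
    also have "\<dots> \<le> (lam\<^sup>2 * (exp 1)\<^sup>2 * a\<^sup>2 + 4 * lam\<^sup>2 * (exp 1)\<^sup>2 * (real d)\<^sup>2) ^ d / fact d"
    proof (intro divide_right_mono power_mono)
      have "(a + 2 * real d)\<^sup>2 \<le> 2 * a\<^sup>2 + 8 * (real d)\<^sup>2"
        using zero_le_power2[of "a - 2 * real d"] by (simp add: power2_eq_square algebra_simps)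
      then have "lam\<^sup>2 / 2 * ((exp 1)\<^sup>2 * (a + 2 * real d)\<^sup>2) \<le> lam\<^sup>2 / 2 * ((exp 1)\<^sup>2 * (2 * a\<^sup>2 + 8 * (real d)\<^sup>2))"
        by (intro mult_left_mono) auto
      then show "lam\<^sup>2 / 2 * ((exp 1)\<^sup>2 * (a + 2 * real d)\<^sup>2) \<le> lam\<^sup>2 * (exp 1)\<^sup>2 * a\<^sup>2 + 4 * lam\<^sup>2 * (exp 1)\<^sup>2 * (real d)\<^sup>2"
        by (simp add: algebra_simps)
    qed auto
    also have "\<dots> \<le> ((2 * (lam\<^sup>2 * (exp 1)\<^sup>2 * a\<^sup>2)) ^ d + (2 * (4 * lam\<^sup>2 * (exp 1)\<^sup>2 * (real d)\<^sup>2)) ^ d) / fact d"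
      by (intro divide_right_mono add_power_le) auto
    also have "\<dots> = (2 * (lam\<^sup>2 * (exp 1)\<^sup>2 * a\<^sup>2)) ^ d / fact d + (8 * lam\<^sup>2 * (exp 1)\<^sup>2 * real d) ^ d * (real d ^ d / fact d)"
      by (simp add: add_divide_distrib power_mult_distrib[symmetric] power2_eq_square mult_ac)
    also have "\<dots> \<le> U ^ d / fact d + (1 / 2) ^ d"
    proof (intro add_mono)
      have "2 * (lam\<^sup>2 * (exp 1)\<^sup>2 * a\<^sup>2) = (2 * (exp 1)\<^sup>2) * (lam\<^sup>2 * a\<^sup>2)" by simp
      also have "\<dots> \<le> U" unfolding U_def by (intro mult_right_mono exp_1_powers) auto
      finally show "(2 * (lam\<^sup>2 * (exp 1)\<^sup>2 * a\<^sup>2)) ^ d / fact d \<le> U ^ d / fact d"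
        by (intro divide_right_mono power_mono) auto
      have "(8 * lam\<^sup>2 * (exp 1)\<^sup>2 * real d) ^ d * (real d ^ d / fact d) \<le> (8 * lam\<^sup>2 * (exp 1)\<^sup>2 * real d) ^ d * exp 1 ^ d"
        using power_le_fact_exp[of d] by (intro mult_left_mono) (auto simp: field_simps)
      also have "\<dots> = ((8 * exp 1 ^ 3) * (lam\<^sup>2 * real d)) ^ d"
        by (simp add: power_mult_distrib[symmetric] power2_eq_square power3_eq_cube mult_ac)
      also have "\<dots> \<le> (200 * (lam\<^sup>2 * real D)) ^ d"
      proof (rule power_mono)
        show "(8 * exp 1 ^ 3) * (lam\<^sup>2 * real d) \<le> 200 * (lam\<^sup>2 * real D)"
          using d by (intro mult_mono exp_1_powers) auto
      qed simp
      also have "\<dots> \<le> (1 / 2) ^ d" using D by (intro power_mono) auto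
      finally show "(8 * lam\<^sup>2 * (exp 1)\<^sup>2 * real d) ^ d * (real d ^ d / fact d) \<le> (1 / 2) ^ d" .
    qed
    finally show ?thesis using False by simp
  qed
  have "pair_mean n \<rho> (\<lambda>\<theta> \<theta>'. \<Sum>d\<le>D. (lam\<^sup>2 * (overlap n \<theta> \<theta>')\<^sup>2 / 2) ^ d / fact d)
     = (\<Sum>d\<le>D. pair_mean n \<rho> (\<lambda>\<theta> \<theta>'. (lam\<^sup>2 * (overlap n \<theta> \<theta>')\<^sup>2 / 2) ^ d / fact d))"
    by (rule pair_mean_sum)
  also have "\<dots> \<le> (\<Sum>d\<le>D. U ^ d / fact d + (if d = 0 then 0 else (1 / 2) ^ d))"
    by (intro sum_mono summand) auto
  also have "\<dots> = (\<Sum>d\<le>D. U ^ d / fact d) + (\<Sum>d\<le>D. if d = 0 then 0 else (1 / 2) ^ d)"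
    by (rule sum.distrib)
  also have "\<dots> \<le> exp U + 1"
  proof (intro add_mono)
    have s: "(\<lambda>k. U ^ k / fact k) sums exp U"
      using exp_converges[of U] by (simp add: divide_inverse mult.commute)
    have "(\<Sum>d\<le>D. U ^ d / fact d) \<le> (\<Sum>d. U ^ d / fact d)"
      using U by (intro sum_le_suminf sums_summable[OF s]) auto
    then show "(\<Sum>d\<le>D. U ^ d / fact d) \<le> exp U" using sums_unique[OF s] by simp
    have "(\<Sum>d\<le>D. if d = 0 then 0 else (1 / 2) ^ d) = (1 :: real) - (1 / 2) ^ D"
      by (induction D) (auto simp: field_simps)
    also have "\<dots> \<le> 1" by simp
    finally show "(\<Sum>d\<le>D. if d = 0 then 0 else (1 / 2 :: real) ^ d) \<le> 1" .
  qed
  finally show ?thesis by (simp add: U_def a_def)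
qed

text \<open>Chernoff bound with exponent -1: the cost is \<rho>n / 2, the gain \<rho>n (1 - 1 / e),
  and 1 / e \<le> 2 / 5 leaves \<rho>n / 10.\<close>

lemma overlap_self_tail:
  assumes \<rho>: "0 < \<rho>" "\<rho> < 1"
  shows "measure_pmf.expectation (theta_pmf n \<rho>) (\<lambda>\<theta>. of_bool (overlap n \<theta> \<theta> < \<rho> * real n / 2)) \<le> exp (- (\<rho> * real n / 10))"
proof -
  have fin: "integrable (measure_pmf (theta_pmf n \<rho>)) f" for f :: "_ \<Rightarrow> real"
    by (rule integrable_measure_pmf_finite[OF finite_set_theta_pmf])
  have "measure_pmf.expectation (theta_pmf n \<rho>) (\<lambda>\<theta>. of_bool (overlap n \<theta> \<theta> < \<rho> * real n / 2))
     \<le> measure_pmf.expectation (theta_pmf n \<rho>) (\<lambda>\<theta>. exp (\<rho> * real n / 2) * exp (- 1 * overlap n \<theta> \<theta>))"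
    by (intro integral_mono fin) (auto simp: exp_add[symmetric])
  also have "\<dots> = exp (\<rho> * real n / 2) * measure_pmf.expectation (theta_pmf n \<rho>) (\<lambda>\<theta>. exp (- 1 * overlap n \<theta> \<theta>))"
    by simp
  also have "\<dots> \<le> exp (\<rho> * real n / 2) * exp (real n * \<rho> * (exp (- 1) - 1))"
    by (intro mult_left_mono overlap_self_mgf \<rho>) auto
  also have "\<dots> = exp (\<rho> * real n * (exp (- 1) - 1 / 2))"
    by (simp add: exp_add[symmetric] algebra_simps)
  also have "\<dots> \<le> exp (\<rho> * real n * (- (1 / 10)))"
  proof -
    have "1 + 1 + 1 / 2 \<le> exp (1 :: real)" using exp_lower_Taylor_quadratic[of 1] by simp
    then have "exp (- 1) \<le> 2 / (5 :: real)" by (simp add: exp_minus field_simps)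
    then show ?thesis using \<rho> by (simp only: exp_le_cancel_iff) (intro mult_left_mono, auto)
  qed
  finally show ?thesis by simp
qed

lemma pair_mean_left: "pair_mean n \<rho> (\<lambda>\<theta> _. f \<theta>) = measure_pmf.expectation (theta_pmf n \<rho>) f"
proof -
  have 1: "(\<Sum>\<theta>\<in>set_pmf (theta_pmf n \<rho>). pmf (theta_pmf n \<rho>) \<theta>) = 1"
    by (rule sum_pmf_eq_1[OF finite_set_theta_pmf]) simp
  have "pair_mean n \<rho> (\<lambda>\<theta> _. f \<theta>) = (\<Sum>\<theta>\<in>set_pmf (theta_pmf n \<rho>). pmf (theta_pmf n \<rho>) \<theta> * f \<theta> * (\<Sum>\<theta>\<in>set_pmf (theta_pmf n \<rho>). pmf (theta_pmf n \<rho>) \<theta>))"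
    unfolding pair_mean_def sum_distrib_left by (simp add: mult_ac)
  then show ?thesis unfolding 1 by (simp add: sum_pmf_theta)
qed

lemma pair_mean_right: "pair_mean n \<rho> (\<lambda>_ \<theta>'. f \<theta>') = measure_pmf.expectation (theta_pmf n \<rho>) f"
proof -
  have "pair_mean n \<rho> (\<lambda>_ \<theta>'. f \<theta>') = pair_mean n \<rho> (\<lambda>\<theta> _. f \<theta>)"
    unfolding pair_mean_def by (subst sum.swap) (simp add: mult.commute)
  then show ?thesis by (simp add: pair_mean_left)
qed

text \<open>With a = n \<rho>^2 the mean overlap, pairs are split at overlap 4 a. Below, the
  exponential is at most exp (8 \<lambda>^2 a^2) and the ratio at most (4 a)^2 / (\<rho>n / 2)^2 =
  64 \<rho>^2, unless one replica has fewer than half of its expected ones. Above, s \<le> n makes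
  the exponent linear in the overlap s, and inserting the factor exp (s - 4 a) > 1 reduces
  everything to an exponential moment.\<close>

lemma correlation_second_moment:
  assumes \<rho>: "0 < \<rho>" "\<rho> < 1" and lam: "lam\<^sup>2 * real n \<le> 1 / 20" and n: "0 < n"
  shows "pair_mean n \<rho> (\<lambda>\<theta> \<theta>'. exp (lam\<^sup>2 * (overlap n \<theta> \<theta>')\<^sup>2 / 2) *
           ((overlap n \<theta> \<theta>')\<^sup>2 / (overlap n \<theta> \<theta> * overlap n \<theta>' \<theta>')))
    \<le> exp (8 * lam\<^sup>2 * (real n * \<rho>\<^sup>2)\<^sup>2) * (64 * \<rho>\<^sup>2 + 2 * exp (- (\<rho> * real n / 10))) + exp (- 2 * (real n * \<rho>\<^sup>2))"
proof -
  define a where "a = real n * \<rho>\<^sup>2"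
  have a: "0 < a" using \<rho> n by (simp add: a_def)
  let ?E = "measure_pmf.expectation (theta_pmf n \<rho>)"
  let ?b = "\<lambda>\<theta>. of_bool (overlap n \<theta> \<theta> < \<rho> * real n / 2) :: real"
  let ?r = "1 + lam\<^sup>2 * real n / 2"
  have pt: "exp (lam\<^sup>2 * (overlap n \<theta> \<theta>')\<^sup>2 / 2) * ((overlap n \<theta> \<theta>')\<^sup>2 / (overlap n \<theta> \<theta> * overlap n \<theta>' \<theta>'))
     \<le> exp (8 * lam\<^sup>2 * a\<^sup>2) * (64 * \<rho>\<^sup>2 + (?b \<theta> + ?b \<theta>')) + exp (- 4 * a) * exp (?r * overlap n \<theta> \<theta>')" for \<theta> \<theta>'
  proof -
    define s k k' where "s = overlap n \<theta> \<theta>'" and "k = overlap n \<theta> \<theta>" and "k' = overlap n \<theta>' \<theta>'"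
    have s: "0 \<le> s" "s \<le> k" "s \<le> k'" "s \<le> real n"
      by (simp_all add: s_def k_def k'_def overlap_nonneg overlap_le_self overlap_le)
    define q where "q = s\<^sup>2 / (k * k')"
    have q0: "0 \<le> q" using s by (auto simp: q_def intro!: divide_nonneg_nonneg mult_nonneg_nonneg)
    have q1: "q \<le> 1"
    proof (cases "k * k' = 0")
      case False
      then have "0 < k * k'" using s by (simp add: less_le)
      moreover have "s\<^sup>2 \<le> k * k'" using s unfolding power2_eq_square by (intro mult_mono) auto
      ultimately show ?thesis by (simp add: q_def)
    qed (auto simp: q_def)
    have "exp (lam\<^sup>2 * s\<^sup>2 / 2) * q \<le> exp (8 * lam\<^sup>2 * a\<^sup>2) * (64 * \<rho>\<^sup>2 + (of_bool (k < \<rho> * real n / 2) + of_bool (k' < \<rho> * real n / 2))) + exp (- 4 * a) * exp (?r * s)"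
    proof (cases "s \<le> 4 * a")
      case True
      have "lam\<^sup>2 * s\<^sup>2 / 2 \<le> lam\<^sup>2 * (4 * a)\<^sup>2 / 2"
        using True s by (intro divide_right_mono mult_left_mono power_mono) auto
      then have "exp (lam\<^sup>2 * s\<^sup>2 / 2) \<le> exp (8 * lam\<^sup>2 * a\<^sup>2)" by (simp add: power_mult_distrib mult_ac)
      moreover have "q \<le> 64 * \<rho>\<^sup>2 + (of_bool (k < \<rho> * real n / 2) + of_bool (k' < \<rho> * real n / 2))"
      proof (cases "k < \<rho> * real n / 2 \<or> k' < \<rho> * real n / 2")
        case True
        then have "1 \<le> of_bool (k < \<rho> * real n / 2) + (of_bool (k' < \<rho> * real n / 2) :: real)" by auto
        moreover have "0 \<le> 64 * \<rho>\<^sup>2" by simp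
        ultimately show ?thesis using q1 by linarith
      next
        case False
        have pos: "0 < \<rho> * real n / 2" using \<rho> n by simp
        have "q \<le> (4 * a)\<^sup>2 / ((\<rho> * real n / 2) * (\<rho> * real n / 2))"
          unfolding q_def using False s True pos
          by (intro frac_le mult_mono power_mono mult_pos_pos) auto
        also have "\<dots> = 64 * \<rho>\<^sup>2"
          using \<rho> n by (simp add: a_def power2_eq_square field_simps)
        finally show ?thesis by simp
      qed
      ultimately have "exp (lam\<^sup>2 * s\<^sup>2 / 2) * q \<le> exp (8 * lam\<^sup>2 * a\<^sup>2) * (64 * \<rho>\<^sup>2 + (of_bool (k < \<rho> * real n / 2) + of_bool (k' < \<rho> * real n / 2)))"
        using q0 by (intro mult_mono) auto
      then show ?thesis by (simp add: add_increasing2)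
    next
      case False
      have "exp (lam\<^sup>2 * s\<^sup>2 / 2) * q \<le> exp (lam\<^sup>2 * s\<^sup>2 / 2) * 1" using q1 by (intro mult_left_mono) auto
      also have "\<dots> \<le> exp (lam\<^sup>2 * real n / 2 * s + (s - 4 * a))"
      proof -
        have "lam\<^sup>2 * s\<^sup>2 / 2 \<le> lam\<^sup>2 * (real n * s) / 2"
          using s by (intro divide_right_mono mult_left_mono) (auto simp: power2_eq_square intro: mult_right_mono)
        then show ?thesis using False by simp
      qed
      also have "\<dots> = exp (- 4 * a) * exp (?r * s)"
        by (simp add: exp_add[symmetric] algebra_simps)
      finally show ?thesis
        by (rule order.trans) (auto intro!: add_increasing mult_nonneg_nonneg)
    qed
    then show ?thesis by (simp add: s_def k_def k'_def q_def)
  qed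
  have "pair_mean n \<rho> (\<lambda>\<theta> \<theta>'. exp (lam\<^sup>2 * (overlap n \<theta> \<theta>')\<^sup>2 / 2) *
           ((overlap n \<theta> \<theta>')\<^sup>2 / (overlap n \<theta> \<theta> * overlap n \<theta>' \<theta>')))
    \<le> pair_mean n \<rho> (\<lambda>\<theta> \<theta>'. exp (8 * lam\<^sup>2 * a\<^sup>2) * (64 * \<rho>\<^sup>2 + (?b \<theta> + ?b \<theta>')) + exp (- 4 * a) * exp (?r * overlap n \<theta> \<theta>'))"
    by (rule pair_mean_mono[OF pt])
  also have "\<dots> = exp (8 * lam\<^sup>2 * a\<^sup>2) * (64 * \<rho>\<^sup>2 + (?E ?b + ?E ?b)) + exp (- 4 * a) * pair_mean n \<rho> (\<lambda>\<theta> \<theta>'. exp (?r * overlap n \<theta> \<theta>'))"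
    unfolding pair_mean_add pair_mean_cmult pair_mean_const pair_mean_left pair_mean_right ..
  also have "\<dots> \<le> exp (8 * lam\<^sup>2 * a\<^sup>2) * (64 * \<rho>\<^sup>2 + (exp (- (\<rho> * real n / 10)) + exp (- (\<rho> * real n / 10)))) + exp (- 4 * a) * exp (2 * a)"
  proof (intro add_mono mult_left_mono overlap_self_tail \<rho> order.refl)
    have "pair_mean n \<rho> (\<lambda>\<theta> \<theta>'. exp (?r * overlap n \<theta> \<theta>')) \<le> exp (a * (exp ?r - 1))"
      unfolding a_def by (rule overlap_mgf[OF \<rho>])
    also have "\<dots> \<le> exp (a * 2)"
    proof -
      \<comment> \<open>By the hypothesis on \<lambda>, \<open>?r\<close> is at most 1 + 1 / 40 and
        its exponential at most 3. The exponential moment is then at most exp (2 a), which exp (-4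
        a) outweighs.\<close>
      have "exp ?r \<le> exp (1 + 1 / 40)" using lam by (simp add: mult_ac)
      also have "\<dots> = exp 1 * exp (1 / 40 :: real)" by (rule exp_add)
      also have "\<dots> \<le> 2.72 * (1 + 1 / 40 + (1 / 40)\<^sup>2)"
        using e_less_272 by (intro mult_mono exp_bound) auto
      also have "\<dots> \<le> 3" by (simp add: power2_eq_square)
      finally show ?thesis using a by (simp only: exp_le_cancel_iff) (intro mult_left_mono, auto)
    qed
    finally show "pair_mean n \<rho> (\<lambda>\<theta> \<theta>'. exp (?r * overlap n \<theta> \<theta>')) \<le> exp (2 * a)" by (simp add: mult.commute)
  qed auto
  also have "\<dots> = exp (8 * lam\<^sup>2 * a\<^sup>2) * (64 * \<rho>\<^sup>2 + 2 * exp (- (\<rho> * real n / 10))) + exp (- 2 * a)"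
    by (simp add: exp_add[symmetric])
  finally show ?thesis by (simp add: a_def)
qed

section \<open>Derandomisation and weak signals\<close>

lemma exec_instr_measurable:
  assumes x: "\<And>i. (\<lambda>a. x a i) \<in> borel_measurable N" and \<omega>: "\<And>s. (\<lambda>a. \<omega> a s) \<in> borel_measurable N"
    and v: "\<And>r. (\<lambda>a. fst (S a) r) \<in> borel_measurable N" and out: "\<And>k. (\<lambda>a. snd (S a) k) \<in> borel_measurable N"
  shows "(\<lambda>a. fst (exec_instr (x a) (\<omega> a) ins (S a)) r) \<in> borel_measurable N"
    and "(\<lambda>a. snd (exec_instr (x a) (\<omega> a) ins (S a)) k) \<in> borel_measurable N"
proof -
  note [measurable] = x \<omega> v out
  have S: "S a = (fst (S a), snd (S a))" for a by simp
  show "(\<lambda>a. fst (exec_instr (x a) (\<omega> a) ins (S a)) r) \<in> borel_measurable N"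
    by (subst S, cases ins) (simp_all only: exec_instr.simps fst_conv fun_upd_apply, measurable)
  show "(\<lambda>a. snd (exec_instr (x a) (\<omega> a) ins (S a)) k) \<in> borel_measurable N"
    by (subst S, cases ins) (simp_all only: exec_instr.simps snd_conv fun_upd_apply, measurable)
qed

lemma run_prog_measurable:
  assumes x: "\<And>i. (\<lambda>a. x a i) \<in> borel_measurable N" and \<omega>: "\<And>s. (\<lambda>a. \<omega> a s) \<in> borel_measurable N"
  shows "(\<lambda>a. run_prog p (x a) (\<omega> a) k) \<in> borel_measurable N"
proof -
  have "(\<forall>r. (\<lambda>a. fst (fold (exec_instr (x a) (\<omega> a)) p (S a)) r) \<in> borel_measurable N) \<and>
        (\<forall>k. (\<lambda>a. snd (fold (exec_instr (x a) (\<omega> a)) p (S a)) k) \<in> borel_measurable N)"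
    if "\<And>r. (\<lambda>a. fst (S a) r) \<in> borel_measurable N" "\<And>k. (\<lambda>a. snd (S a) k) \<in> borel_measurable N" for S
    using that
  proof (induction p arbitrary: S)
    case (Cons ins p)
    show ?case
      unfolding fold_Cons comp_def
      by (rule Cons.IH) (rule exec_instr_measurable[OF x \<omega> Cons.prems])+
  qed simp
  from this[of "\<lambda>_. (\<lambda>_. 0, \<lambda>_. 0)"] show ?thesis by (simp add: run_prog_def)
qed

text \<open>A program may read an index outside \<open>I\<close>. There all points of the product
  space have the same value \<open>undefined\<close>, so evaluation is measurable at every
  index.\<close>

lemma measurable_PiM_apply:
  "(\<lambda>x. x i) \<in> borel_measurable (PiM I (\<lambda>_. borel :: real measure))"
proof (cases "i \<in> I")
  case False
  then have "(\<lambda>x. x i) \<in> borel_measurable (PiM I (\<lambda>_. borel :: real measure)) \<longleftrightarrow> (\<lambda>x. undefined :: real) \<in> borel_measurable (PiM I (\<lambda>_. borel :: real measure))"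
    by (intro measurable_cong) (auto simp: space_PiM PiE_iff extensional_def)
  then show ?thesis by simp
qed simp

text \<open>The cosine of the angle between two matrices, 0 if one of them vanishes; this is the
  integrand of \<open>recovery_score\<close>.\<close>

definition corr :: "nat \<Rightarrow> (nat \<times> nat \<Rightarrow> real) \<Rightarrow> (nat \<times> nat \<Rightarrow> real) \<Rightarrow> real" where
  "corr n X Z = frob_inner n X Z / (frob_norm n X * frob_norm n Z)"

lemma frob_inner_self_nonneg: "0 \<le> frob_inner n X X"
  by (auto simp: frob_inner_def intro: sum_nonneg)

lemma frob_norm_nonneg: "0 \<le> frob_norm n X"
  by (simp add: frob_norm_def frob_inner_self_nonneg)

lemma frob_norm_sq: "(frob_norm n X)\<^sup>2 = frob_inner n X X"
  by (simp add: frob_norm_def frob_inner_self_nonneg)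

lemma abs_frob_inner_le: "\<bar>frob_inner n X Z\<bar> \<le> frob_norm n X * frob_norm n Z"
proof -
  have "(frob_inner n X Z)\<^sup>2 \<le> (frob_norm n X * frob_norm n Z)\<^sup>2"
    unfolding power_mult_distrib frob_norm_sq unfolding frob_inner_def
    using Cauchy_Schwarz_ineq_sum[of X Z "entries n"] by (simp add: power2_eq_square)
  then show ?thesis
    by (rule abs_le_square_iff[THEN iffD2, THEN order.trans]) (simp add: frob_norm_nonneg)
qed

lemma abs_corr_le: "\<bar>corr n X Z\<bar> \<le> 1"
proof (cases "frob_norm n X * frob_norm n Z = 0")
  case False
  then have "0 < frob_norm n X * frob_norm n Z"
    using frob_norm_nonneg[of n X] frob_norm_nonneg[of n Z] by (simp add: less_le)
  then show ?thesis
    using abs_frob_inner_le[of n X Z] by (simp add: corr_def abs_divide)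
qed (auto simp: corr_def)

lemma corr_measurable:
  assumes "\<And>e. (\<lambda>a. X a e) \<in> borel_measurable N" "\<And>e. (\<lambda>a. Z a e) \<in> borel_measurable N"
  shows "(\<lambda>a. corr n (X a) (Z a)) \<in> borel_measurable N"
proof -
  note [measurable] = assms
  show ?thesis unfolding corr_def frob_norm_def frob_inner_def by measurable
qed

lemma frob_inner_signal: "frob_inner n (signal lam \<theta>) (signal lam \<theta>') = lam\<^sup>2 * (overlap n \<theta> \<theta>')\<^sup>2"
proof -
  have "frob_inner n (signal lam \<theta>) (signal lam \<theta>') = 2 * gauss_inner entry_sd (upper n) (signal lam \<theta>) (signal lam \<theta>')"
    unfolding frob_inner_def gauss_inner_def by (rule sum_entries_upper) (simp add: signal_sort_pair)
  then show ?thesis by (simp add: gauss_inner_signal)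
qed

lemma frob_norm_signal: "0 \<le> lam \<Longrightarrow> frob_norm n (signal lam \<theta>) = lam * overlap n \<theta> \<theta>"
  by (simp add: frob_norm_def frob_inner_signal real_sqrt_mult overlap_nonneg)

text \<open>The score of a deterministic estimator, computed conditionally on \<theta>.
  \<open>X\<close> is an arbitrary map because the bound for weak signals is
  information-theoretic.\<close>

definition det_score :: "nat \<Rightarrow> real \<Rightarrow> real \<Rightarrow> ((nat \<times> nat \<Rightarrow> real) \<Rightarrow> nat \<times> nat \<Rightarrow> real) \<Rightarrow> real" where
  "det_score n lam \<rho> X = measure_pmf.expectation (theta_pmf n \<rho>)
     (\<lambda>\<theta>. \<integral>y. corr n (X y) (signal lam \<theta>) \<partial>gauss_image entry_sd (upper n) (entries n) sort_pair (signal lam \<theta>))"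

lemma prob_space_gauss_tape: "prob_space gauss_tape"
  unfolding gauss_tape_def by (intro prob_space_PiM prob_space_normal_density) simp

lemma sets_gauss_tape: "sets gauss_tape = sets (PiM UNIV (\<lambda>_. borel))"
  unfolding gauss_tape_def by (intro sets_PiM_cong) auto

lemma prob_space_model_space: "prob_space (model_space n \<rho>)"
proof -
  interpret N: prob_space "noise_law n" by (rule prob_space_noise_law)
  interpret P: pair_prob_space "measure_pmf (theta_pmf n \<rho>)" "noise_law n" ..
  show ?thesis unfolding model_space_def by (rule P.prob_space_axioms)
qed

text \<open>The score is the average over the tape of the scores with a frozen tape, so some tape
  reaches it. Its cells can later be hard-wired as constants.\<close>

lemma derandomised_score:
  assumes c: "c \<le> recovery_score n lam \<rho> p"
  obtains \<omega> where "c \<le> det_score n lam \<rho> (\<lambda>y. run_prog p y \<omega>)"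
proof -
  let ?\<pi> = "theta_pmf n \<rho>"
  interpret T: prob_space gauss_tape by (rule prob_space_gauss_tape)
  interpret N: prob_space "noise_law n" by (rule prob_space_noise_law)
  interpret Mo: prob_space "model_space n \<rho>" by (rule prob_space_model_space)
  interpret P: pair_prob_space "model_space n \<rho>" gauss_tape ..
  interpret P': pair_prob_space "measure_pmf ?\<pi>" "noise_law n" ..
  define F where "F = (\<lambda>m \<omega>. corr n (run_prog p (observation n lam m) \<omega>) (signal lam (fst m)))"
  have obs: "(\<lambda>m. observation n lam m e) \<in> borel_measurable (model_space n \<rho>)" for e
    by (rule measurable_compose[OF observation_measurable measurable_PiM_apply])
  have tape: "(\<lambda>\<omega>. \<omega> s) \<in> borel_measurable gauss_tape" for s
    unfolding measurable_cong_sets[OF sets_gauss_tape refl] by (rule measurable_PiM_apply)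
  have sig: "(\<lambda>m. signal lam (fst m) e) \<in> borel_measurable (model_space n \<rho>)" for e
    unfolding model_space_def by (rule measurable_compose[OF measurable_fst]) simp
  have Fm: "case_prod F \<in> borel_measurable (model_space n \<rho> \<Otimes>\<^sub>M gauss_tape)"
    unfolding F_def case_prod_unfold
    by (intro corr_measurable run_prog_measurable measurable_compose[OF measurable_fst obs]
        measurable_compose[OF measurable_snd tape] measurable_compose[OF measurable_fst sig])
  have Fi: "integrable (model_space n \<rho> \<Otimes>\<^sub>M gauss_tape) (case_prod F)"
    using Fm by (intro P.integrable_const_bound[where B=1]) (auto simp: F_def abs_corr_le)
  have "recovery_score n lam \<rho> p = (\<integral>a. case_prod F a \<partial>(model_space n \<rho> \<Otimes>\<^sub>M gauss_tape))"
    unfolding recovery_score_def F_def corr_def Let_def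
    by (intro Bochner_Integration.integral_cong refl) (auto split: prod.splits)
  also have "\<dots> = (\<integral>\<omega>. (\<integral>m. F m \<omega> \<partial>model_space n \<rho>) \<partial>gauss_tape)"
    using P.integral_snd[OF Fi] by simp
  finally have c': "c \<le> (\<integral>\<omega>. (\<integral>m. F m \<omega> \<partial>model_space n \<rho>) \<partial>gauss_tape)" using c by simp
  have Gi: "integrable gauss_tape (\<lambda>\<omega>. \<integral>m. F m \<omega> \<partial>model_space n \<rho>)"
    by (rule P.integrable_snd[OF Fi])
  obtain \<omega> where \<omega>: "c \<le> (\<integral>m. F m \<omega> \<partial>model_space n \<rho>)"
  proof (rule ccontr)
    assume "\<not> thesis"
    then have "(\<integral>m. F m \<omega> \<partial>model_space n \<rho>) < c" for \<omega> using that by (meson not_le)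
    then have "(\<integral>\<omega>. (\<integral>m. F m \<omega> \<partial>model_space n \<rho>) \<partial>gauss_tape) < c"
      by (intro T.expectation_less Gi) auto
    with c' show False by simp
  qed
  have Fm': "(\<lambda>m. F m \<omega>) \<in> borel_measurable (model_space n \<rho>)"
    unfolding F_def by (intro corr_measurable run_prog_measurable obs sig) simp
  have "integrable (model_space n \<rho>) (\<lambda>m. F m \<omega>)"
    using Fm' by (intro Mo.integrable_const_bound[where B=1]) (auto simp: F_def abs_corr_le)
  then have Fi': "integrable (measure_pmf ?\<pi> \<Otimes>\<^sub>M noise_law n) (case_prod (\<lambda>\<theta> W. F (\<theta>, W) \<omega>))"
    unfolding model_space_def by (simp add: case_prod_unfold)
  have "(\<integral>m. F m \<omega> \<partial>model_space n \<rho>) = (\<integral>\<theta>. (\<integral>W. F (\<theta>, W) \<omega> \<partial>noise_law n) \<partial>measure_pmf ?\<pi>)"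
    using P'.integral_fst[OF Fi'] unfolding model_space_def by (simp add: case_prod_unfold)
  also have "\<dots> = det_score n lam \<rho> (\<lambda>y. run_prog p y \<omega>)"
    unfolding det_score_def
  proof (rule Bochner_Integration.integral_cong[OF refl])
    fix \<theta>
    have m: "(\<lambda>y. corr n (run_prog p y \<omega>) (signal lam \<theta>)) \<in> borel_measurable (PiM (entries n) (\<lambda>_. borel))"
      by (intro corr_measurable run_prog_measurable measurable_PiM_apply) simp_all
    show "(\<integral>W. F (\<theta>, W) \<omega> \<partial>noise_law n) = (\<integral>y. corr n (run_prog p y \<omega>) (signal lam \<theta>) \<partial>gauss_image entry_sd (upper n) (entries n) sort_pair (signal lam \<theta>))"
      unfolding noise_law_shift[symmetric] by (subst integral_distr[OF observation_shift_measurable m]) (simp add: F_def)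
  qed
  finally have "c \<le> det_score n lam \<rho> (\<lambda>y. run_prog p y \<omega>)" using \<omega> by simp
  then show thesis by (rule that)
qed

text \<open>
  Exchanging the order of integration, the score is the mean of the inner product of the unit vector
  \<open>X / \<parallel>X\<parallel>\<close> with the unnormalised posterior mean of \<open>\<theta>\<theta>\<^sup>T / \<parallel>\<theta>\<theta>\<^sup>T\<parallel>\<close>, which does not depend on \<open>X\<close>.
\<close>

lemma det_score_le:
  fixes X :: "(nat \<times> nat \<Rightarrow> real) \<Rightarrow> nat \<times> nat \<Rightarrow> real"
  assumes X: "\<And>e. (\<lambda>y. X y e) \<in> borel_measurable (PiM (entries n) (\<lambda>_. borel))"
    and lam: "0 \<le> lam" and \<alpha>: "0 < \<alpha>"
  shows "det_score n lam \<rho> X \<le> \<alpha> / 2 + pair_mean n \<rho> (\<lambda>\<theta> \<theta>'. exp (lam\<^sup>2 * (overlap n \<theta> \<theta>')\<^sup>2 / 2) *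
           ((overlap n \<theta> \<theta>')\<^sup>2 / (overlap n \<theta> \<theta> * overlap n \<theta>' \<theta>'))) / (2 * \<alpha>)"
proof -
  let ?\<gamma> = "gauss_prod entry_sd (upper n)"
  let ?\<pi> = "theta_pmf n \<rho>"
  let ?S = "set_pmf ?\<pi>"
  let ?T = "\<lambda>\<theta>. tilt entry_sd (upper n) (signal lam \<theta>)"
  let ?K = "\<lambda>\<theta> \<theta>'. lam\<^sup>2 * (overlap n \<theta> \<theta>')\<^sup>2 / 2"
  let ?f = "\<lambda>w. \<lambda>e\<in>entries n. (w (sort_pair e) :: real)"
  note tp = tilt_pos[THEN less_imp_le]
  \<comment> \<open>By the convention for division, \<open>u\<close> and \<open>v\<close> are unit
    vectors or zero, hence of norm at most 1 in every case.\<close>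
  define u where "u w e = X (?f w) e / frob_norm n (X (?f w))" for w e
  define v where "v \<theta> e = signal lam \<theta> e / frob_norm n (signal lam \<theta>)" for \<theta> e
  define g where "g e w = (\<Sum>\<theta>\<in>?S. pmf ?\<pi> \<theta> * v \<theta> e * ?T \<theta> w)" for e w
  interpret G: prob_space ?\<gamma> by (rule prob_space_gauss_prod[OF entry_sd_pos])
  have fm: "?f \<in> measurable (PiM (upper n) (\<lambda>_. borel)) (PiM (entries n) (\<lambda>_. borel))"
    using measurable_feature[OF entry_sd_pos finite_upper _ sort_pair_entries, of n "\<lambda>_. 0"]
    by (simp add: measurable_gauss_prod1)
  have Xm: "(\<lambda>w. X (?f w) e) \<in> borel_measurable (PiM (upper n) (\<lambda>_. borel))" for e
    by (rule measurable_compose[OF fm X])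
  have um: "(\<lambda>w. u w e) \<in> borel_measurable ?\<gamma>" for e
  proof -
    note [measurable] = Xm
    show ?thesis
      unfolding u_def frob_norm_def frob_inner_def measurable_gauss_prod1 by measurable
  qed
  have Tm: "?T \<theta> \<in> borel_measurable ?\<gamma>" for \<theta>
    using borel_measurable_tilt by (simp add: measurable_gauss_prod1)
  have gm: "g e \<in> borel_measurable ?\<gamma>" for e
    unfolding g_def using Tm by (intro borel_measurable_sum borel_measurable_times) auto
  have usum: "(\<Sum>e\<in>entries n. (u w e)\<^sup>2) \<le> 1" for w
  proof -
    have "(\<Sum>e\<in>entries n. (u w e)\<^sup>2) = frob_inner n (X (?f w)) (X (?f w)) / (frob_norm n (X (?f w)))\<^sup>2"
      unfolding u_def frob_inner_def by (simp add: power_divide sum_divide_distrib power2_eq_square)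
    then show ?thesis by (simp add: frob_norm_sq)
  qed
  have u1: "\<bar>u w e\<bar> \<le> 1" if "e \<in> entries n" for w e
  proof -
    have "(u w e)\<^sup>2 \<le> (\<Sum>e\<in>entries n. (u w e)\<^sup>2)" using that by (intro member_le_sum) auto
    then have "(u w e)\<^sup>2 \<le> 1\<^sup>2" using usum[of w] by simp
    then show ?thesis using abs_le_square_iff[of "u w e" 1] by simp
  qed
  have Ti: "integrable ?\<gamma> (?T \<theta>)" for \<theta>
    using has_bochner_integral_tilt[OF entry_sd_pos finite_upper] by (auto simp: has_bochner_integral_iff)
  have uTi: "integrable ?\<gamma> (\<lambda>w. u w e * ?T \<theta> w)" if "e \<in> entries n" for e \<theta>
  proof (rule Bochner_Integration.integrable_bound[OF Ti[of \<theta>]])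
    show "(\<lambda>w. u w e * ?T \<theta> w) \<in> borel_measurable ?\<gamma>" using um Tm by (intro borel_measurable_times)
    show "AE w in ?\<gamma>. norm (u w e * ?T \<theta> w) \<le> norm (?T \<theta> w)"
      using u1[OF that] tp by (auto simp: abs_mult intro!: mult_left_le_one_le)
  qed
  have inner: "(\<integral>y. corr n (X y) (signal lam \<theta>) \<partial>gauss_image entry_sd (upper n) (entries n) sort_pair (signal lam \<theta>))
     = (\<Sum>e\<in>entries n. v \<theta> e * (\<integral>w. u w e * ?T \<theta> w \<partial>?\<gamma>))" for \<theta>
  proof -
    have cm: "(\<lambda>y. corr n (X y) (signal lam \<theta>)) \<in> borel_measurable (PiM (entries n) (\<lambda>_. borel))"
      by (intro corr_measurable X) simp
    have cm': "(\<lambda>w. corr n (X (?f w)) (signal lam \<theta>)) \<in> borel_measurable (PiM (upper n) (\<lambda>_. borel))"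
      by (rule measurable_compose[OF fm cm])
    have "(\<integral>y. corr n (X y) (signal lam \<theta>) \<partial>gauss_image entry_sd (upper n) (entries n) sort_pair (signal lam \<theta>))
       = (\<integral>w. corr n (X (?f w)) (signal lam \<theta>) \<partial>density ?\<gamma> (?T \<theta>))"
      unfolding gauss_image_tilt[OF entry_sd_pos finite_upper finite_cartesian_product[OF finite_lessThan finite_lessThan] sort_pair_entries]
      using fm cm by (subst integral_distr) (auto simp: measurable_gauss_prod1)
    also have "\<dots> = (\<integral>w. ?T \<theta> w * corr n (X (?f w)) (signal lam \<theta>) \<partial>?\<gamma>)"
      using cm' Tm by (subst integral_density) (auto simp: measurable_gauss_prod1 tp)
    also have "\<dots> = (\<integral>w. (\<Sum>e\<in>entries n. v \<theta> e * (u w e * ?T \<theta> w)) \<partial>?\<gamma>)"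
    proof (intro Bochner_Integration.integral_cong refl)
      fix w
      have "corr n (X (?f w)) (signal lam \<theta>) = (\<Sum>e\<in>entries n. u w e * v \<theta> e)"
        unfolding corr_def u_def v_def frob_inner_def by (simp add: sum_divide_distrib)
      then show "?T \<theta> w * corr n (X (?f w)) (signal lam \<theta>) = (\<Sum>e\<in>entries n. v \<theta> e * (u w e * ?T \<theta> w))"
        by (simp add: sum_distrib_left mult_ac)
    qed
    also have "\<dots> = (\<Sum>e\<in>entries n. v \<theta> e * (\<integral>w. u w e * ?T \<theta> w \<partial>?\<gamma>))"
      by (subst Bochner_Integration.integral_sum) (auto intro!: integrable_mult_right uTi)
    finally show ?thesis .
  qed
  have ug: "integrable ?\<gamma> (\<lambda>w. u w e * g e w)" and ugi: "(\<integral>w. u w e * g e w \<partial>?\<gamma>) = (\<Sum>\<theta>\<in>?S. pmf ?\<pi> \<theta> * v \<theta> e * (\<integral>w. u w e * ?T \<theta> w \<partial>?\<gamma>))"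
    if e: "e \<in> entries n" for e
  proof -
    have eq: "(\<lambda>w. u w e * g e w) = (\<lambda>w. \<Sum>\<theta>\<in>?S. (pmf ?\<pi> \<theta> * v \<theta> e) * (u w e * ?T \<theta> w))"
      unfolding g_def by (intro ext) (simp add: sum_distrib_left mult_ac)
    show "integrable ?\<gamma> (\<lambda>w. u w e * g e w)"
      unfolding eq by (intro Bochner_Integration.integrable_sum integrable_mult_right uTi e)
    show "(\<integral>w. u w e * g e w \<partial>?\<gamma>) = (\<Sum>\<theta>\<in>?S. pmf ?\<pi> \<theta> * v \<theta> e * (\<integral>w. u w e * ?T \<theta> w \<partial>?\<gamma>))"
      unfolding eq by (subst Bochner_Integration.integral_sum) (auto intro!: integrable_mult_right uTi e)
  qed
  have g2: "has_bochner_integral ?\<gamma> (\<lambda>w. (g e w)\<^sup>2) (\<Sum>\<theta>\<in>?S. \<Sum>\<theta>'\<in>?S. (pmf ?\<pi> \<theta> * v \<theta> e) * (pmf ?\<pi> \<theta>' * v \<theta>' e) * exp (?K \<theta> \<theta>'))" for e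
  proof -
    have eq: "(\<lambda>w. (g e w)\<^sup>2) = (\<lambda>w. \<Sum>\<theta>\<in>?S. \<Sum>\<theta>'\<in>?S. (pmf ?\<pi> \<theta> * v \<theta> e) * (pmf ?\<pi> \<theta>' * v \<theta>' e) * (?T \<theta> w * ?T \<theta>' w))"
      unfolding g_def power2_eq_square sum_product by (intro ext sum.cong refl) (simp add: mult_ac)
    show ?thesis
      unfolding eq gauss_inner_signal[symmetric]
      by (intro has_bochner_integral_sum has_bochner_integral_mult_right has_bochner_integral_tilt_mult entry_sd_pos finite_upper)
  qed
  have u2: "integrable ?\<gamma> (\<lambda>w. (u w e)\<^sup>2)" if "e \<in> entries n" for e
    using um[of e] u1[OF that] by (intro G.integrable_const_bound[where B=1]) (auto simp: abs_square_le_1)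
  have "det_score n lam \<rho> X = (\<Sum>\<theta>\<in>?S. pmf ?\<pi> \<theta> * (\<Sum>e\<in>entries n. v \<theta> e * (\<integral>w. u w e * ?T \<theta> w \<partial>?\<gamma>)))"
    unfolding det_score_def inner sum_pmf_theta ..
  also have "\<dots> = (\<Sum>e\<in>entries n. \<integral>w. u w e * g e w \<partial>?\<gamma>)"
    by (simp add: ugi sum_distrib_left mult.assoc) (rule sum.swap)
  also have "\<dots> \<le> (\<Sum>e\<in>entries n. \<integral>w. \<alpha> / 2 * (u w e)\<^sup>2 + 1 / (2 * \<alpha>) * (g e w)\<^sup>2 \<partial>?\<gamma>)"
  proof (intro sum_mono integral_mono ug)
    fix e w assume e: "e \<in> entries n"
    show "integrable ?\<gamma> (\<lambda>w. \<alpha> / 2 * (u w e)\<^sup>2 + 1 / (2 * \<alpha>) * (g e w)\<^sup>2)"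
      using u2[OF e] g2 by (auto simp: has_bochner_integral_iff)
    \<comment> \<open>Weighted AM-GM in each entry. The weight \<alpha> is left free; the
      application takes the recovery level for it.\<close>
    have "0 \<le> (\<alpha> * u w e - g e w)\<^sup>2 / (2 * \<alpha>)" using \<alpha> by simp
    also have "\<dots> = \<alpha> / 2 * (u w e)\<^sup>2 + 1 / (2 * \<alpha>) * (g e w)\<^sup>2 - u w e * g e w"
      using \<alpha> by (simp add: power2_eq_square field_simps)
    finally show "u w e * g e w \<le> \<alpha> / 2 * (u w e)\<^sup>2 + 1 / (2 * \<alpha>) * (g e w)\<^sup>2" by simp
  qed
  also have "\<dots> = (\<Sum>e\<in>entries n. \<alpha> / 2 * (\<integral>w. (u w e)\<^sup>2 \<partial>?\<gamma>) + 1 / (2 * \<alpha>) * (\<integral>w. (g e w)\<^sup>2 \<partial>?\<gamma>))"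
    using u2 g2 by (intro sum.cong refl) (auto simp: has_bochner_integral_iff)
  also have "\<dots> = \<alpha> / 2 * (\<integral>w. (\<Sum>e\<in>entries n. (u w e)\<^sup>2) \<partial>?\<gamma>) + 1 / (2 * \<alpha>) * (\<Sum>e\<in>entries n. \<integral>w. (g e w)\<^sup>2 \<partial>?\<gamma>)"
    using u2 by (subst Bochner_Integration.integral_sum) (auto simp: sum.distrib sum_distrib_left)
  also have "\<dots> \<le> \<alpha> / 2 * 1 + 1 / (2 * \<alpha>) * pair_mean n \<rho> (\<lambda>\<theta> \<theta>'. exp (?K \<theta> \<theta>') * ((overlap n \<theta> \<theta>')\<^sup>2 / (overlap n \<theta> \<theta> * overlap n \<theta>' \<theta>')))"
  proof (intro add_mono mult_left_mono)
    show "(\<integral>w. (\<Sum>e\<in>entries n. (u w e)\<^sup>2) \<partial>?\<gamma>) \<le> 1"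
      using u2 usum by (intro G.integral_le_const) auto
    have "(\<Sum>e\<in>entries n. \<integral>w. (g e w)\<^sup>2 \<partial>?\<gamma>) = (\<Sum>\<theta>\<in>?S. \<Sum>\<theta>'\<in>?S. \<Sum>e\<in>entries n. (pmf ?\<pi> \<theta> * v \<theta> e) * (pmf ?\<pi> \<theta>' * v \<theta>' e) * exp (?K \<theta> \<theta>'))"
      unfolding has_bochner_integral_integral_eq[OF g2]
      by (subst sum.swap, intro sum.cong refl, rule sum.swap)
    also have "\<dots> = pair_mean n \<rho> (\<lambda>\<theta> \<theta>'. exp (?K \<theta> \<theta>') * (\<Sum>e\<in>entries n. v \<theta> e * v \<theta>' e))"
      unfolding pair_mean_def by (simp only: sum_distrib_left) (intro sum.cong refl, simp add: mult_ac)
    also have "\<dots> \<le> pair_mean n \<rho> (\<lambda>\<theta> \<theta>'. exp (?K \<theta> \<theta>') * ((overlap n \<theta> \<theta>')\<^sup>2 / (overlap n \<theta> \<theta> * overlap n \<theta>' \<theta>')))"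
    proof (intro pair_mean_mono mult_left_mono)
      fix \<theta> \<theta>'
      have "(\<Sum>e\<in>entries n. v \<theta> e * v \<theta>' e) = frob_inner n (signal lam \<theta>) (signal lam \<theta>') / (frob_norm n (signal lam \<theta>) * frob_norm n (signal lam \<theta>'))"
        unfolding v_def frob_inner_def by (simp add: sum_divide_distrib)
      also have "\<dots> = lam\<^sup>2 * (overlap n \<theta> \<theta>')\<^sup>2 / (lam\<^sup>2 * (overlap n \<theta> \<theta> * overlap n \<theta>' \<theta>'))"
        unfolding frob_inner_signal frob_norm_signal[OF lam] by (simp add: power2_eq_square mult_ac)
      \<comment> \<open>For \<lambda> = 0 the left side is 0 by the convention for division, hence
        an inequality in place of an equation.\<close>
      also have "\<dots> \<le> (overlap n \<theta> \<theta>')\<^sup>2 / (overlap n \<theta> \<theta> * overlap n \<theta>' \<theta>')"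
        by (cases "lam = 0") (auto intro!: divide_nonneg_nonneg mult_nonneg_nonneg overlap_nonneg)
      finally show "(\<Sum>e\<in>entries n. v \<theta> e * v \<theta>' e) \<le> (overlap n \<theta> \<theta>')\<^sup>2 / (overlap n \<theta> \<theta> * overlap n \<theta>' \<theta>')" .
    qed simp
    finally show "(\<Sum>e\<in>entries n. \<integral>w. (g e w)\<^sup>2 \<partial>?\<gamma>) \<le> pair_mean n \<rho> (\<lambda>\<theta> \<theta>'. exp (?K \<theta> \<theta>') * ((overlap n \<theta> \<theta>')\<^sup>2 / (overlap n \<theta> \<theta> * overlap n \<theta>' \<theta>')))" .
  qed (use \<alpha> in auto)
  finally show ?thesis by simp
qed

section \<open>The clone test\<close>

lemma normal_density_rotate:
  "normal_density 0 s ((u + v) / sqrt 2) * normal_density 0 s ((u - v) / sqrt 2) = normal_density 0 s u * normal_density 0 s v"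
proof -
  have "exp (- ((u + v) / sqrt 2)\<^sup>2 / (2 * s\<^sup>2)) * exp (- ((u - v) / sqrt 2)\<^sup>2 / (2 * s\<^sup>2)) = exp (- u\<^sup>2 / (2 * s\<^sup>2)) * exp (- v\<^sup>2 / (2 * s\<^sup>2))"
    unfolding exp_add[symmetric]
    by (cases "s = 0") (simp_all add: power_divide field_simps power2_eq_square)
  then show ?thesis
    unfolding normal_density_def by (simp add: mult_ac)
qed

text \<open>The planar Gaussian is invariant under the orthogonal map to normalised sum and
  difference. Two one-dimensional substitutions achieve this; their Jacobians sqrt 2 and 1 / sqrt 2
  cancel.\<close>

lemma nn_integral_normal_rotate:
  fixes F :: "real \<times> real \<Rightarrow> ennreal"
  assumes [measurable]: "F \<in> borel_measurable (borel \<Otimes>\<^sub>M borel)"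
  shows "(\<integral>\<^sup>+w. \<integral>\<^sup>+z. F ((w + z) / sqrt 2, (w - z) / sqrt 2) \<partial>density lborel (normal_density 0 s) \<partial>density lborel (normal_density 0 s))
      = (\<integral>\<^sup>+u. \<integral>\<^sup>+v. F (u, v) \<partial>density lborel (normal_density 0 s) \<partial>density lborel (normal_density 0 s))"
proof -
  let ?\<phi> = "\<lambda>x. ennreal (normal_density 0 s x)"
  have exp2: "(\<integral>\<^sup>+w. \<integral>\<^sup>+z. G w z \<partial>density lborel ?\<phi> \<partial>density lborel ?\<phi>) = (\<integral>\<^sup>+w. \<integral>\<^sup>+z. ?\<phi> w * (?\<phi> z * G w z) \<partial>lborel \<partial>lborel)"
    if [measurable]: "case_prod G \<in> borel_measurable (borel \<Otimes>\<^sub>M borel)" for G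
  proof -
    have "(\<integral>\<^sup>+w. \<integral>\<^sup>+z. G w z \<partial>density lborel ?\<phi> \<partial>density lborel ?\<phi>) = (\<integral>\<^sup>+w. (\<integral>\<^sup>+z. ?\<phi> z * G w z \<partial>lborel) \<partial>density lborel ?\<phi>)"
      by (intro nn_integral_cong) (simp add: nn_integral_density)
    also have "\<dots> = (\<integral>\<^sup>+w. ?\<phi> w * (\<integral>\<^sup>+z. ?\<phi> z * G w z \<partial>lborel) \<partial>lborel)"
      by (subst nn_integral_density) auto
    also have "\<dots> = (\<integral>\<^sup>+w. \<integral>\<^sup>+z. ?\<phi> w * (?\<phi> z * G w z) \<partial>lborel \<partial>lborel)"
      by (intro nn_integral_cong) (simp add: nn_integral_cmult)
    finally show ?thesis .
  qed
  have "(\<integral>\<^sup>+w. \<integral>\<^sup>+z. F ((w + z) / sqrt 2, (w - z) / sqrt 2) \<partial>density lborel ?\<phi> \<partial>density lborel ?\<phi>)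
      = (\<integral>\<^sup>+w. \<integral>\<^sup>+z. ?\<phi> w * (?\<phi> z * F ((w + z) / sqrt 2, (w - z) / sqrt 2)) \<partial>lborel \<partial>lborel)"
    by (rule exp2) measurable
  also have "\<dots> = (\<integral>\<^sup>+w. \<integral>\<^sup>+u. ennreal (sqrt 2) * (?\<phi> w * (?\<phi> (sqrt 2 * u - w) * F (u, sqrt 2 * w - u))) \<partial>lborel \<partial>lborel)"
  proof (rule nn_integral_cong)
    fix w :: real
    have "(\<integral>\<^sup>+z. ?\<phi> w * (?\<phi> z * F ((w + z) / sqrt 2, (w - z) / sqrt 2)) \<partial>lborel)
       = ennreal \<bar>sqrt 2\<bar> * (\<integral>\<^sup>+u. ?\<phi> w * (?\<phi> (- w + sqrt 2 * u) * F ((w + (- w + sqrt 2 * u)) / sqrt 2, (w - (- w + sqrt 2 * u)) / sqrt 2)) \<partial>lborel)"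
      by (rule nn_integral_real_affine) auto
    also have "\<dots> = (\<integral>\<^sup>+u. ennreal (sqrt 2) * (?\<phi> w * (?\<phi> (- w + sqrt 2 * u) * F ((w + (- w + sqrt 2 * u)) / sqrt 2, (w - (- w + sqrt 2 * u)) / sqrt 2))) \<partial>lborel)"
      by (subst nn_integral_cmult) auto
    also have "\<dots> = (\<integral>\<^sup>+u. ennreal (sqrt 2) * (?\<phi> w * (?\<phi> (sqrt 2 * u - w) * F (u, sqrt 2 * w - u))) \<partial>lborel)"
    proof (rule nn_integral_cong)
      fix u :: real
      have "(w - (- w + sqrt 2 * u)) / sqrt 2 = sqrt 2 * w - u"
        by (simp add: field_simps)
      then show "ennreal (sqrt 2) * (?\<phi> w * (?\<phi> (- w + sqrt 2 * u) * F ((w + (- w + sqrt 2 * u)) / sqrt 2, (w - (- w + sqrt 2 * u)) / sqrt 2)))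
         = ennreal (sqrt 2) * (?\<phi> w * (?\<phi> (sqrt 2 * u - w) * F (u, sqrt 2 * w - u)))"
        by (simp add: add.commute)
    qed
    finally show "(\<integral>\<^sup>+z. ?\<phi> w * (?\<phi> z * F ((w + z) / sqrt 2, (w - z) / sqrt 2)) \<partial>lborel)
       = (\<integral>\<^sup>+u. ennreal (sqrt 2) * (?\<phi> w * (?\<phi> (sqrt 2 * u - w) * F (u, sqrt 2 * w - u))) \<partial>lborel)" .
  qed
  \<comment> \<open>So far z = sqrt 2 * u - w has been substituted at fixed w. Exchanging the order
    permits the substitution w = (u + v) / sqrt 2 at fixed u.\<close>
  also have "\<dots> = (\<integral>\<^sup>+u. \<integral>\<^sup>+w. ennreal (sqrt 2) * (?\<phi> w * (?\<phi> (sqrt 2 * u - w) * F (u, sqrt 2 * w - u))) \<partial>lborel \<partial>lborel)"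
    by (rule lborel_pair.Fubini') measurable
  also have "\<dots> = (\<integral>\<^sup>+u. \<integral>\<^sup>+v. ?\<phi> u * (?\<phi> v * F (u, v)) \<partial>lborel \<partial>lborel)"
  proof (rule nn_integral_cong)
    fix u :: real
    let ?G = "\<lambda>w. ennreal (sqrt 2) * (?\<phi> w * (?\<phi> (sqrt 2 * u - w) * F (u, sqrt 2 * w - u)))"
    have "(\<integral>\<^sup>+w. ?G w \<partial>lborel) = ennreal \<bar>1 / sqrt 2\<bar> * (\<integral>\<^sup>+v. ?G (u / sqrt 2 + 1 / sqrt 2 * v) \<partial>lborel)"
      by (rule nn_integral_real_affine) auto
    also have "\<dots> = (\<integral>\<^sup>+v. ennreal (1 / sqrt 2) * ?G (u / sqrt 2 + 1 / sqrt 2 * v) \<partial>lborel)"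
      by (subst nn_integral_cmult) auto
    also have "\<dots> = (\<integral>\<^sup>+v. ?\<phi> u * (?\<phi> v * F (u, v)) \<partial>lborel)"
    proof (rule nn_integral_cong)
      fix v :: real
      have 1: "u / sqrt 2 + 1 / sqrt 2 * v = (u + v) / sqrt 2" by (simp add: add_divide_distrib)
      have 2: "sqrt 2 * u - (u + v) / sqrt 2 = (u - v) / sqrt 2" by (simp add: field_simps)
      have 3: "sqrt 2 * ((u + v) / sqrt 2) - u = v" by simp
      have c: "ennreal (1 / sqrt 2) * (ennreal (sqrt 2) * x) = x" for x
        by (simp add: mult.assoc[symmetric] ennreal_mult[symmetric])
      have "ennreal (1 / sqrt 2) * (ennreal (sqrt 2) * (?\<phi> ((u + v) / sqrt 2) * (?\<phi> ((u - v) / sqrt 2) * F (u, v))))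
         = ennreal (normal_density 0 s ((u + v) / sqrt 2) * normal_density 0 s ((u - v) / sqrt 2)) * F (u, v)"
        unfolding c by (simp add: ennreal_mult' mult.assoc)
      also have "\<dots> = ?\<phi> u * (?\<phi> v * F (u, v))"
        unfolding normal_density_rotate by (simp add: ennreal_mult' mult.assoc)
      finally show "ennreal (1 / sqrt 2) * ?G (u / sqrt 2 + 1 / sqrt 2 * v) = ?\<phi> u * (?\<phi> v * F (u, v))"
        unfolding 1 2 3 .
    qed
    finally show "(\<integral>\<^sup>+w. ?G w \<partial>lborel) = (\<integral>\<^sup>+v. ?\<phi> u * (?\<phi> v * F (u, v)) \<partial>lborel)" .
  qed
  also have "\<dots> = (\<integral>\<^sup>+u. \<integral>\<^sup>+v. F (u, v) \<partial>density lborel ?\<phi> \<partial>density lborel ?\<phi>)"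
    by (rule exp2[symmetric]) simp
  finally show ?thesis .
qed

text \<open>Induction over the coordinates with \<open>F\<close> arbitrary. The planar case rotates
  the new coordinate while the others are held fixed; the induction hypothesis then applies to the
  function left after integrating the new coordinate out.\<close>

lemma nn_integral_gauss_prod_rotate:
  fixes F :: "('i \<Rightarrow> real) \<times> ('i \<Rightarrow> real) \<Rightarrow> ennreal"
  assumes \<sigma>: "\<And>e. 0 < \<sigma> e" and J: "finite J"
    and F: "F \<in> borel_measurable (PiM J (\<lambda>_. borel) \<Otimes>\<^sub>M PiM J (\<lambda>_. borel))"
  shows "(\<integral>\<^sup>+w. \<integral>\<^sup>+z. F (\<lambda>e\<in>J. (w e + z e) / sqrt 2, \<lambda>e\<in>J. (w e - z e) / sqrt 2) \<partial>gauss_prod \<sigma> J \<partial>gauss_prod \<sigma> J)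
      = (\<integral>\<^sup>+u. \<integral>\<^sup>+v. F (u, v) \<partial>gauss_prod \<sigma> J \<partial>gauss_prod \<sigma> J)"
  using J F
proof (induction J arbitrary: F rule: finite_induct)
  case empty
  interpret product_prob_space "\<lambda>e. density lborel (normal_density 0 (\<sigma> e))" "{}"
    by (rule product_prob_spaceI) (rule prob_space_normal_density[OF \<sigma>])
  have "(\<integral>\<^sup>+x. G x \<partial>gauss_prod \<sigma> {}) = G (\<lambda>_. undefined)" for G
    unfolding gauss_prod_def by (rule nn_integral_empty) simp
  then show ?case by (simp only:) (simp add: restrict_def)
next
  case (insert i I)
  let ?N = "\<lambda>e. density lborel (normal_density 0 (\<sigma> e))"
  let ?\<gamma> = "gauss_prod \<sigma> I"
  interpret P: product_prob_space ?N I
    by (rule product_prob_spaceI) (rule prob_space_normal_density[OF \<sigma>])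
  interpret Ni: prob_space "?N i" by (rule prob_space_normal_density[OF \<sigma>])
  interpret G: prob_space ?\<gamma> by (rule prob_space_gauss_prod[OF \<sigma>])
  interpret GN: pair_sigma_finite "?N i" ?\<gamma> ..
  have sI[measurable_cong]: "sets ?\<gamma> = sets (PiM I (\<lambda>_. borel))" by (rule sets_gauss_prod)
  have sii: "sets (gauss_prod \<sigma> (insert i I)) = sets (PiM (insert i I) (\<lambda>_. borel))"
    by (rule sets_gauss_prod)
  have sN[measurable_cong]: "sets (?N i) = sets borel" by simp
  note [measurable] = insert.prems
  have upd[measurable]: "(\<lambda>p. (f p)(i := h p)) \<in> measurable K (PiM (insert i I) (\<lambda>_. borel))"
    if "f \<in> measurable K (PiM I (\<lambda>_. borel))" "h \<in> borel_measurable K" for f h and K :: "'k measure"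
    by (rule measurable_fun_upd[where J=I]) (use that in auto)
  have split: "(\<integral>\<^sup>+x. G x \<partial>gauss_prod \<sigma> (insert i I)) = (\<integral>\<^sup>+x. \<integral>\<^sup>+y. G (x(i := y)) \<partial>?N i \<partial>?\<gamma>)"
    if "G \<in> borel_measurable (PiM (insert i I) (\<lambda>_. borel))" for G
    unfolding gauss_prod_def
    by (rule P.product_nn_integral_insert[OF insert(1,2)])
       (use that in \<open>simp add: gauss_prod_def[symmetric] measurable_cong_sets[OF sii refl]\<close>)
  have split2: "(\<integral>\<^sup>+w. \<integral>\<^sup>+z. H (w, z) \<partial>gauss_prod \<sigma> (insert i I) \<partial>gauss_prod \<sigma> (insert i I))
      = (\<integral>\<^sup>+w. \<integral>\<^sup>+z. \<integral>\<^sup>+a. \<integral>\<^sup>+b. H (w(i := a), z(i := b)) \<partial>?N i \<partial>?N i \<partial>?\<gamma> \<partial>?\<gamma>)"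
    if [measurable]: "H \<in> borel_measurable (PiM (insert i I) (\<lambda>_. borel) \<Otimes>\<^sub>M PiM (insert i I) (\<lambda>_. borel))" for H
  proof -
    have mw: "(\<lambda>z. H (w, z)) \<in> borel_measurable (PiM (insert i I) (\<lambda>_. borel))" if "w \<in> space (PiM (insert i I) (\<lambda>_. borel))" for w
      using that by measurable
    have "(\<integral>\<^sup>+w. \<integral>\<^sup>+z. H (w, z) \<partial>gauss_prod \<sigma> (insert i I) \<partial>gauss_prod \<sigma> (insert i I))
       = (\<integral>\<^sup>+w. \<integral>\<^sup>+z. \<integral>\<^sup>+b. H (w, z(i := b)) \<partial>?N i \<partial>?\<gamma> \<partial>gauss_prod \<sigma> (insert i I))"
      by (intro nn_integral_cong split mw) (simp add: sets_eq_imp_space_eq[OF sii])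
    also have "\<dots> = (\<integral>\<^sup>+w. \<integral>\<^sup>+a. \<integral>\<^sup>+z. \<integral>\<^sup>+b. H (w(i := a), z(i := b)) \<partial>?N i \<partial>?\<gamma> \<partial>?N i \<partial>?\<gamma>)"
      by (rule split) measurable
    also have "\<dots> = (\<integral>\<^sup>+w. \<integral>\<^sup>+z. \<integral>\<^sup>+a. \<integral>\<^sup>+b. H (w(i := a), z(i := b)) \<partial>?N i \<partial>?N i \<partial>?\<gamma> \<partial>?\<gamma>)"
    proof (rule nn_integral_cong)
      fix w assume "w \<in> space ?\<gamma>"
      then have [measurable]: "w \<in> space (PiM I (\<lambda>_. borel))" by (simp add: sets_eq_imp_space_eq[OF sI])
      show "(\<integral>\<^sup>+a. \<integral>\<^sup>+z. \<integral>\<^sup>+b. H (w(i := a), z(i := b)) \<partial>?N i \<partial>?\<gamma> \<partial>?N i) = (\<integral>\<^sup>+z. \<integral>\<^sup>+a. \<integral>\<^sup>+b. H (w(i := a), z(i := b)) \<partial>?N i \<partial>?N i \<partial>?\<gamma>)"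
        by (rule GN.Fubini'[symmetric]) measurable
    qed
    finally show ?thesis .
  qed
  define R where "R = (\<lambda>p. (\<lambda>e\<in>insert i I. (fst p e + snd p e) / sqrt 2, \<lambda>e\<in>insert i I. (fst p e - snd p e) / sqrt 2 :: real))"
  have Rm[measurable]: "R \<in> measurable (PiM (insert i I) (\<lambda>_. borel) \<Otimes>\<^sub>M PiM (insert i I) (\<lambda>_. borel)) (PiM (insert i I) (\<lambda>_. borel) \<Otimes>\<^sub>M PiM (insert i I) (\<lambda>_. borel))"
    unfolding R_def by measurable
  have Rupd: "R (w(i := a), z(i := b)) = ((\<lambda>e\<in>I. (w e + z e) / sqrt 2)(i := (a + b) / sqrt 2), (\<lambda>e\<in>I. (w e - z e) / sqrt 2)(i := (a - b) / sqrt 2))" for w z a b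
    using insert(2) by (auto simp: R_def fun_eq_iff)
  have "(\<integral>\<^sup>+w. \<integral>\<^sup>+z. F (\<lambda>e\<in>insert i I. (w e + z e) / sqrt 2, \<lambda>e\<in>insert i I. (w e - z e) / sqrt 2) \<partial>gauss_prod \<sigma> (insert i I) \<partial>gauss_prod \<sigma> (insert i I))
      = (\<integral>\<^sup>+w. \<integral>\<^sup>+z. F (R (w, z)) \<partial>gauss_prod \<sigma> (insert i I) \<partial>gauss_prod \<sigma> (insert i I))"
    by (simp add: R_def)
  also have "\<dots> = (\<integral>\<^sup>+w. \<integral>\<^sup>+z. \<integral>\<^sup>+a. \<integral>\<^sup>+b. F (R (w(i := a), z(i := b))) \<partial>?N i \<partial>?N i \<partial>?\<gamma> \<partial>?\<gamma>)"
    by (rule split2) measurable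
  also have "\<dots> = (\<integral>\<^sup>+w. \<integral>\<^sup>+z. \<integral>\<^sup>+a. \<integral>\<^sup>+b. F ((\<lambda>e\<in>I. (w e + z e) / sqrt 2)(i := a), (\<lambda>e\<in>I. (w e - z e) / sqrt 2)(i := b)) \<partial>?N i \<partial>?N i \<partial>?\<gamma> \<partial>?\<gamma>)"
  proof (rule nn_integral_cong, rule nn_integral_cong)
    fix w z assume "w \<in> space ?\<gamma>" "z \<in> space ?\<gamma>"
    let ?u = "\<lambda>e\<in>I. (w e + z e) / sqrt 2" and ?v = "\<lambda>e\<in>I. (w e - z e) / sqrt 2"
    have [measurable]: "?u \<in> space (PiM I (\<lambda>_. borel))" "?v \<in> space (PiM I (\<lambda>_. borel))" by (auto simp: space_PiM)
    have m: "(\<lambda>p. F (?u(i := fst p), ?v(i := snd p))) \<in> borel_measurable (borel \<Otimes>\<^sub>M borel)"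
      by measurable
    show "(\<integral>\<^sup>+a. \<integral>\<^sup>+b. F (R (w(i := a), z(i := b))) \<partial>?N i \<partial>?N i) = (\<integral>\<^sup>+a. \<integral>\<^sup>+b. F (?u(i := a), ?v(i := b)) \<partial>?N i \<partial>?N i)"
      unfolding Rupd using nn_integral_normal_rotate[OF m, of "\<sigma> i"] by simp
  qed
  also have "\<dots> = (\<integral>\<^sup>+u. \<integral>\<^sup>+v. \<integral>\<^sup>+a. \<integral>\<^sup>+b. F (u(i := a), v(i := b)) \<partial>?N i \<partial>?N i \<partial>?\<gamma> \<partial>?\<gamma>)"
  proof -
    have "(\<lambda>p. \<integral>\<^sup>+a. \<integral>\<^sup>+b. F ((fst p)(i := a), (snd p)(i := b)) \<partial>?N i \<partial>?N i) \<in> borel_measurable (PiM I (\<lambda>_. borel) \<Otimes>\<^sub>M PiM I (\<lambda>_. borel))"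
      by measurable
    from insert.IH[OF this] show ?thesis by (simp only: fst_conv snd_conv)
  qed
  also have "\<dots> = (\<integral>\<^sup>+u. \<integral>\<^sup>+v. F (u, v) \<partial>gauss_prod \<sigma> (insert i I) \<partial>gauss_prod \<sigma> (insert i I))"
    by (rule split2[symmetric]) measurable
  finally show ?case .
qed

section \<open>Symmetric Gaussian noise and its linear forms\<close>

definition spread :: "nat \<Rightarrow> (nat \<times> nat \<Rightarrow> real) \<Rightarrow> (nat \<times> nat \<Rightarrow> real) \<Rightarrow> nat \<times> nat \<Rightarrow> real" where
  "spread n x w = (\<lambda>e\<in>entries n. x e + w (sort_pair e))"

lemma spread_measurable:
  "spread n x \<in> measurable (PiM (upper n) (\<lambda>_. borel)) (PiM (entries n) (\<lambda>_. borel))"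
  unfolding spread_def
proof (rule measurable_restrict)
  fix e assume "e \<in> entries n"
  then have "sort_pair e \<in> upper n" using sort_pair_entries by auto
  then show "(\<lambda>w. x e + w (sort_pair e)) \<in> borel_measurable (PiM (upper n) (\<lambda>_. borel))" by measurable
qed

lemma gauss_image_signal_spread:
  "gauss_image entry_sd (upper n) (entries n) sort_pair (signal lam \<theta>)
    = distr (gauss_prod entry_sd (upper n)) (PiM (entries n) (\<lambda>_. borel)) (spread n (signal lam \<theta>))"
  unfolding gauss_image_def spread_def by (simp only: signal_sort_pair)

lemma noise_law_spread:
  "noise_law n = distr (gauss_prod entry_sd (upper n)) (PiM (entries n) (\<lambda>_. borel)) (spread n (\<lambda>_. 0))"
  unfolding noise_law_gauss_image gauss_image_def spread_def ..

text \<open>Chernoff bound in which the exponential of the linear form is a tilt, so its mean is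
  known. Folding the coefficients onto the independent variables shows the variance to be
  \<open>?Q\<close>, at most twice the squared norm of \<open>a\<close>. For N the norm of
  \<open>a\<close>, the choice s = t / (2 N) minimises -s t N + s^2 N^2.\<close>

lemma gaussian_form_tail1:
  assumes t: "0 < t" and N: "0 < frob_norm n a"
  shows "emeasure (gauss_prod entry_sd (upper n)) {v \<in> space (gauss_prod entry_sd (upper n)). t * frob_norm n a \<le> (\<Sum>e\<in>entries n. a e * v (sort_pair e))}
     \<le> ennreal (exp (- (t\<^sup>2 / 4)))"
proof -
  let ?\<gamma> = "gauss_prod entry_sd (upper n)"
  let ?N = "frob_norm n a"
  let ?Z = "\<lambda>v. \<Sum>e\<in>entries n. a e * v (sort_pair e)"
  define b where "b e = (\<Sum>x\<in>{x \<in> entries n. sort_pair x = e}. a x)" for e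
  define s where "s = t / (2 * ?N)"
  let ?Q = "\<Sum>e\<in>upper n. (b e)\<^sup>2 * (entry_sd e)\<^sup>2"
  have Z: "?Z v = (\<Sum>e\<in>upper n. b e * v e)" for v
  proof -
    have "?Z v = (\<Sum>e\<in>upper n. \<Sum>x\<in>{x \<in> entries n. sort_pair x = e}. a x * v (sort_pair x))"
    proof (rule sum.group[symmetric])
      show "sort_pair ` entries n \<subseteq> upper n"
        using sort_pair_entries by (simp only: image_subset_iff_funcset)
    qed (simp_all add: finite_upper)
    also have "\<dots> = (\<Sum>e\<in>upper n. b e * v e)"
      unfolding b_def sum_distrib_right by (intro sum.cong refl) auto
    finally show ?thesis .
  qed
  \<comment> \<open>Cauchy-Schwarz on each fibre of \<open>sort_pair\<close>; its size times the
    variance is 2.\<close>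
  have Q: "?Q \<le> 2 * ?N\<^sup>2"
  proof -
    have "?Q \<le> (\<Sum>e\<in>upper n. 2 * (\<Sum>x\<in>{x \<in> entries n. sort_pair x = e}. a x * a x))"
    proof (intro sum_mono)
      fix e assume e: "e \<in> upper n"
      have "(b e)\<^sup>2 \<le> real (card {x \<in> entries n. sort_pair x = e}) * (\<Sum>x\<in>{x \<in> entries n. sort_pair x = e}. a x * a x)"
        using Cauchy_Schwarz_ineq_sum[of "\<lambda>_. 1" a "{x \<in> entries n. sort_pair x = e}"]
        by (simp add: b_def power2_eq_square)
      then have "(b e)\<^sup>2 * (entry_sd e)\<^sup>2 \<le> 2 / (entry_sd e)\<^sup>2 * (\<Sum>x\<in>{x \<in> entries n. sort_pair x = e}. a x * a x) * (entry_sd e)\<^sup>2"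
        by (intro mult_right_mono) (auto simp: sort_pair_fiber[OF e])
      then show "(b e)\<^sup>2 * (entry_sd e)\<^sup>2 \<le> 2 * (\<Sum>x\<in>{x \<in> entries n. sort_pair x = e}. a x * a x)"
        using entry_sd_pos[of e] by simp
    qed
    also have "\<dots> = 2 * (\<Sum>e\<in>upper n. \<Sum>x\<in>{x \<in> entries n. sort_pair x = e}. a x * a x)"
      by (simp add: sum_distrib_left)
    also have "(\<Sum>e\<in>upper n. \<Sum>x\<in>{x \<in> entries n. sort_pair x = e}. a x * a x) = (\<Sum>x\<in>entries n. a x * a x)"
    proof (rule sum.group)
      show "sort_pair ` entries n \<subseteq> upper n"
        using sort_pair_entries by (simp only: image_subset_iff_funcset)
    qed (simp_all add: finite_upper)
    finally show ?thesis by (simp add: frob_norm_sq frob_inner_def)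
  qed
  let ?x = "\<lambda>e. s * b e * (entry_sd e)\<^sup>2"
  have T: "tilt entry_sd (upper n) ?x v = exp (s * ?Z v - s\<^sup>2 * ?Q / 2)" for v
    unfolding tilt_def Z sum_distrib_left sum_subtractf sum_divide_distrib
    using entry_sd_pos by (intro arg_cong[where f=exp] arg_cong2[where f="(-)"] sum.cong refl)
      (auto simp: power2_eq_square less_imp_neq[OF entry_sd_pos, symmetric])
  have [measurable]: "(\<lambda>v. v (sort_pair e)) \<in> borel_measurable ?\<gamma>" for e
    unfolding measurable_gauss_prod1 by (rule measurable_PiM_apply)
  have "emeasure ?\<gamma> {v \<in> space ?\<gamma>. t * ?N \<le> ?Z v} = (\<integral>\<^sup>+v. indicator {v \<in> space ?\<gamma>. t * ?N \<le> ?Z v} v \<partial>?\<gamma>)"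
    by (intro nn_integral_indicator[symmetric]) measurable
  also have "\<dots> \<le> (\<integral>\<^sup>+v. ennreal (exp (- (t\<^sup>2 / 4))) * ennreal (tilt entry_sd (upper n) ?x v) \<partial>?\<gamma>)"
  proof (rule nn_integral_mono)
    fix v
    have "1 \<le> exp (- (t\<^sup>2 / 4)) * tilt entry_sd (upper n) ?x v" if "t * ?N \<le> ?Z v"
    proof -
      have "s * (t * ?N) \<le> s * ?Z v" using that t N by (intro mult_left_mono) (auto simp: s_def)
      moreover have "s * (t * ?N) = t\<^sup>2 / 2" using N by (simp add: s_def power2_eq_square)
      moreover have "s\<^sup>2 * ?Q / 2 \<le> s\<^sup>2 * (2 * ?N\<^sup>2) / 2" by (intro divide_right_mono mult_left_mono Q) auto
      moreover have "s\<^sup>2 * (2 * ?N\<^sup>2) / 2 = t\<^sup>2 / 4" using N by (simp add: s_def power2_eq_square)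
      ultimately have "0 \<le> - (t\<^sup>2 / 4) + (s * ?Z v - s\<^sup>2 * ?Q / 2)" by linarith
      then show ?thesis unfolding T by (simp add: exp_add[symmetric])
    qed
    then show "indicator {v \<in> space ?\<gamma>. t * ?N \<le> ?Z v} v \<le> ennreal (exp (- (t\<^sup>2 / 4))) * ennreal (tilt entry_sd (upper n) ?x v)"
      by (auto simp: indicator_def ennreal_mult'[symmetric])
  qed
  also have "\<dots> = ennreal (exp (- (t\<^sup>2 / 4)))"
    using nn_integral_tilt[OF entry_sd_pos finite_upper] borel_measurable_tilt
    by (subst nn_integral_cmult) (auto simp: measurable_gauss_prod1)
  finally show ?thesis .
qed

text \<open>Union bound over the two signs. The squared form is the one that a program without
  square roots can compare.\<close>

lemma gaussian_form_tail:
  assumes t: "0 < t" and N: "0 < frob_norm n a"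
  shows "emeasure (gauss_prod entry_sd (upper n)) {v \<in> space (gauss_prod entry_sd (upper n)). t\<^sup>2 * frob_inner n a a \<le> (\<Sum>e\<in>entries n. a e * v (sort_pair e))\<^sup>2}
     \<le> ennreal (2 * exp (- (t\<^sup>2 / 4)))"
proof -
  let ?\<gamma> = "gauss_prod entry_sd (upper n)"
  let ?Z = "\<lambda>a v. \<Sum>e\<in>entries n. a e * v (sort_pair e)"
  let ?A = "\<lambda>a. {v \<in> space ?\<gamma>. t * frob_norm n a \<le> ?Z a v}"
  have [measurable]: "(\<lambda>v. v (sort_pair e)) \<in> borel_measurable ?\<gamma>" for e
    unfolding measurable_gauss_prod1 by (rule measurable_PiM_apply)
  have A: "?A a \<in> sets ?\<gamma>" for a by measurable
  have neg: "frob_norm n (\<lambda>e. - a e) = frob_norm n a" by (simp add: frob_norm_def frob_inner_def)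
  have "{v \<in> space ?\<gamma>. t\<^sup>2 * frob_inner n a a \<le> (?Z a v)\<^sup>2} \<subseteq> ?A a \<union> ?A (\<lambda>e. - a e)"
  proof
    fix v assume v: "v \<in> {v \<in> space ?\<gamma>. t\<^sup>2 * frob_inner n a a \<le> (?Z a v)\<^sup>2}"
    then have "(t * frob_norm n a)\<^sup>2 \<le> (?Z a v)\<^sup>2" by (simp add: power_mult_distrib frob_norm_sq)
    then have "\<bar>t * frob_norm n a\<bar> \<le> \<bar>?Z a v\<bar>" by (simp add: abs_le_square_iff)
    then have "t * frob_norm n a \<le> \<bar>?Z a v\<bar>" by linarith
    then show "v \<in> ?A a \<union> ?A (\<lambda>e. - a e)" using v by (auto simp: neg sum_negf abs_if split: if_splits)
  qed
  then have "emeasure ?\<gamma> {v \<in> space ?\<gamma>. t\<^sup>2 * frob_inner n a a \<le> (?Z a v)\<^sup>2} \<le> emeasure ?\<gamma> (?A a \<union> ?A (\<lambda>e. - a e))"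
    by (rule emeasure_mono[OF _ sets.Un[OF A A]])
  also have "\<dots> \<le> emeasure ?\<gamma> (?A a) + emeasure ?\<gamma> (?A (\<lambda>e. - a e))"
    by (rule emeasure_subadditive[OF A A])
  also have "\<dots> \<le> ennreal (exp (- (t\<^sup>2 / 4))) + ennreal (exp (- (t\<^sup>2 / 4)))"
    using t N by (intro add_mono gaussian_form_tail1) (auto simp: neg)
  also have "\<dots> = ennreal (2 * exp (- (t\<^sup>2 / 4)))"
    by (simp flip: ennreal_plus)
  finally show ?thesis .
qed

section \<open>Splitting a sample into two clones\<close>

definition clone_sum :: "nat \<Rightarrow> (nat \<times> nat \<Rightarrow> real) \<Rightarrow> (nat \<times> nat \<Rightarrow> real) \<Rightarrow> nat \<times> nat \<Rightarrow> real" where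
  "clone_sum n z y = (\<lambda>e\<in>entries n. (y e + z (sort_pair e)) / sqrt 2)"

definition clone_diff :: "nat \<Rightarrow> (nat \<times> nat \<Rightarrow> real) \<Rightarrow> (nat \<times> nat \<Rightarrow> real) \<Rightarrow> nat \<times> nat \<Rightarrow> real" where
  "clone_diff n z y = (\<lambda>e\<in>entries n. (y e - z (sort_pair e)) / sqrt 2)"

lemma clone_measurable:
  "(\<lambda>p. (clone_sum n (fst p) (snd p), clone_diff n (fst p) (snd p)))
    \<in> measurable (PiM (upper n) (\<lambda>_. borel) \<Otimes>\<^sub>M PiM (entries n) (\<lambda>_. borel)) (PiM (entries n) (\<lambda>_. borel) \<Otimes>\<^sub>M PiM (entries n) (\<lambda>_. borel))"
proof -
  have [measurable]: "(\<lambda>p. fst p (sort_pair e)) \<in> borel_measurable (PiM (upper n) (\<lambda>_. borel :: real measure) \<Otimes>\<^sub>M PiM (entries n) (\<lambda>_. borel :: real measure))" for e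
    by (rule measurable_compose[OF measurable_fst measurable_PiM_apply])
  show ?thesis unfolding clone_sum_def clone_diff_def by measurable
qed

text \<open>For y = x + w the clones are x / sqrt 2 plus (w + z) / sqrt 2 and x / sqrt 2 plus (w -
  z) / sqrt 2, and by rotation invariance these noises are independent copies of w. The integral
  over z stays outside because a good value of z is selected later.\<close>

lemma nn_integral_clone:
  assumes G: "G \<in> borel_measurable (PiM (entries n) (\<lambda>_. borel) \<Otimes>\<^sub>M PiM (entries n) (\<lambda>_. borel))"
  shows "(\<integral>\<^sup>+z. \<integral>\<^sup>+y. G (clone_sum n z y, clone_diff n z y) \<partial>distr (gauss_prod entry_sd (upper n)) (PiM (entries n) (\<lambda>_. borel)) (spread n x) \<partial>gauss_prod entry_sd (upper n))
    = (\<integral>\<^sup>+u. \<integral>\<^sup>+v. G (spread n (\<lambda>e. x e / sqrt 2) u, spread n (\<lambda>e. x e / sqrt 2) v) \<partial>gauss_prod entry_sd (upper n) \<partial>gauss_prod entry_sd (upper n))"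
proof -
  let ?\<gamma> = "gauss_prod entry_sd (upper n)"
  let ?x = "\<lambda>e. x e / sqrt 2"
  note s\<gamma> = sets_gauss_prod
  interpret g: prob_space ?\<gamma> by (rule prob_space_gauss_prod[OF entry_sd_pos])
  interpret gg: pair_prob_space ?\<gamma> ?\<gamma> ..
  have sm: "spread n x \<in> measurable ?\<gamma> (PiM (entries n) (\<lambda>_. borel))" for x
    using spread_measurable by (simp add: measurable_gauss_prod1)
  define H where "H p = G (clone_sum n (fst p) (snd p), clone_diff n (fst p) (snd p))" for p
  have Hm: "H \<in> borel_measurable (PiM (upper n) (\<lambda>_. borel) \<Otimes>\<^sub>M PiM (entries n) (\<lambda>_. borel))"
    unfolding H_def by (rule measurable_compose[OF clone_measurable G])
  have Hz: "(\<lambda>y. H (z, y)) \<in> borel_measurable (PiM (entries n) (\<lambda>_. borel))" if "z \<in> space ?\<gamma>" for z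
    using measurable_compose[OF measurable_Pair1'[of z] Hm] that by (simp add: space_gauss_prod)
  have Hs: "(\<lambda>(w, z). H (z, spread n x w)) \<in> borel_measurable (?\<gamma> \<Otimes>\<^sub>M ?\<gamma>)"
  proof -
    have "(\<lambda>p. (snd p, spread n x (fst p))) \<in> measurable (?\<gamma> \<Otimes>\<^sub>M ?\<gamma>) (PiM (upper n) (\<lambda>_. borel) \<Otimes>\<^sub>M PiM (entries n) (\<lambda>_. borel))"
      by (intro measurable_Pair measurable_compose[OF measurable_fst sm])
         (rule measurable_snd[THEN measurable_compose], simp add: measurable_gauss_prod1)
    from measurable_compose[OF this Hm] show ?thesis by (simp add: case_prod_unfold)
  qed
  have rot: "(clone_sum n z (spread n x w), clone_diff n z (spread n x w))
     = (spread n ?x (\<lambda>e\<in>upper n. (w e + z e) / sqrt 2), spread n ?x (\<lambda>e\<in>upper n. (w e - z e) / sqrt 2))" for w z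
    using sort_pair_entries[of n]
    by (auto simp: clone_sum_def clone_diff_def spread_def fun_eq_iff add_divide_distrib diff_divide_distrib Pi_iff)
  have "(\<lambda>p. (spread n ?x (fst p), spread n ?x (snd p))) \<in> measurable (PiM (upper n) (\<lambda>_. borel) \<Otimes>\<^sub>M PiM (upper n) (\<lambda>_. borel)) (PiM (entries n) (\<lambda>_. borel) \<Otimes>\<^sub>M PiM (entries n) (\<lambda>_. borel))"
    by (intro measurable_Pair measurable_compose[OF measurable_fst spread_measurable] measurable_compose[OF measurable_snd spread_measurable])
  from measurable_compose[OF this G]
  have Fm: "(\<lambda>p. G (spread n ?x (fst p), spread n ?x (snd p))) \<in> borel_measurable (PiM (upper n) (\<lambda>_. borel) \<Otimes>\<^sub>M PiM (upper n) (\<lambda>_. borel))" .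
  have "(\<integral>\<^sup>+z. \<integral>\<^sup>+y. G (clone_sum n z y, clone_diff n z y) \<partial>distr ?\<gamma> (PiM (entries n) (\<lambda>_. borel)) (spread n x) \<partial>?\<gamma>)
    = (\<integral>\<^sup>+z. \<integral>\<^sup>+w. H (z, spread n x w) \<partial>?\<gamma> \<partial>?\<gamma>)"
  proof (rule nn_integral_cong)
    fix z assume "z \<in> space ?\<gamma>"
    then have "(\<lambda>y. H (z, y)) \<in> borel_measurable (distr ?\<gamma> (PiM (entries n) (\<lambda>_. borel)) (spread n x))"
      using Hz by simp
    from nn_integral_distr[OF sm this]
    show "(\<integral>\<^sup>+y. G (clone_sum n z y, clone_diff n z y) \<partial>distr ?\<gamma> (PiM (entries n) (\<lambda>_. borel)) (spread n x)) = (\<integral>\<^sup>+w. H (z, spread n x w) \<partial>?\<gamma>)"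
      by (simp add: H_def)
  qed
  also have "\<dots> = (\<integral>\<^sup>+w. \<integral>\<^sup>+z. H (z, spread n x w) \<partial>?\<gamma> \<partial>?\<gamma>)"
    by (rule gg.Fubini'[OF Hs])
  also have "\<dots> = (\<integral>\<^sup>+w. \<integral>\<^sup>+z. G (spread n ?x (\<lambda>e\<in>upper n. (w e + z e) / sqrt 2), spread n ?x (\<lambda>e\<in>upper n. (w e - z e) / sqrt 2)) \<partial>?\<gamma> \<partial>?\<gamma>)"
    by (simp only: H_def fst_conv snd_conv rot)
  also have "\<dots> = (\<integral>\<^sup>+u. \<integral>\<^sup>+v. G (spread n ?x u, spread n ?x v) \<partial>?\<gamma> \<partial>?\<gamma>)"
    using nn_integral_gauss_prod_rotate[OF entry_sd_pos finite_upper Fm] by (simp only: fst_conv snd_conv)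
  finally show ?thesis .
qed

text \<open>A threshold for the inner product of the normalised estimate with the second clone,
  squared and cleared of the denominator so that it can be evaluated without roots. The inequality
  is strict, so an estimate equal to 0 never raises an alarm.\<close>

definition clone_test :: "nat \<Rightarrow> real \<Rightarrow> ((nat \<times> nat \<Rightarrow> real) \<Rightarrow> nat \<times> nat \<Rightarrow> real) \<Rightarrow> (nat \<times> nat \<Rightarrow> real) \<times> (nat \<times> nat \<Rightarrow> real) \<Rightarrow> bool" where
  "clone_test n \<tau> X p \<longleftrightarrow> \<tau>\<^sup>2 * frob_inner n (X (fst p)) (X (fst p)) < (frob_inner n (X (fst p)) (snd p))\<^sup>2"

context
  fixes n :: nat and X :: "(nat \<times> nat \<Rightarrow> real) \<Rightarrow> nat \<times> nat \<Rightarrow> real"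
  assumes X: "\<And>e. (\<lambda>y. X y e) \<in> borel_measurable (PiM (entries n) (\<lambda>_. borel))"
begin

lemma clone_test_measurable:
  "Measurable.pred (PiM (entries n) (\<lambda>_. borel) \<Otimes>\<^sub>M PiM (entries n) (\<lambda>_. borel)) (clone_test n \<tau> X)"
proof -
  have [measurable]: "(\<lambda>p. X (fst p) e) \<in> borel_measurable (PiM (entries n) (\<lambda>_. borel) \<Otimes>\<^sub>M PiM (entries n) (\<lambda>_. borel :: real measure))" for e
    by (rule measurable_compose[OF measurable_fst X])
  have [measurable]: "(\<lambda>p. snd p e) \<in> borel_measurable (PiM (entries n) (\<lambda>_. borel) \<Otimes>\<^sub>M PiM (entries n) (\<lambda>_. borel :: real measure))" for e
    by (rule measurable_compose[OF measurable_snd measurable_PiM_apply])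
  show ?thesis unfolding clone_test_def frob_inner_def by measurable
qed

lemma clone_test_section:
  "Measurable.pred (PiM (entries n) (\<lambda>_. borel)) (\<lambda>y. clone_test n \<tau> X (clone_sum n z y, clone_diff n z y))"
proof -
  have "(\<lambda>y. (clone_sum n z y, clone_diff n z y)) \<in> measurable (PiM (entries n) (\<lambda>_. borel)) (PiM (entries n) (\<lambda>_. borel) \<Otimes>\<^sub>M PiM (entries n) (\<lambda>_. borel))"
    unfolding clone_sum_def clone_diff_def by measurable
  from measurable_compose[OF this clone_test_measurable] show ?thesis .
qed

text \<open>Given the first clone, the estimate is a fixed matrix and the second clone is
  independent pure noise. The alarm is then a two-sided tail event of a Gaussian linear
  form.\<close>

lemma null_false_alarm:
  assumes \<tau>: "0 < \<tau>"
  shows "(\<integral>\<^sup>+z. emeasure (noise_law n) {y \<in> space (noise_law n). clone_test n \<tau> X (clone_sum n z y, clone_diff n z y)} \<partial>gauss_prod entry_sd (upper n))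
     \<le> ennreal (2 * exp (- (\<tau>\<^sup>2 / 4)))"
proof -
  let ?\<gamma> = "gauss_prod entry_sd (upper n)"
  let ?G = "\<lambda>p. indicator {p. clone_test n \<tau> X p} p :: ennreal"
  interpret g: prob_space ?\<gamma> by (rule prob_space_gauss_prod[OF entry_sd_pos])
  have Gm: "?G \<in> borel_measurable (PiM (entries n) (\<lambda>_. borel) \<Otimes>\<^sub>M PiM (entries n) (\<lambda>_. borel))"
    using clone_test_measurable by measurable
  have "(\<integral>\<^sup>+z. emeasure (noise_law n) {y \<in> space (noise_law n). clone_test n \<tau> X (clone_sum n z y, clone_diff n z y)} \<partial>?\<gamma>)
     = (\<integral>\<^sup>+z. \<integral>\<^sup>+y. ?G (clone_sum n z y, clone_diff n z y) \<partial>noise_law n \<partial>?\<gamma>)"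
  proof (rule nn_integral_cong)
    fix z
    have "{y \<in> space (noise_law n). clone_test n \<tau> X (clone_sum n z y, clone_diff n z y)} \<in> sets (noise_law n)"
      using clone_test_section by (simp add: pred_def sets_eq_imp_space_eq[OF sets_noise_law])
    from nn_integral_indicator[OF this, symmetric]
    show "emeasure (noise_law n) {y \<in> space (noise_law n). clone_test n \<tau> X (clone_sum n z y, clone_diff n z y)} = (\<integral>\<^sup>+y. ?G (clone_sum n z y, clone_diff n z y) \<partial>noise_law n)"
      by (rule trans) (auto intro!: nn_integral_cong simp: indicator_def)
  qed
  also have "\<dots> = (\<integral>\<^sup>+u. \<integral>\<^sup>+v. ?G (spread n (\<lambda>_. 0) u, spread n (\<lambda>_. 0) v) \<partial>?\<gamma> \<partial>?\<gamma>)"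
    unfolding noise_law_spread nn_integral_clone[OF Gm] by simp
  also have "\<dots> \<le> (\<integral>\<^sup>+u. ennreal (2 * exp (- (\<tau>\<^sup>2 / 4))) \<partial>?\<gamma>)"
  proof (rule nn_integral_mono)
    fix u
    let ?a = "X (spread n (\<lambda>_. 0) u)"
    let ?B = "{v \<in> space ?\<gamma>. \<tau>\<^sup>2 * frob_inner n ?a ?a \<le> (\<Sum>e\<in>entries n. ?a e * v (sort_pair e))\<^sup>2}"
    have fi: "frob_inner n ?a (spread n (\<lambda>_. 0) v) = (\<Sum>e\<in>entries n. ?a e * v (sort_pair e))" for v
      unfolding frob_inner_def spread_def by (intro sum.cong refl) auto
    show "(\<integral>\<^sup>+v. ?G (spread n (\<lambda>_. 0) u, spread n (\<lambda>_. 0) v) \<partial>?\<gamma>) \<le> ennreal (2 * exp (- (\<tau>\<^sup>2 / 4)))"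
    proof (cases "0 < frob_norm n ?a")
      case True
      have "?B \<in> sets ?\<gamma>"
      proof -
        have [measurable]: "(\<lambda>v. v (sort_pair e)) \<in> borel_measurable ?\<gamma>" for e
          unfolding measurable_gauss_prod1 by (rule measurable_PiM_apply)
        show ?thesis by measurable
      qed
      then have "emeasure ?\<gamma> ?B = (\<integral>\<^sup>+v. indicator ?B v \<partial>?\<gamma>)" by simp
      moreover have "(\<integral>\<^sup>+v. ?G (spread n (\<lambda>_. 0) u, spread n (\<lambda>_. 0) v) \<partial>?\<gamma>) \<le> (\<integral>\<^sup>+v. indicator ?B v \<partial>?\<gamma>)"
        by (rule nn_integral_mono) (auto simp: indicator_def clone_test_def fi)
      ultimately show ?thesis using gaussian_form_tail[OF \<tau> True] by simp
    next
      case False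
      then have "frob_norm n ?a = 0" using frob_norm_nonneg[of n ?a] by simp
      then have "frob_inner n ?a b = 0" for b using abs_frob_inner_le[of n ?a b] by simp
      then have "?G (spread n (\<lambda>_. 0) u, spread n (\<lambda>_. 0) v) = 0" for v
        by (simp add: clone_test_def)
      then show ?thesis by simp
    qed
  qed
  also have "\<dots> = ennreal (2 * exp (- (\<tau>\<^sup>2 / 4)))"
    by (simp add: g.emeasure_space_1)
  finally show ?thesis .
qed

end

lemma measurable_emeasure_clone:
  assumes R: "prob_space R" "sets R = sets (PiM (entries n) (\<lambda>_. borel))"
    and Q: "Measurable.pred (PiM (entries n) (\<lambda>_. borel) \<Otimes>\<^sub>M PiM (entries n) (\<lambda>_. borel)) Q"
  shows "(\<lambda>z. emeasure R {y \<in> space R. Q (clone_sum n z y, clone_diff n z y)}) \<in> borel_measurable (gauss_prod entry_sd (upper n))"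
proof -
  let ?\<gamma> = "gauss_prod entry_sd (upper n)"
  interpret R: prob_space R by (rule R)
  let ?S = "{q \<in> space (PiM (upper n) (\<lambda>_. borel) \<Otimes>\<^sub>M PiM (entries n) (\<lambda>_. borel)). Q (clone_sum n (fst q) (snd q), clone_diff n (fst q) (snd q))}"
  have "?S \<in> sets (PiM (upper n) (\<lambda>_. borel) \<Otimes>\<^sub>M PiM (entries n) (\<lambda>_. borel))"
    using measurable_compose[OF clone_measurable Q] by measurable
  also have "sets (PiM (upper n) (\<lambda>_. borel) \<Otimes>\<^sub>M PiM (entries n) (\<lambda>_. borel)) = sets (?\<gamma> \<Otimes>\<^sub>M R)"
    by (rule sets_pair_measure_cong) (simp_all add: sets_gauss_prod R)
  finally have "(\<lambda>z. emeasure R (Pair z -` ?S)) \<in> borel_measurable ?\<gamma>"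
    by (rule R.measurable_emeasure_Pair)
  moreover have "Pair z -` ?S = {y \<in> space R. Q (clone_sum n z y, clone_diff n z y)}" if "z \<in> space ?\<gamma>" for z
    using that by (auto simp: space_pair_measure space_gauss_prod sets_eq_imp_space_eq[OF R(2)])
  ultimately show ?thesis
    by (subst measurable_cong[where g="\<lambda>z. emeasure R (Pair z -` ?S)"]) auto
qed

text \<open>A miss has three possible causes: the estimate from the first clone has correlation
  below c / 2, or \<theta> has fewer than half of its expected ones, or the noise of the second
  clone cancels half of the signal. Without the first two, the signal part of the inner product is
  at least (c / 2) (\<lambda>\<rho>n / 2) = 2 \<tau> times the norm of the estimate; this explains
  the 8 in \<tau>.\<close>

lemma planted_miss:
  fixes X :: "(nat \<times> nat \<Rightarrow> real) \<Rightarrow> nat \<times> nat \<Rightarrow> real"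
  assumes X: "\<And>e. (\<lambda>y. X y e) \<in> borel_measurable (PiM (entries n) (\<lambda>_. borel))"
    and lam: "0 < lam" and \<rho>: "0 < \<rho>" "\<rho> < 1" and n: "0 < n"
    and c: "0 < c" "c \<le> det_score n lam \<rho> X" and \<tau>: "\<tau> = c * lam * (\<rho> * real n) / 8"
  shows "(\<integral>\<^sup>+z. emeasure (planted_law n (sqrt 2 * lam) \<rho>)
        {y \<in> space (planted_law n (sqrt 2 * lam) \<rho>). \<not> clone_test n \<tau> X (clone_sum n z y, clone_diff n z y)} \<partial>gauss_prod entry_sd (upper n))
     \<le> ennreal (1 - c / 2 + exp (- (\<rho> * real n / 10)) + 2 * exp (- (\<tau>\<^sup>2 / 4)))"
proof -
  let ?\<gamma> = "gauss_prod entry_sd (upper n)"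
  let ?\<pi> = "theta_pmf n \<rho>"
  let ?G = "\<lambda>p. indicator {p. \<not> clone_test n \<tau> X p} p :: ennreal"
  let ?D = "\<lambda>lam \<theta>. gauss_image entry_sd (upper n) (entries n) sort_pair (signal lam \<theta>)"
  let ?A = "\<lambda>z. {y \<in> space (PiM (entries n) (\<lambda>_. borel)). \<not> clone_test n \<tau> X (clone_sum n z y, clone_diff n z y)}"
  have \<tau>0: "0 < \<tau>" using lam \<rho> n c by (simp add: \<tau>)
  interpret g: prob_space ?\<gamma> by (rule prob_space_gauss_prod[OF entry_sd_pos])
  have pD: "prob_space (?D l \<theta>)" for l \<theta>
    by (rule prob_space_gauss_image[OF entry_sd_pos finite_upper _ sort_pair_entries]) simp
  have sp: "space (planted_law n l \<rho>) = space (PiM (entries n) (\<lambda>_. borel))" for l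
    by (simp add: planted_law_def)
  have Am: "?A z \<in> sets (PiM (entries n) (\<lambda>_. borel))" for z
    using clone_test_section[OF X, where \<tau>=\<tau> and z=z] by measurable
  have Gm: "?G \<in> borel_measurable (PiM (entries n) (\<lambda>_. borel) \<Otimes>\<^sub>M PiM (entries n) (\<lambda>_. borel))"
    using clone_test_measurable[OF X] by measurable
  define p where "p \<theta> = measure (?D lam \<theta>) {y \<in> space (?D lam \<theta>). corr n (X y) (signal lam \<theta>) < c / 2}" for \<theta>
  have cm: "(\<lambda>y. corr n (X y) (signal lam \<theta>)) \<in> borel_measurable (PiM (entries n) (\<lambda>_. borel))" for \<theta>
    by (intro corr_measurable X) simp
  have Dsp: "space (?D l \<theta>) = space (PiM (entries n) (\<lambda>_. borel))" for l \<theta>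
    by (simp add: gauss_image_def)
  have "{y \<in> space (PiM (entries n) (\<lambda>_. borel)). corr n (X y) (signal lam \<theta>) < c / 2} \<in> sets (PiM (entries n) (\<lambda>_. borel))" for \<theta>
    using cm[of \<theta>] by measurable
  then have pm: "{y \<in> space (?D lam \<theta>). corr n (X y) (signal lam \<theta>) < c / 2} \<in> sets (?D lam \<theta>)" for \<theta>
    by (simp only: Dsp sets_gauss_image)
  \<comment> \<open>Reverse Markov inequality: the correlation is at most 1, and below c / 2 on the
    bad event, so a mean of at least c limits the bad event to probability 1 - c / 2.\<close>
  have psum: "measure_pmf.expectation ?\<pi> p \<le> 1 - c / 2"
  proof -
    have "(\<integral>y. corr n (X y) (signal lam \<theta>) \<partial>?D lam \<theta>) \<le> 1 - p \<theta> + c / 2" for \<theta>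
    proof -
      interpret D: prob_space "?D lam \<theta>" by (rule pD)
      let ?B = "{y \<in> space (?D lam \<theta>). corr n (X y) (signal lam \<theta>) < c / 2}"
      have cm': "(\<lambda>y. corr n (X y) (signal lam \<theta>)) \<in> borel_measurable (?D lam \<theta>)"
        using cm by (simp add: gauss_image_def)
      have "(\<integral>y. corr n (X y) (signal lam \<theta>) \<partial>?D lam \<theta>) \<le> (\<integral>y. (1 + c / 2) - indicator ?B y \<partial>?D lam \<theta>)"
      proof (rule integral_mono)
        show "integrable (?D lam \<theta>) (\<lambda>y. corr n (X y) (signal lam \<theta>))"
          using cm' by (intro D.integrable_const_bound[where B=1]) (auto simp: abs_corr_le)
        show "integrable (?D lam \<theta>) (\<lambda>y. (1 + c / 2) - indicator ?B y)"
          using pm by (intro Bochner_Integration.integrable_diff integrable_real_indicator) (auto simp: D.emeasure_eq_measure)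
        fix y assume "y \<in> space (?D lam \<theta>)"
        then show "corr n (X y) (signal lam \<theta>) \<le> (1 + c / 2) - indicator ?B y"
          using abs_corr_le[of n "X y" "signal lam \<theta>"] c by (auto simp: indicator_def)
      qed
      also have "\<dots> = (1 + c / 2) - p \<theta>"
        using pm by (subst Bochner_Integration.integral_diff) (auto simp: p_def D.emeasure_eq_measure D.prob_space)
      finally show ?thesis by simp
    qed
    then have "det_score n lam \<rho> X \<le> measure_pmf.expectation ?\<pi> (\<lambda>\<theta>. 1 - p \<theta> + c / 2)"
      unfolding det_score_def by (intro integral_mono integrable_measure_pmf_finite finite_set_theta_pmf)
    also have "\<dots> = 1 - measure_pmf.expectation ?\<pi> p + c / 2"
      by (simp add: integrable_measure_pmf_finite finite_set_theta_pmf)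
    finally show ?thesis using c by simp
  qed
  have each: "(\<integral>\<^sup>+z. emeasure (?D (sqrt 2 * lam) \<theta>) (?A z) \<partial>?\<gamma>)
      \<le> ennreal (p \<theta> + of_bool (overlap n \<theta> \<theta> < \<rho> * real n / 2) + 2 * exp (- (\<tau>\<^sup>2 / 4)))" for \<theta>
  proof -
    let ?s = "signal lam \<theta>"
    \<comment> \<open>Cloning divides out exactly the factor sqrt 2 by which the planted signal was
      enlarged.\<close>
    have half: "(\<lambda>e. signal (sqrt 2 * lam) \<theta> e / sqrt 2) = ?s"
      by (auto simp: signal_def fun_eq_iff)
    have "(\<integral>\<^sup>+z. emeasure (?D (sqrt 2 * lam) \<theta>) (?A z) \<partial>?\<gamma>) = (\<integral>\<^sup>+z. \<integral>\<^sup>+y. ?G (clone_sum n z y, clone_diff n z y) \<partial>?D (sqrt 2 * lam) \<theta> \<partial>?\<gamma>)"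
    proof (rule nn_integral_cong)
      fix z
      have "?A z \<in> sets (?D (sqrt 2 * lam) \<theta>)" using Am by simp
      from nn_integral_indicator[OF this, symmetric]
      show "emeasure (?D (sqrt 2 * lam) \<theta>) (?A z) = (\<integral>\<^sup>+y. ?G (clone_sum n z y, clone_diff n z y) \<partial>?D (sqrt 2 * lam) \<theta>)"
        by (rule trans) (auto intro!: nn_integral_cong simp: indicator_def Dsp)
    qed
    also have "\<dots> = (\<integral>\<^sup>+u. \<integral>\<^sup>+v. ?G (spread n ?s u, spread n ?s v) \<partial>?\<gamma> \<partial>?\<gamma>)"
      unfolding gauss_image_signal_spread nn_integral_clone[OF Gm] half ..
    also have "\<dots> \<le> (\<integral>\<^sup>+u. indicator {y. corr n (X y) ?s < c / 2} (spread n ?s u) + ennreal (of_bool (overlap n \<theta> \<theta> < \<rho> * real n / 2) + 2 * exp (- (\<tau>\<^sup>2 / 4))) \<partial>?\<gamma>)"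
    proof (rule nn_integral_mono)
      fix u
      let ?a = "X (spread n ?s u)"
      have le1: "(\<integral>\<^sup>+v. ?G (spread n ?s u, spread n ?s v) \<partial>?\<gamma>) \<le> 1"
      proof -
        have "(\<integral>\<^sup>+v. ?G (spread n ?s u, spread n ?s v) \<partial>?\<gamma>) \<le> (\<integral>\<^sup>+v. 1 \<partial>?\<gamma>)"
          by (rule nn_integral_mono) (auto simp: indicator_def)
        then show ?thesis by (simp add: g.emeasure_space_1)
      qed
      consider "corr n ?a ?s < c / 2" | "overlap n \<theta> \<theta> < \<rho> * real n / 2" | "c / 2 \<le> corr n ?a ?s" "\<rho> * real n / 2 \<le> overlap n \<theta> \<theta>"
        by linarith
      then show "(\<integral>\<^sup>+v. ?G (spread n ?s u, spread n ?s v) \<partial>?\<gamma>)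
          \<le> indicator {y. corr n (X y) ?s < c / 2} (spread n ?s u) + ennreal (of_bool (overlap n \<theta> \<theta> < \<rho> * real n / 2) + 2 * exp (- (\<tau>\<^sup>2 / 4)))"
      proof cases
        case 1
        then show ?thesis by (intro order.trans[OF le1]) (simp add: indicator_def)
      next
        case 2
        have "1 \<le> ennreal (of_bool (overlap n \<theta> \<theta> < \<rho> * real n / 2) + 2 * exp (- (\<tau>\<^sup>2 / 4)))"
          using 2 by simp
        then show ?thesis by (intro order.trans[OF le1] order.trans[OF _ add_increasing]) auto
      next
        case 3
        have Ns: "lam * (\<rho> * real n / 2) \<le> frob_norm n ?s"
          using 3 lam by (simp add: frob_norm_signal)
        have N0: "0 < frob_norm n ?a"
        proof (rule ccontr)
          assume "\<not> ?thesis"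
          then have "frob_norm n ?a = 0" using frob_norm_nonneg[of n ?a] by simp
          then show False using 3 c by (simp add: corr_def)
        qed
        have s0: "0 < frob_norm n ?s" using lam \<rho> n by (intro less_le_trans[OF _ Ns] mult_pos_pos) auto
        have big: "2 * \<tau> * frob_norm n ?a \<le> frob_inner n ?a ?s"
        proof -
          have "c / 2 * (frob_norm n ?a * frob_norm n ?s) \<le> frob_inner n ?a ?s"
            using 3(1) N0 s0 by (simp add: corr_def pos_le_divide_eq)
          moreover have "c / 2 * (frob_norm n ?a * (lam * (\<rho> * real n / 2))) \<le> c / 2 * (frob_norm n ?a * frob_norm n ?s)"
            using Ns N0 c by (intro mult_left_mono) auto
          ultimately show ?thesis by (simp add: \<tau> mult_ac)
        qed
        let ?B = "{v \<in> space ?\<gamma>. \<tau>\<^sup>2 * frob_inner n ?a ?a \<le> (\<Sum>e\<in>entries n. ?a e * v (sort_pair e))\<^sup>2}"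
        have fi: "frob_inner n ?a (spread n ?s v) = frob_inner n ?a ?s + (\<Sum>e\<in>entries n. ?a e * v (sort_pair e))" for v
          unfolding frob_inner_def spread_def sum.distrib[symmetric] by (intro sum.cong refl) (auto simp: distrib_left)
        have "?B \<in> sets ?\<gamma>"
        proof -
          have [measurable]: "(\<lambda>v. v (sort_pair e)) \<in> borel_measurable ?\<gamma>" for e
            unfolding measurable_gauss_prod1 by (rule measurable_PiM_apply)
          show ?thesis by measurable
        qed
        then have "emeasure ?\<gamma> ?B = (\<integral>\<^sup>+v. indicator ?B v \<partial>?\<gamma>)" by simp
        moreover have "(\<integral>\<^sup>+v. ?G (spread n ?s u, spread n ?s v) \<partial>?\<gamma>) \<le> (\<integral>\<^sup>+v. indicator ?B v \<partial>?\<gamma>)"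
        proof (rule nn_integral_mono)
          fix v assume v: "v \<in> space ?\<gamma>"
          let ?Z = "\<Sum>e\<in>entries n. ?a e * v (sort_pair e)"
          have "\<tau>\<^sup>2 * frob_inner n ?a ?a \<le> ?Z\<^sup>2" if "(frob_inner n ?a ?s + ?Z)\<^sup>2 \<le> \<tau>\<^sup>2 * frob_inner n ?a ?a"
          proof -
            have sq: "\<tau>\<^sup>2 * frob_inner n ?a ?a = (\<tau> * frob_norm n ?a)\<^sup>2" by (simp add: power_mult_distrib frob_norm_sq)
            have "\<bar>frob_inner n ?a ?s + ?Z\<bar> \<le> \<bar>\<tau> * frob_norm n ?a\<bar>"
              using that unfolding sq by (simp add: abs_le_square_iff)
            \<comment> \<open>The signal part is at least twice the threshold while the sum stays
              within it, so the noise part alone must reach the threshold.\<close>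
            then have "\<bar>\<tau> * frob_norm n ?a\<bar> \<le> \<bar>?Z\<bar>" using big \<tau>0 N0 by auto
            then show ?thesis unfolding sq by (simp add: abs_le_square_iff)
          qed
          then show "?G (spread n ?s u, spread n ?s v) \<le> indicator ?B v"
            using v by (auto simp: indicator_def clone_test_def fi not_less)
        qed
        ultimately have "(\<integral>\<^sup>+v. ?G (spread n ?s u, spread n ?s v) \<partial>?\<gamma>) \<le> ennreal (2 * exp (- (\<tau>\<^sup>2 / 4)))"
          using gaussian_form_tail[OF \<tau>0 N0] by simp
        also have "\<dots> \<le> ennreal (of_bool (overlap n \<theta> \<theta> < \<rho> * real n / 2) + 2 * exp (- (\<tau>\<^sup>2 / 4)))"
          by (intro ennreal_leI) simp
        also have "\<dots> \<le> indicator {y. corr n (X y) ?s < c / 2} (spread n ?s u) + \<dots>"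
          by (rule add_increasing) auto
        finally show ?thesis .
      qed
    qed
    also have "\<dots> = (\<integral>\<^sup>+u. indicator {y. corr n (X y) ?s < c / 2} (spread n ?s u) \<partial>?\<gamma>) + ennreal (of_bool (overlap n \<theta> \<theta> < \<rho> * real n / 2) + 2 * exp (- (\<tau>\<^sup>2 / 4)))"
    proof (subst nn_integral_add)
      have "(\<lambda>y. indicator {y. corr n (X y) ?s < c / 2} y :: ennreal) \<in> borel_measurable (PiM (entries n) (\<lambda>_. borel))"
        using cm[of \<theta>] by measurable
      from measurable_compose[OF spread_measurable this]
      show "(\<lambda>u. indicator {y. corr n (X y) ?s < c / 2} (spread n ?s u) :: ennreal) \<in> borel_measurable ?\<gamma>"
        unfolding measurable_gauss_prod1 .
    qed (auto simp: g.emeasure_space_1)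
    also have "(\<integral>\<^sup>+u. indicator {y. corr n (X y) ?s < c / 2} (spread n ?s u) \<partial>?\<gamma>) = ennreal (p \<theta>)"
    proof -
      interpret D: prob_space "?D lam \<theta>" by (rule pD)
      have sm: "spread n ?s \<in> measurable ?\<gamma> (PiM (entries n) (\<lambda>_. borel))"
        using spread_measurable by (simp add: measurable_gauss_prod1)
      have im: "(\<lambda>y. indicator {y. corr n (X y) ?s < c / 2} y :: ennreal) \<in> borel_measurable (PiM (entries n) (\<lambda>_. borel))"
        using cm[of \<theta>] by measurable
      have "ennreal (p \<theta>) = emeasure (?D lam \<theta>) {y \<in> space (?D lam \<theta>). corr n (X y) ?s < c / 2}"
        by (simp add: p_def D.emeasure_eq_measure)
      also have "\<dots> = (\<integral>\<^sup>+y. indicator {y \<in> space (?D lam \<theta>). corr n (X y) ?s < c / 2} y \<partial>?D lam \<theta>)"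
        using pm by simp
      also have "\<dots> = (\<integral>\<^sup>+y. indicator {y. corr n (X y) ?s < c / 2} y \<partial>?D lam \<theta>)"
        by (rule nn_integral_cong) (auto simp: indicator_def)
      also have "\<dots> = (\<integral>\<^sup>+u. indicator {y. corr n (X y) ?s < c / 2} (spread n ?s u) \<partial>?\<gamma>)"
        unfolding gauss_image_signal_spread using im by (subst nn_integral_distr[OF sm]) auto
      finally show ?thesis ..
    qed
    also have "ennreal (p \<theta>) + ennreal (of_bool (overlap n \<theta> \<theta> < \<rho> * real n / 2) + 2 * exp (- (\<tau>\<^sup>2 / 4)))
       = ennreal (p \<theta> + of_bool (overlap n \<theta> \<theta> < \<rho> * real n / 2) + 2 * exp (- (\<tau>\<^sup>2 / 4)))"
      by (subst ennreal_plus[symmetric]) (auto simp: p_def add.assoc)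
    finally show ?thesis .
  qed
  have p0: "0 \<le> p \<theta>" for \<theta> by (simp add: p_def)
  have "(\<integral>\<^sup>+z. emeasure (planted_law n (sqrt 2 * lam) \<rho>)
        {y \<in> space (planted_law n (sqrt 2 * lam) \<rho>). \<not> clone_test n \<tau> X (clone_sum n z y, clone_diff n z y)} \<partial>?\<gamma>)
     = (\<integral>\<^sup>+z. (\<Sum>\<theta>\<in>set_pmf ?\<pi>. emeasure (?D (sqrt 2 * lam) \<theta>) (?A z) * ennreal (pmf ?\<pi> \<theta>)) \<partial>?\<gamma>)"
  proof (rule nn_integral_cong)
    fix z
    have "emeasure (planted_law n (sqrt 2 * lam) \<rho>) (?A z) = (\<integral>\<^sup>+\<theta>. emeasure (?D (sqrt 2 * lam) \<theta>) (?A z) \<partial>measure_pmf ?\<pi>)"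
      unfolding planted_law_gauss_image by (rule emeasure_bind_pmf[OF pD _ Am]) simp
    also have "\<dots> = (\<Sum>\<theta>\<in>set_pmf ?\<pi>. emeasure (?D (sqrt 2 * lam) \<theta>) (?A z) * ennreal (pmf ?\<pi> \<theta>))"
      by (rule nn_integral_measure_pmf_finite[OF finite_set_theta_pmf]) simp
    finally show "emeasure (planted_law n (sqrt 2 * lam) \<rho>) {y \<in> space (planted_law n (sqrt 2 * lam) \<rho>). \<not> clone_test n \<tau> X (clone_sum n z y, clone_diff n z y)}
      = (\<Sum>\<theta>\<in>set_pmf ?\<pi>. emeasure (?D (sqrt 2 * lam) \<theta>) (?A z) * ennreal (pmf ?\<pi> \<theta>))"
      by (simp only: sp)
  qed
  also have "\<dots> = (\<Sum>\<theta>\<in>set_pmf ?\<pi>. (\<integral>\<^sup>+z. emeasure (?D (sqrt 2 * lam) \<theta>) (?A z) \<partial>?\<gamma>) * ennreal (pmf ?\<pi> \<theta>))"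
  proof -
    have nQ: "Measurable.pred (PiM (entries n) (\<lambda>_. borel) \<Otimes>\<^sub>M PiM (entries n) (\<lambda>_. borel)) (\<lambda>q. \<not> clone_test n \<tau> X q)"
      using clone_test_measurable[OF X] by measurable
    have m: "(\<lambda>z. emeasure (?D (sqrt 2 * lam) \<theta>) (?A z)) \<in> borel_measurable ?\<gamma>" for \<theta>
      using measurable_emeasure_clone[OF pD sets_gauss_image nQ] by (simp only: Dsp)
    have m': "(\<lambda>z. f z * ennreal r) \<in> borel_measurable ?\<gamma>" if [measurable]: "f \<in> borel_measurable ?\<gamma>" for f r
      by measurable
    show ?thesis
      by (subst nn_integral_sum[OF m'[OF m]]) (intro sum.cong refl nn_integral_multc m)
  qed
  also have "\<dots> \<le> (\<Sum>\<theta>\<in>set_pmf ?\<pi>. ennreal (p \<theta> + of_bool (overlap n \<theta> \<theta> < \<rho> * real n / 2) + 2 * exp (- (\<tau>\<^sup>2 / 4))) * ennreal (pmf ?\<pi> \<theta>))"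
    by (intro sum_mono mult_right_mono each) auto
  also have "\<dots> = ennreal (\<Sum>\<theta>\<in>set_pmf ?\<pi>. pmf ?\<pi> \<theta> * (p \<theta> + of_bool (overlap n \<theta> \<theta> < \<rho> * real n / 2) + 2 * exp (- (\<tau>\<^sup>2 / 4))))"
    by (subst sum_ennreal[symmetric]) (auto simp: p0 ennreal_mult' mult.commute intro!: sum.cong add_nonneg_nonneg mult_nonneg_nonneg)
  also have "\<dots> = ennreal (measure_pmf.expectation ?\<pi> p + measure_pmf.expectation ?\<pi> (\<lambda>\<theta>. of_bool (overlap n \<theta> \<theta> < \<rho> * real n / 2)) + 2 * exp (- (\<tau>\<^sup>2 / 4)))"
    unfolding sum_pmf_theta by (simp add: integrable_measure_pmf_finite finite_set_theta_pmf)
  also have "\<dots> \<le> ennreal (1 - c / 2 + exp (- (\<rho> * real n / 10)) + 2 * exp (- (\<tau>\<^sup>2 / 4)))"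
    by (intro ennreal_leI add_mono psum overlap_self_tail \<rho> order.refl)
  finally show ?thesis .
qed

text \<open>One \<open>z\<close> has to serve both error probabilities, so their weighted sum is
  averaged over \<open>z\<close>. The weight M anticipates the union bound over the samples.\<close>

lemma exists_clone_seed:
  fixes X :: "(nat \<times> nat \<Rightarrow> real) \<Rightarrow> nat \<times> nat \<Rightarrow> real"
  assumes X: "\<And>e. (\<lambda>y. X y e) \<in> borel_measurable (PiM (entries n) (\<lambda>_. borel))"
    and lam: "0 < lam" and \<rho>: "0 < \<rho>" "\<rho> < 1" and n: "0 < n"
    and c: "0 < c" "c \<le> det_score n lam \<rho> X" and \<tau>: "\<tau> = c * lam * (\<rho> * real n) / 8"
  obtains z where
    "real M * measure (noise_law n) {y \<in> space (noise_law n). clone_test n \<tau> X (clone_sum n z y, clone_diff n z y)}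
      + measure (planted_law n (sqrt 2 * lam) \<rho>)
          {y \<in> space (planted_law n (sqrt 2 * lam) \<rho>). \<not> clone_test n \<tau> X (clone_sum n z y, clone_diff n z y)}
      \<le> 1 - c / 2 + exp (- (\<rho> * real n / 10)) + (2 * real M + 3) * exp (- (\<tau>\<^sup>2 / 4))"
proof -
  let ?\<gamma> = "gauss_prod entry_sd (upper n)"
  let ?a = "\<lambda>z. measure (noise_law n) {y \<in> space (noise_law n). clone_test n \<tau> X (clone_sum n z y, clone_diff n z y)}"
  let ?b = "\<lambda>z. measure (planted_law n (sqrt 2 * lam) \<rho>)
          {y \<in> space (planted_law n (sqrt 2 * lam) \<rho>). \<not> clone_test n \<tau> X (clone_sum n z y, clone_diff n z y)}"
  let ?R = "1 - c / 2 + exp (- (\<rho> * real n / 10)) + (2 * real M + 2) * exp (- (\<tau>\<^sup>2 / 4))"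
  \<comment> \<open>This slack makes the averaging argument end in a strict contradiction; it turns
    2 M + 2 into 2 M + 3.\<close>
  let ?\<delta> = "exp (- (\<tau>\<^sup>2 / 4))"
  interpret g: prob_space ?\<gamma> by (rule prob_space_gauss_prod[OF entry_sd_pos])
  interpret N: prob_space "noise_law n" by (rule prob_space_noise_law)
  interpret P: prob_space "planted_law n (sqrt 2 * lam) \<rho>"
    unfolding planted_law_def by (rule prob_space.prob_space_distr[OF prob_space_model_space observation_measurable])
  have \<tau>0: "0 < \<tau>" using lam \<rho> n c by (simp add: \<tau>)
  \<comment> \<open>Keeps \<open>?R\<close> nonnegative; \<open>ennreal\<close> would send a
    negative bound to 0.\<close>
  have c1: "c \<le> 1"
  proof -
    have "prob_space (gauss_image entry_sd (upper n) (entries n) sort_pair (signal lam \<theta>))" for \<theta>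
      by (rule prob_space_gauss_image[OF entry_sd_pos finite_upper _ sort_pair_entries]) simp
    note pD = this
    have "(\<integral>y. corr n (X y) (signal lam \<theta>) \<partial>gauss_image entry_sd (upper n) (entries n) sort_pair (signal lam \<theta>)) \<le> 1" for \<theta>
    proof -
      interpret D: prob_space "gauss_image entry_sd (upper n) (entries n) sort_pair (signal lam \<theta>)" by (rule pD)
      have "(\<lambda>y. corr n (X y) (signal lam \<theta>)) \<in> borel_measurable (PiM (entries n) (\<lambda>_. borel))"
        by (intro corr_measurable X) simp
      then have "integrable (gauss_image entry_sd (upper n) (entries n) sort_pair (signal lam \<theta>)) (\<lambda>y. corr n (X y) (signal lam \<theta>))"
        by (intro D.integrable_const_bound[where B=1]) (auto simp: abs_corr_le gauss_image_def)
      then show ?thesis using abs_corr_le by (intro D.integral_le_const) (auto simp: abs_le_iff)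
    qed
    then have "det_score n lam \<rho> X \<le> 1"
      unfolding det_score_def
      by (intro measure_pmf.integral_le_const integrable_measure_pmf_finite finite_set_theta_pmf) auto
    then show ?thesis using c by simp
  qed
  have R0: "0 \<le> ?R" using c1 by (intro add_nonneg_nonneg mult_nonneg_nonneg) auto
  have nQ: "Measurable.pred (PiM (entries n) (\<lambda>_. borel) \<Otimes>\<^sub>M PiM (entries n) (\<lambda>_. borel)) (\<lambda>q. \<not> clone_test n \<tau> X q)"
    using clone_test_measurable[OF X] by measurable
  note am = measurable_emeasure_clone[OF prob_space_noise_law sets_noise_law clone_test_measurable[OF X, of \<tau>]]
  have sP: "sets (planted_law n (sqrt 2 * lam) \<rho>) = sets (PiM (entries n) (\<lambda>_. borel))" by (simp add: planted_law_def)
  note bm = measurable_emeasure_clone[OF P.prob_space_axioms sP nQ]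
  have scale: "(\<lambda>z. ennreal r * f z) \<in> borel_measurable ?\<gamma>" if [measurable]: "f \<in> borel_measurable ?\<gamma>" for r f
    by measurable
  have tot: "(\<integral>\<^sup>+z. ennreal (real M * ?a z + ?b z) \<partial>?\<gamma>) \<le> ennreal ?R"
  proof -
    have "(\<integral>\<^sup>+z. ennreal (real M * ?a z + ?b z) \<partial>?\<gamma>) = (\<integral>\<^sup>+z. ennreal (real M) * emeasure (noise_law n) {y \<in> space (noise_law n). clone_test n \<tau> X (clone_sum n z y, clone_diff n z y)} + emeasure (planted_law n (sqrt 2 * lam) \<rho>)
          {y \<in> space (planted_law n (sqrt 2 * lam) \<rho>). \<not> clone_test n \<tau> X (clone_sum n z y, clone_diff n z y)} \<partial>?\<gamma>)"
      by (intro nn_integral_cong) (simp add: N.emeasure_eq_measure P.emeasure_eq_measure ennreal_mult')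
    also have "\<dots> = ennreal (real M) * (\<integral>\<^sup>+z. emeasure (noise_law n) {y \<in> space (noise_law n). clone_test n \<tau> X (clone_sum n z y, clone_diff n z y)} \<partial>?\<gamma>) + (\<integral>\<^sup>+z. emeasure (planted_law n (sqrt 2 * lam) \<rho>)
          {y \<in> space (planted_law n (sqrt 2 * lam) \<rho>). \<not> clone_test n \<tau> X (clone_sum n z y, clone_diff n z y)} \<partial>?\<gamma>)"
      by (subst nn_integral_add) (simp_all add: nn_integral_cmult[OF am] bm scale[OF am])
    also have "\<dots> \<le> ennreal (real M) * ennreal (2 * exp (- (\<tau>\<^sup>2 / 4))) + ennreal (1 - c / 2 + exp (- (\<rho> * real n / 10)) + 2 * exp (- (\<tau>\<^sup>2 / 4)))"
      by (intro add_mono mult_left_mono null_false_alarm[OF X \<tau>0] planted_miss[OF X lam \<rho> n c \<tau>]) auto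
    also have "\<dots> = ennreal (real M * (2 * exp (- (\<tau>\<^sup>2 / 4))) + (1 - c / 2 + exp (- (\<rho> * real n / 10)) + 2 * exp (- (\<tau>\<^sup>2 / 4))))"
      using c1 by (subst ennreal_plus) (auto simp: ennreal_mult' intro!: add_nonneg_nonneg)
    also have "\<dots> = ennreal ?R" by (simp add: algebra_simps)
    finally show ?thesis .
  qed
  have "\<exists>z. real M * ?a z + ?b z \<le> ?R + ?\<delta>"
  proof (rule ccontr)
    assume "\<not> ?thesis"
    then have "ennreal (?R + ?\<delta>) \<le> ennreal (real M * ?a z + ?b z)" for z
      by (intro ennreal_leI) (simp add: not_le less_imp_le)
    then have "(\<integral>\<^sup>+z. ennreal (?R + ?\<delta>) \<partial>?\<gamma>) \<le> (\<integral>\<^sup>+z. ennreal (real M * ?a z + ?b z) \<partial>?\<gamma>)"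
      by (intro nn_integral_mono)
    with tot have "ennreal (?R + ?\<delta>) \<le> ennreal ?R" by (simp add: g.emeasure_space_1)
    then show False using R0 by (simp add: ennreal_le_iff)
  qed
  then obtain z where "real M * ?a z + ?b z \<le> ?R + ?\<delta>" by blast
  then have "real M * ?a z + ?b z \<le> 1 - c / 2 + exp (- (\<rho> * real n / 10)) + (2 * real M + 3) * exp (- (\<tau>\<^sup>2 / 4))"
    by (simp add: algebra_simps)
  then show thesis by (rule that)
qed

section \<open>The detector\<close>

text \<open>
  Every sample \<open>j\<close> has its own registers, which makes it unnecessary to reset them between samples: they
  are initially \<open>0\<close>.
\<close>

datatype reg = RProg nat nat | ROut nat "nat \<times> nat" | RTmp | RTmp2 | RSq nat | RIp nat | ROne | RFlag

instance reg :: countable by countable_datatype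

definition rg :: "reg \<Rightarrow> nat" where "rg = to_nat"

lemma rg_eq_iff[simp]: "rg a = rg b \<longleftrightarrow> a = b"
  by (simp add: rg_def)

context
  fixes n :: nat and z :: "nat \<times> nat \<Rightarrow> real" and \<omega> :: "nat \<Rightarrow> real" and \<tau> :: real
    and p :: "(nat \<times> nat, nat \<times> nat) prog"
begin

text \<open>Compiles an instruction of \<open>p\<close> for the registers of sample
  \<open>j\<close>: inputs are turned into the first clone as they are read, and tape cells become
  constants. Reading outside the matrix gives \<open>undefined\<close> because
  \<open>clone_sum\<close> is a restricted function. A \<open>Write\<close> becomes the addition of
  0, which serves as a copy into an output register.\<close>

fun embed_instr :: "nat \<Rightarrow> (nat \<times> nat, nat \<times> nat) instr \<Rightarrow> (nat \<times> (nat \<times> nat), unit) instr list" where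
  "embed_instr j (Const r a) = [Const (rg (RProg j r)) a]"
| "embed_instr j (Read r e) =
     (if e \<in> entries n then
        [Read (rg (RProg j r)) (j, e), Const (rg RTmp) (z (sort_pair e)), Add (rg (RProg j r)) (rg (RProg j r)) (rg RTmp),
         Const (rg RTmp) (sqrt 2), Div (rg (RProg j r)) (rg (RProg j r)) (rg RTmp)]
      else [Const (rg (RProg j r)) undefined])"
| "embed_instr j (Gauss r s) = [Const (rg (RProg j r)) (\<omega> s)]"
| "embed_instr j (Add r a b) = [Add (rg (RProg j r)) (rg (RProg j a)) (rg (RProg j b))]"
| "embed_instr j (Sub r a b) = [Sub (rg (RProg j r)) (rg (RProg j a)) (rg (RProg j b))]"
| "embed_instr j (Mul r a b) = [Mul (rg (RProg j r)) (rg (RProg j a)) (rg (RProg j b))]"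
| "embed_instr j (Div r a b) = [Div (rg (RProg j r)) (rg (RProg j a)) (rg (RProg j b))]"
| "embed_instr j (IfLe r a b c d) = [IfLe (rg (RProg j r)) (rg (RProg j a)) (rg (RProg j b)) (rg (RProg j c)) (rg (RProg j d))]"
| "embed_instr j (Write k a) = [Const (rg RTmp) 0, Add (rg (ROut j k)) (rg (RProg j a)) (rg RTmp)]"

text \<open>The contribution of one entry to the two sides of the clone test. The second clone is
  computed from the input on the spot.\<close>

definition score_step :: "nat \<Rightarrow> nat \<times> nat \<Rightarrow> (nat \<times> (nat \<times> nat), unit) instr list" where
  "score_step j e =
     [Mul (rg RTmp) (rg (ROut j e)) (rg (ROut j e)), Add (rg (RSq j)) (rg (RSq j)) (rg RTmp),
      Read (rg RTmp) (j, e), Const (rg RTmp2) (z (sort_pair e)), Sub (rg RTmp) (rg RTmp) (rg RTmp2),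
      Const (rg RTmp2) (sqrt 2), Div (rg RTmp) (rg RTmp) (rg RTmp2),
      Mul (rg RTmp) (rg (ROut j e)) (rg RTmp), Add (rg (RIp j)) (rg (RIp j)) (rg RTmp)]"

text \<open>The flag is kept or set to 1 and never cleared, so in the end it is the disjunction over
  all samples. At equality \<open>IfLe\<close> keeps it, in accordance with the strict inequality of
  \<open>clone_test\<close>.\<close>

definition decide_step :: "nat \<Rightarrow> (nat \<times> (nat \<times> nat), unit) instr list" where
  "decide_step j =
     [Mul (rg (RIp j)) (rg (RIp j)) (rg (RIp j)), Const (rg RTmp) (\<tau>\<^sup>2), Mul (rg (RSq j)) (rg RTmp) (rg (RSq j)),
      Const (rg ROne) 1, IfLe (rg RFlag) (rg (RIp j)) (rg (RSq j)) (rg RFlag) (rg ROne)]"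

definition sample_block :: "nat \<Rightarrow> (nat \<times> (nat \<times> nat), unit) prog" where
  "sample_block j = concat (map (embed_instr j) p) @ concat (map (score_step j) (List.product [0..<n] [0..<n])) @ decide_step j"

definition detector :: "nat \<Rightarrow> (nat \<times> (nat \<times> nat), unit) prog" where
  "detector M = concat (map sample_block [0..<M]) @ [Write () (rg RFlag)]"

lemma length_embed_instr: "length (embed_instr j ins) \<le> 5"
  by (cases ins) auto

lemma length_concat_map_le: "(\<And>x. length (f x) \<le> k) \<Longrightarrow> length (concat (map f xs)) \<le> length xs * k"
  by (induction xs) (auto intro: add_mono)

text \<open>Compilation costs a factor of at most 5, scoring 9 instructions per entry and the
  decision 5; the last 1 is the final output.\<close>

lemma run_time_detector: "run_time (detector M) \<le> M * (5 * run_time p + 9 * n\<^sup>2 + 5) + 1"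
proof -
  have "length (sample_block j) \<le> 5 * length p + 9 * n\<^sup>2 + 5" for j
    using length_concat_map_le[where f="embed_instr j" and xs=p, OF length_embed_instr]
      length_concat_map_le[where f="score_step j" and k=9 and xs="List.product [0..<n] [0..<n]"]
    by (simp add: sample_block_def decide_step_def score_step_def power2_eq_square)
  from length_concat_map_le[where f=sample_block and xs="[0..<M]", OF this]
  show ?thesis by (simp add: detector_def run_time_def)
qed

section \<open>Correctness of the detector\<close>

context
  fixes x :: "nat \<times> (nat \<times> nat) \<Rightarrow> real" and \<omega>' :: "nat \<Rightarrow> real"
begin

text \<open>The simulation relation between a state of \<open>p\<close> and the registers of sample
  \<open>j\<close>. Scratch registers are not constrained.\<close>

definition mirrors :: "nat \<Rightarrow> (nat \<Rightarrow> real) \<times> (nat \<times> nat \<Rightarrow> real) \<Rightarrow> (nat \<Rightarrow> real) \<Rightarrow> bool" where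
  "mirrors j S v \<longleftrightarrow> (\<forall>r. v (rg (RProg j r)) = fst S r) \<and> (\<forall>k. v (rg (ROut j k)) = snd S k)"

text \<open>The last clause is a frame condition: the accumulators, the flag and the registers of
  all other samples survive, which the later stages rely on.\<close>

lemma embed_instr_correct:
  assumes "mirrors j S v"
  shows "\<exists>v'. fold (exec_instr x \<omega>') (embed_instr j ins) (v, out) = (v', out) \<and>
    mirrors j (exec_instr (clone_sum n z (\<lambda>e. x (j, e))) \<omega> ins S) v' \<and>
    (\<forall>q. (\<forall>r. q \<noteq> RProg j r) \<and> (\<forall>k. q \<noteq> ROut j k) \<and> q \<noteq> RTmp \<longrightarrow> v' (rg q) = v (rg q))"
proof -
  obtain u w where S: "S = (u, w)" by (cases S)
  show ?thesis
    using assms unfolding S mirrors_def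
    by (cases ins) (auto simp: clone_sum_def)
qed

lemma embed_prog_correct:
  assumes "mirrors j S v"
  shows "\<exists>v'. fold (exec_instr x \<omega>') (concat (map (embed_instr j) q)) (v, out) = (v', out) \<and>
    mirrors j (fold (exec_instr (clone_sum n z (\<lambda>e. x (j, e))) \<omega>) q S) v' \<and>
    (\<forall>q. (\<forall>r. q \<noteq> RProg j r) \<and> (\<forall>k. q \<noteq> ROut j k) \<and> q \<noteq> RTmp \<longrightarrow> v' (rg q) = v (rg q))"
  using assms
proof (induction q arbitrary: S v)
  case (Cons ins q)
  from embed_instr_correct[OF Cons.prems, of ins out] obtain v1 where
    v1: "fold (exec_instr x \<omega>') (embed_instr j ins) (v, out) = (v1, out)"
    "mirrors j (exec_instr (clone_sum n z (\<lambda>e. x (j, e))) \<omega> ins S) v1"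
    "\<forall>q. (\<forall>r. q \<noteq> RProg j r) \<and> (\<forall>k. q \<noteq> ROut j k) \<and> q \<noteq> RTmp \<longrightarrow> v1 (rg q) = v (rg q)" by blast
  from Cons.IH[OF v1(2)] obtain v2 where
    v2: "fold (exec_instr x \<omega>') (concat (map (embed_instr j) q)) (v1, out) = (v2, out)"
    "mirrors j (fold (exec_instr (clone_sum n z (\<lambda>e. x (j, e))) \<omega>) q (exec_instr (clone_sum n z (\<lambda>e. x (j, e))) \<omega> ins S)) v2"
    "\<forall>q. (\<forall>r. q \<noteq> RProg j r) \<and> (\<forall>k. q \<noteq> ROut j k) \<and> q \<noteq> RTmp \<longrightarrow> v2 (rg q) = v1 (rg q)" by blast
  show ?case using v1 v2 by (intro exI[of _ v2]) auto
qed simp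

lemma score_step_correct:
  "\<exists>v'. fold (exec_instr x \<omega>') (concat (map (score_step j) es)) (v, out) = (v', out) \<and>
    v' (rg (RSq j)) = v (rg (RSq j)) + (\<Sum>e\<leftarrow>es. v (rg (ROut j e)) * v (rg (ROut j e))) \<and>
    v' (rg (RIp j)) = v (rg (RIp j)) + (\<Sum>e\<leftarrow>es. v (rg (ROut j e)) * ((x (j, e) - z (sort_pair e)) / sqrt 2)) \<and>
    (\<forall>q. q \<noteq> RTmp \<and> q \<noteq> RTmp2 \<and> q \<noteq> RSq j \<and> q \<noteq> RIp j \<longrightarrow> v' (rg q) = v (rg q))"
proof (induction es arbitrary: v)
  case (Cons e es)
  obtain v1 where v1: "fold (exec_instr x \<omega>') (score_step j e) (v, out) = (v1, out)"
    "v1 (rg (RSq j)) = v (rg (RSq j)) + v (rg (ROut j e)) * v (rg (ROut j e))"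
    "v1 (rg (RIp j)) = v (rg (RIp j)) + v (rg (ROut j e)) * ((x (j, e) - z (sort_pair e)) / sqrt 2)"
    "\<forall>q. q \<noteq> RTmp \<and> q \<noteq> RTmp2 \<and> q \<noteq> RSq j \<and> q \<noteq> RIp j \<longrightarrow> v1 (rg q) = v (rg q)"
    by (simp add: score_step_def)
  from Cons.IH[of v1] obtain v2 where v2: "fold (exec_instr x \<omega>') (concat (map (score_step j) es)) (v1, out) = (v2, out)"
    "v2 (rg (RSq j)) = v1 (rg (RSq j)) + (\<Sum>e\<leftarrow>es. v1 (rg (ROut j e)) * v1 (rg (ROut j e)))"
    "v2 (rg (RIp j)) = v1 (rg (RIp j)) + (\<Sum>e\<leftarrow>es. v1 (rg (ROut j e)) * ((x (j, e) - z (sort_pair e)) / sqrt 2))"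
    "\<forall>q. q \<noteq> RTmp \<and> q \<noteq> RTmp2 \<and> q \<noteq> RSq j \<and> q \<noteq> RIp j \<longrightarrow> v2 (rg q) = v1 (rg q)"
    by blast
  show ?case using v1 v2 by (intro exI[of _ v2]) auto
qed simp

abbreviation alarm :: "nat \<Rightarrow> bool" where
  "alarm j \<equiv> clone_test n \<tau> (\<lambda>y. run_prog p y \<omega>) (clone_sum n z (\<lambda>e. x (j, e)), clone_diff n z (\<lambda>e. x (j, e)))"

lemma sample_block_correct:
  assumes v: "\<And>r. v (rg (RProg j r)) = 0" "\<And>k. v (rg (ROut j k)) = 0" "v (rg (RSq j)) = 0" "v (rg (RIp j)) = 0"
  shows "\<exists>v'. fold (exec_instr x \<omega>') (sample_block j) (v, out) = (v', out) \<and>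
    v' (rg RFlag) = (if alarm j then 1 else v (rg RFlag)) \<and>
    (\<forall>i\<noteq>j. \<forall>q\<in>{RSq i, RIp i} \<union> range (RProg i) \<union> range (ROut i). v' (rg q) = v (rg q))"
proof -
  let ?X = "run_prog p (clone_sum n z (\<lambda>e. x (j, e))) \<omega>"
  let ?d = "clone_diff n z (\<lambda>e. x (j, e))"
  let ?es = "List.product [0..<n] [0..<n]"
  have es: "distinct ?es" "set ?es = entries n"
    by (auto simp: distinct_product)
  have "mirrors j (\<lambda>_. 0, \<lambda>_. 0) v" using v by (simp add: mirrors_def)
  from embed_prog_correct[OF this, of p out] obtain v1 where
    v1: "fold (exec_instr x \<omega>') (concat (map (embed_instr j) p)) (v, out) = (v1, out)"
    "\<And>k. v1 (rg (ROut j k)) = ?X k"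
    and fr1: "\<And>q. (\<forall>r. q \<noteq> RProg j r) \<Longrightarrow> (\<forall>k. q \<noteq> ROut j k) \<Longrightarrow> q \<noteq> RTmp \<Longrightarrow> v1 (rg q) = v (rg q)"
    unfolding mirrors_def run_prog_def by blast
  from score_step_correct[of j ?es v1 out] obtain v2 where
    v2: "fold (exec_instr x \<omega>') (concat (map (score_step j) ?es)) (v1, out) = (v2, out)"
    "v2 (rg (RSq j)) = v1 (rg (RSq j)) + (\<Sum>e\<leftarrow>?es. v1 (rg (ROut j e)) * v1 (rg (ROut j e)))"
    "v2 (rg (RIp j)) = v1 (rg (RIp j)) + (\<Sum>e\<leftarrow>?es. v1 (rg (ROut j e)) * ((x (j, e) - z (sort_pair e)) / sqrt 2))"
    and fr2: "\<And>q. q \<noteq> RTmp \<Longrightarrow> q \<noteq> RTmp2 \<Longrightarrow> q \<noteq> RSq j \<Longrightarrow> q \<noteq> RIp j \<Longrightarrow> v2 (rg q) = v1 (rg q)"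
    by blast
  have sq: "v2 (rg (RSq j)) = frob_inner n ?X ?X"
    using v2(2) fr1[of "RSq j"] v(3) by (simp add: v1(2) frob_inner_def sum_list_distinct_conv_sum_set[OF es(1)] es(2) del: set_product)
  have ip: "v2 (rg (RIp j)) = frob_inner n ?X ?d"
  proof -
    have "v2 (rg (RIp j)) = (\<Sum>e\<in>entries n. ?X e * ((x (j, e) - z (sort_pair e)) / sqrt 2))"
      using v2(3) fr1[of "RIp j"] v(4) by (simp add: v1(2) sum_list_distinct_conv_sum_set[OF es(1)] es(2) del: set_product)
    also have "\<dots> = frob_inner n ?X ?d"
      unfolding frob_inner_def clone_diff_def by (intro sum.cong refl) auto
    finally show ?thesis .
  qed
  have fl: "v2 (rg RFlag) = v (rg RFlag)" using fr1[of RFlag] fr2[of RFlag] by simp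
  obtain v3 where v3: "fold (exec_instr x \<omega>') (decide_step j) (v2, out) = (v3, out)"
    "v3 (rg RFlag) = (if v2 (rg (RIp j)) * v2 (rg (RIp j)) \<le> \<tau>\<^sup>2 * v2 (rg (RSq j)) then v2 (rg RFlag) else 1)"
    and fr3: "\<And>q. q \<noteq> RTmp \<Longrightarrow> q \<noteq> ROne \<Longrightarrow> q \<noteq> RFlag \<Longrightarrow> q \<noteq> RSq j \<Longrightarrow> q \<noteq> RIp j \<Longrightarrow> v3 (rg q) = v2 (rg q)"
    by (simp add: decide_step_def)
  show ?thesis
  proof (intro exI[of _ v3] conjI)
    show "fold (exec_instr x \<omega>') (sample_block j) (v, out) = (v3, out)"
      by (simp add: sample_block_def v1 v2 v3)
    show "v3 (rg RFlag) = (if alarm j then 1 else v (rg RFlag))"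
      by (auto simp: v3 sq ip fl clone_test_def power2_eq_square)
    show "\<forall>i\<noteq>j. \<forall>q\<in>{RSq i, RIp i} \<union> range (RProg i) \<union> range (ROut i). v3 (rg q) = v (rg q)"
    proof (intro allI impI ballI)
      fix i q assume "i \<noteq> j" "q \<in> {RSq i, RIp i} \<union> range (RProg i) \<union> range (ROut i)"
      then have "v3 (rg q) = v2 (rg q)" "v2 (rg q) = v1 (rg q)" "v1 (rg q) = v (rg q)"
        by (auto intro!: fr1 fr2 fr3)
      then show "v3 (rg q) = v (rg q)" by simp
    qed
  qed
qed

text \<open>The second clause of the invariant says that the registers of samples not yet processed
  still hold 0, as the correctness of their blocks requires.\<close>

lemma sample_blocks_correct:
  "\<exists>v. fold (exec_instr x \<omega>') (concat (map sample_block [0..<M])) (\<lambda>_. 0, out) = (v, out) \<and>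
    v (rg RFlag) = (if \<exists>j<M. alarm j then 1 else 0) \<and>
    (\<forall>i\<ge>M. \<forall>q\<in>{RSq i, RIp i} \<union> range (RProg i) \<union> range (ROut i). v (rg q) = 0)"
proof (induction M)
  case (Suc M)
  then obtain v where v: "fold (exec_instr x \<omega>') (concat (map sample_block [0..<M])) (\<lambda>_. 0, out) = (v, out)"
    "v (rg RFlag) = (if \<exists>j<M. alarm j then 1 else 0)"
    "\<forall>i\<ge>M. \<forall>q\<in>{RSq i, RIp i} \<union> range (RProg i) \<union> range (ROut i). v (rg q) = 0" by blast
  have "v (rg (RProg M r)) = 0" "v (rg (ROut M k)) = 0" "v (rg (RSq M)) = 0" "v (rg (RIp M)) = 0" for r k
    using v(3) by auto
  from sample_block_correct[OF this, of out] obtain v' where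
    v': "fold (exec_instr x \<omega>') (sample_block M) (v, out) = (v', out)"
    "v' (rg RFlag) = (if alarm M then 1 else v (rg RFlag))"
    "\<forall>i\<noteq>M. \<forall>q\<in>{RSq i, RIp i} \<union> range (RProg i) \<union> range (ROut i). v' (rg q) = v (rg q)" by blast
  show ?case
  proof (intro exI[of _ v'] conjI)
    show "fold (exec_instr x \<omega>') (concat (map sample_block [0..<Suc M])) (\<lambda>_. 0, out) = (v', out)"
      by (simp add: v v')
    show "v' (rg RFlag) = (if \<exists>j<Suc M. alarm j then 1 else 0)"
      by (auto simp: v v' less_Suc_eq)
    show "\<forall>i\<ge>Suc M. \<forall>q\<in>{RSq i, RIp i} \<union> range (RProg i) \<union> range (ROut i). v' (rg q) = 0"
    proof (intro allI impI ballI)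
      fix i q assume i: "Suc M \<le> i" and q: "q \<in> {RSq i, RIp i} \<union> range (RProg i) \<union> range (ROut i)"
      then have "v' (rg q) = v (rg q)" using v'(3) by (metis Suc_n_not_le_n)
      also have "\<dots> = 0" using v(3) i q by (metis Suc_leD)
      finally show "v' (rg q) = 0" .
    qed
  qed
qed simp

lemma run_detector: "run_prog (detector M) x \<omega>' () = (if \<exists>j<M. alarm j then 1 else 0)"
proof -
  from sample_blocks_correct[of M "\<lambda>_. 0"] obtain v where
    "fold (exec_instr x \<omega>') (concat (map sample_block [0..<M])) (\<lambda>_. 0, \<lambda>_. 0) = (v, \<lambda>_. 0)"
    "v (rg RFlag) = (if \<exists>j<M. alarm j then 1 else 0)" by blast
  then show ?thesis by (simp add: run_prog_def detector_def)
qed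

end

end

section \<open>Error probabilities of the detector\<close>

lemma prob_output_deterministic:
  assumes R: "prob_space R" and f: "\<And>x \<omega>. run_prog q x \<omega> () = f x" and A: "{x \<in> space R. f x = b} \<in> sets R"
  shows "prob_output q R b = measure R {x \<in> space R. f x = b}"
proof -
  interpret R: prob_space R by (rule R)
  interpret T: prob_space gauss_tape by (rule prob_space_gauss_tape)
  have "{(x, \<omega>) \<in> space (R \<Otimes>\<^sub>M gauss_tape). run_prog q x \<omega> () = b} = {x \<in> space R. f x = b} \<times> space gauss_tape"
    by (auto simp: space_pair_measure f)
  then show ?thesis
    unfolding prob_output_def
    by (simp add: measure_def T.emeasure_pair_measure_Times[OF A sets.top] T.emeasure_space_1)
qed

lemma component_pred_sets:
  assumes j: "j < M" and Q: "Measurable.pred (PiM I (\<lambda>_. borel)) Q"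
  shows "{x \<in> space (PiM ({..<M} \<times> I) (\<lambda>_. borel)). Q (\<lambda>e\<in>I. x (j, e))} \<in> sets (PiM ({..<M} \<times> I) (\<lambda>_. borel))"
proof -
  have "(\<lambda>x. \<lambda>e\<in>I. x (j, e)) \<in> measurable (PiM ({..<M} \<times> I) (\<lambda>_. borel)) (PiM I (\<lambda>_. borel))"
    by (rule measurable_restrict) (rule measurable_component_singleton, use j in auto)
  from measurable_compose[OF this Q] show ?thesis by (simp only: pred_def)
qed

lemma samples_law_component:
  assumes R: "\<And>i. i < M \<Longrightarrow> prob_space (R i)" "\<And>i. i < M \<Longrightarrow> sets (R i) = sets (PiM I (\<lambda>_. borel))"
    and j: "j < M" and Q: "Measurable.pred (PiM I (\<lambda>_. borel)) Q"
  shows "{x \<in> space (samples_law M I R). Q (\<lambda>e\<in>I. x (j, e))} \<in> sets (samples_law M I R)"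
    and "emeasure (samples_law M I R) {x \<in> space (samples_law M I R). Q (\<lambda>e\<in>I. x (j, e))} = emeasure (R j) {y \<in> space (R j). Q y}"
proof -
  let ?c = "\<lambda>x. \<lambda>e\<in>I. x (j, e)"
  have sp: "space (samples_law M I R) = space (PiM ({..<M} \<times> I) (\<lambda>_. borel))"
    by (simp add: samples_law_def)
  show A: "{x \<in> space (samples_law M I R). Q (?c x)} \<in> sets (samples_law M I R)"
    using component_pred_sets[OF j Q] by (simp only: sp sets_samples_law)
  have fm: "flatten_samples M I \<in> measurable (PiM {..<M} R) (PiM ({..<M} \<times> I) (\<lambda>_. borel))"
    by (rule measurable_flatten_samples') (rule R)
  have Qj: "{y \<in> space (R j). Q y} \<in> sets (R j)"
    using Q unfolding sets_eq_imp_space_eq[OF R(2)[OF j]] R(2)[OF j] by (simp add: pred_def)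
  have "emeasure (samples_law M I R) {x \<in> space (samples_law M I R). Q (?c x)}
     = emeasure (PiM {..<M} R) (flatten_samples M I -` {x \<in> space (samples_law M I R). Q (?c x)} \<inter> space (PiM {..<M} R))"
    using A unfolding samples_law_def by (intro emeasure_distr[OF fm]) simp
  also have "flatten_samples M I -` {x \<in> space (samples_law M I R). Q (?c x)} \<inter> space (PiM {..<M} R)
     = (\<lambda>g. g j) -` {y \<in> space (R j). Q y} \<inter> space (PiM {..<M} R)"
  proof (intro set_eqI)
    fix g
    have "?c (flatten_samples M I g) = g j" if "g \<in> space (PiM {..<M} R)"
    proof -
      have "g j \<in> space (R j)" using that j by (auto simp: space_PiM PiE_iff)
      then have "g j \<in> extensional I" unfolding sets_eq_imp_space_eq[OF R(2)[OF j]] by (simp add: space_PiM PiE_def)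
      then show ?thesis using j by (auto simp: flatten_samples_def extensional_def fun_eq_iff)
    qed
    moreover have "flatten_samples M I g \<in> space (samples_law M I R)" if "g \<in> space (PiM {..<M} R)"
      using measurable_space[OF fm that] by (simp add: sp)
    moreover have "g j \<in> space (R j)" if "g \<in> space (PiM {..<M} R)"
      using that j by (auto simp: space_PiM PiE_iff)
    ultimately show "g \<in> flatten_samples M I -` {x \<in> space (samples_law M I R). Q (?c x)} \<inter> space (PiM {..<M} R)
      \<longleftrightarrow> g \<in> (\<lambda>g. g j) -` {y \<in> space (R j). Q y} \<inter> space (PiM {..<M} R)" by auto
  qed
  also have "emeasure (PiM {..<M} R) \<dots> = emeasure (distr (PiM {..<M} R) (R j) (\<lambda>g. g j)) {y \<in> space (R j). Q y}"
    using j by (intro emeasure_distr[symmetric] Qj measurable_component_singleton) auto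
  also have "distr (PiM {..<M} R) (R j) (\<lambda>g. g j) = R j"
    by (rule distr_PiM_component) (use R j in auto)
  finally show "emeasure (samples_law M I R) {x \<in> space (samples_law M I R). Q (?c x)} = emeasure (R j) {y \<in> space (R j). Q y}" .
qed

text \<open>Union bound over the samples, each of which has law \<open>N\<close>.\<close>

lemma hidden_null_any_le:
  assumes N: "prob_space N" "sets N = sets (PiM I (\<lambda>_. borel))" and Q: "Measurable.pred (PiM I (\<lambda>_. borel)) Q"
  shows "{x \<in> space (hidden_null M I N). \<exists>j<M. Q (\<lambda>e\<in>I. x (j, e))} \<in> sets (hidden_null M I N)"
    and "measure (hidden_null M I N) {x \<in> space (hidden_null M I N). \<exists>j<M. Q (\<lambda>e\<in>I. x (j, e))} \<le> real M * measure N {y \<in> space N. Q y}"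
proof -
  let ?R = "hidden_null M I N"
  let ?A = "\<lambda>j. {x \<in> space ?R. Q (\<lambda>e\<in>I. x (j, e))}"
  interpret R: prob_space ?R unfolding hidden_null_def by (rule prob_space_samples_law) (use N in auto)
  have A: "?A j \<in> sets ?R" "measure ?R (?A j) = measure N {y \<in> space N. Q y}" if "j < M" for j
    using samples_law_component[of M "\<lambda>_. N" I j Q, OF N that Q] by (auto simp: hidden_null_def measure_def)
  have eq: "{x \<in> space ?R. \<exists>j<M. Q (\<lambda>e\<in>I. x (j, e))} = (\<Union>j\<in>{..<M}. ?A j)" by auto
  show "{x \<in> space ?R. \<exists>j<M. Q (\<lambda>e\<in>I. x (j, e))} \<in> sets ?R"
    unfolding eq using A by (intro sets.finite_UN) auto
  have "measure ?R (\<Union>j\<in>{..<M}. ?A j) \<le> (\<Sum>j<M. measure ?R (?A j))"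
    using A by (intro R.finite_measure_subadditive_finite) auto
  also have "\<dots> = real M * measure N {y \<in> space N. Q y}" using A by simp
  finally show "measure ?R {x \<in> space ?R. \<exists>j<M. Q (\<lambda>e\<in>I. x (j, e))} \<le> real M * measure N {y \<in> space N. Q y}"
    unfolding eq .
qed

text \<open>If no sample raises an alarm, then in particular the informative one does not, and its
  law is \<open>P\<close> whatever its position.\<close>

lemma hidden_planted_none_le:
  assumes P: "prob_space P" "sets P = sets (PiM I (\<lambda>_. borel))"
    and N: "prob_space N" "sets N = sets (PiM I (\<lambda>_. borel))"
    and Q: "Measurable.pred (PiM I (\<lambda>_. borel)) Q" and M: "0 < M"
  shows "prob_space (hidden_planted M I P N)"
    and "sets (hidden_planted M I P N) = sets (PiM ({..<M} \<times> I) (\<lambda>_. borel))"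
    and "{x \<in> space (hidden_planted M I P N). \<not> (\<exists>j<M. Q (\<lambda>e\<in>I. x (j, e)))} \<in> sets (hidden_planted M I P N)"
    and "measure (hidden_planted M I P N) {x \<in> space (hidden_planted M I P N). \<not> (\<exists>j<M. Q (\<lambda>e\<in>I. x (j, e)))} \<le> measure P {y \<in> space P. \<not> Q y}"
proof -
  let ?R = "hidden_planted M I P N"
  let ?S = "\<lambda>\<kappa>. samples_law M I (\<lambda>j. if j = \<kappa> then P else N)"
  let ?L = "PiM ({..<M} \<times> I) (\<lambda>_. borel) :: (nat \<times> 'a \<Rightarrow> real) measure"
  let ?A = "{x \<in> space ?R. \<not> (\<exists>j<M. Q (\<lambda>e\<in>I. x (j, e)))}"
  interpret P: prob_space P by (rule P)
  have pS: "prob_space (?S \<kappa>)" for \<kappa> by (rule prob_space_samples_law) (use P N in auto)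
  show pR: "prob_space ?R" unfolding hidden_planted_def by (rule prob_space_bind_pmf[OF pS sets_samples_law])
  show sR: "sets ?R = sets ?L" unfolding hidden_planted_def by (rule sets_bind_pmf[OF pS sets_samples_law])
  interpret R: prob_space ?R by (rule pR)
  note spR = sets_eq_imp_space_eq[OF sR]
  have spS: "space (?S \<kappa>) = space ?L" for \<kappa> by (rule sets_eq_imp_space_eq) simp
  have A_eq: "?A = space ?L - (\<Union>j\<in>{..<M}. {x \<in> space ?L. Q (\<lambda>e\<in>I. x (j, e))})"
  proof -
    have "{x \<in> S. \<not> (\<exists>j<M. B x j)} = S - (\<Union>j\<in>{..<M}. {x \<in> S. B x j})" for S and B :: "(nat \<times> 'a \<Rightarrow> real) \<Rightarrow> nat \<Rightarrow> bool"
      by auto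
    from this[of "space ?L" "\<lambda>x j. Q (\<lambda>e\<in>I. x (j, e))"] show ?thesis by (simp only: spR)
  qed
  have "(\<Union>j\<in>{..<M}. {x \<in> space ?L. Q (\<lambda>e\<in>I. x (j, e))}) \<in> sets ?L"
  proof (rule sets.finite_UN)
    fix j assume "j \<in> {..<M}"
    then have "j < M" by simp
    from component_pred_sets[OF this Q] show "{x \<in> space ?L. Q (\<lambda>e\<in>I. x (j, e))} \<in> sets ?L" .
  qed (rule finite_lessThan)
  then have A: "?A \<in> sets ?L" unfolding A_eq by (rule sets.compl_sets)
  then show "?A \<in> sets ?R" by (simp only: sR)
  have nQ: "Measurable.pred (PiM I (\<lambda>_. borel)) (\<lambda>y. \<not> Q y)" using Q by measurable
  have "emeasure ?R ?A = (\<integral>\<^sup>+\<kappa>. emeasure (?S \<kappa>) ?A \<partial>measure_pmf (pmf_of_set {..<M}))"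
    unfolding hidden_planted_def by (rule emeasure_bind_pmf[OF pS sets_samples_law A[unfolded hidden_planted_def]])
  also have "\<dots> \<le> (\<integral>\<^sup>+\<kappa>. emeasure P {y \<in> space P. \<not> Q y} \<partial>measure_pmf (pmf_of_set {..<M}))"
  proof (rule nn_integral_mono_AE, rule AE_pmfI)
    fix \<kappa> assume "\<kappa> \<in> set_pmf (pmf_of_set {..<M})"
    then have \<kappa>: "\<kappa> < M" using M by (subst (asm) set_pmf_of_set) auto
    let ?Q = "\<lambda>j. if j = \<kappa> then P else N"
    have c: "{x \<in> space (?S \<kappa>). \<not> Q (\<lambda>e\<in>I. x (\<kappa>, e))} \<in> sets (?S \<kappa>)"
      "emeasure (?S \<kappa>) {x \<in> space (?S \<kappa>). \<not> Q (\<lambda>e\<in>I. x (\<kappa>, e))} = emeasure P {y \<in> space P. \<not> Q y}"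
    proof -
      have 1: "prob_space (?Q j)" "sets (?Q j) = sets (PiM I (\<lambda>_. borel))" for j
        by (cases "j = \<kappa>", simp_all add: P N)+
      note 2 = samples_law_component[where M=M and R="?Q" and j=\<kappa>, OF 1 \<kappa> nQ]
      show "{x \<in> space (?S \<kappa>). \<not> Q (\<lambda>e\<in>I. x (\<kappa>, e))} \<in> sets (?S \<kappa>)" by (rule 2)
      show "emeasure (?S \<kappa>) {x \<in> space (?S \<kappa>). \<not> Q (\<lambda>e\<in>I. x (\<kappa>, e))} = emeasure P {y \<in> space P. \<not> Q y}"
        using 2(2) by (simp only: if_True simp_thms)
    qed
    have "emeasure (?S \<kappa>) ?A \<le> emeasure (?S \<kappa>) {x \<in> space (?S \<kappa>). \<not> Q (\<lambda>e\<in>I. x (\<kappa>, e))}"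
    proof (rule emeasure_mono[OF _ c(1)], rule subsetI)
      fix x assume "x \<in> ?A"
      then have "x \<in> space ?L" "\<not> Q (\<lambda>e\<in>I. x (\<kappa>, e))"
        using \<kappa> unfolding spR by blast+
      then show "x \<in> {x \<in> space (?S \<kappa>). \<not> Q (\<lambda>e\<in>I. x (\<kappa>, e))}"
        unfolding spS by blast
    qed
    then show "emeasure (?S \<kappa>) ?A \<le> emeasure P {y \<in> space P. \<not> Q y}" by (simp add: c)
  qed
  also have "\<dots> = emeasure P {y \<in> space P. \<not> Q y}" by simp
  finally show "measure ?R ?A \<le> measure P {y \<in> space P. \<not> Q y}"
    by (simp add: R.emeasure_eq_measure P.emeasure_eq_measure)
qed

lemma clone_restrict:
  "clone_sum n z (\<lambda>e\<in>entries n. y e) = clone_sum n z y" "clone_diff n z (\<lambda>e\<in>entries n. y e) = clone_diff n z y"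
  by (auto simp: clone_sum_def clone_diff_def fun_eq_iff)

lemma detector_error:
  assumes P: "prob_space P" "sets P = sets (PiM (entries n) (\<lambda>_. borel))"
    and N: "prob_space N" "sets N = sets (PiM (entries n) (\<lambda>_. borel))" and M: "0 < M"
  shows "binary_valued (detector n z \<omega> \<tau> p M)"
    and "error_sum (detector n z \<omega> \<tau> p M) (hidden_planted M (entries n) P N) (hidden_null M (entries n) N)
      \<le> real M * measure N {y \<in> space N. clone_test n \<tau> (\<lambda>y. run_prog p y \<omega>) (clone_sum n z y, clone_diff n z y)}
        + measure P {y \<in> space P. \<not> clone_test n \<tau> (\<lambda>y. run_prog p y \<omega>) (clone_sum n z y, clone_diff n z y)}"
proof -
  let ?Q = "\<lambda>y. clone_test n \<tau> (\<lambda>y. run_prog p y \<omega>) (clone_sum n z y, clone_diff n z y)"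
  let ?f = "\<lambda>x. if \<exists>j<M. ?Q (\<lambda>e\<in>entries n. x (j, e)) then 1 else 0 :: real"
  have X: "(\<lambda>y. run_prog p y \<omega> e) \<in> borel_measurable (PiM (entries n) (\<lambda>_. borel))" for e
    by (intro run_prog_measurable measurable_PiM_apply) simp
  have Q: "Measurable.pred (PiM (entries n) (\<lambda>_. borel)) ?Q"
    by (rule clone_test_section[OF X])
  have run: "run_prog (detector n z \<omega> \<tau> p M) x \<omega>' () = ?f x" for x \<omega>'
    unfolding run_detector clone_restrict ..
  then show "binary_valued (detector n z \<omega> \<tau> p M)" by (simp add: binary_valued_def)
  have n1: "{x \<in> space (hidden_null M (entries n) N). ?f x = 1} = {x \<in> space (hidden_null M (entries n) N). \<exists>j<M. ?Q (\<lambda>e\<in>entries n. x (j, e))}"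
    by auto
  have p0: "{x \<in> space (hidden_planted M (entries n) P N). ?f x = 0} = {x \<in> space (hidden_planted M (entries n) P N). \<not> (\<exists>j<M. ?Q (\<lambda>e\<in>entries n. x (j, e)))}"
    by auto
  have pn: "prob_space (hidden_null M (entries n) N)"
    unfolding hidden_null_def by (rule prob_space_samples_law) (use N in auto)
  note hn = hidden_null_any_le[OF N Q, of M] and hp = hidden_planted_none_le[OF P N Q M]
  have "prob_output (detector n z \<omega> \<tau> p M) (hidden_null M (entries n) N) 1 = measure (hidden_null M (entries n) N) {x \<in> space (hidden_null M (entries n) N). ?f x = 1}"
    by (rule prob_output_deterministic[OF pn run], unfold n1, rule hn(1))
  moreover have "prob_output (detector n z \<omega> \<tau> p M) (hidden_planted M (entries n) P N) 0 = measure (hidden_planted M (entries n) P N) {x \<in> space (hidden_planted M (entries n) P N). ?f x = 0}"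
    by (rule prob_output_deterministic[OF hp(1) run], unfold p0, rule hp(3))
  ultimately show "error_sum (detector n z \<omega> \<tau> p M) (hidden_planted M (entries n) P N) (hidden_null M (entries n) N)
      \<le> real M * measure N {y \<in> space N. ?Q y} + measure P {y \<in> space P. \<not> ?Q y}"
    unfolding error_sum_def n1 p0 using hn(2) hp(4) by linarith
qed

section \<open>Asymptotics\<close>

text \<open>The constant polynomial 1 is admissible. This gives the lower half of the convergence of
  the advantage to 1, and the sign needed for squaring an upper bound.\<close>

lemma Adv_ge_1:
  assumes P: "prob_space P" and Q: "prob_space Q"
  shows "1 \<le> Adv I D P Q"
proof -
  interpret P: prob_space P by (rule P)
  interpret Q: prob_space Q by (rule Q)
  have "(\<lambda>_. 1) \<in> poly_funs I D"
    unfolding poly_funs_def by (intro CollectI exI[of _ "{\<lambda>_. 0}"] exI[of _ "\<lambda>_. 1"]) auto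
  then have "ereal ((\<integral>x. 1 \<partial>P) / sqrt (\<integral>x. 1\<^sup>2 \<partial>Q)) \<le> Adv I D P Q"
    unfolding Adv_def by (rule SUP_upper)
  then show ?thesis by (simp add: P.prob_space Q.prob_space one_ereal_def)
qed

lemma prob_space_planted_law: "prob_space (planted_law n lam \<rho>)"
  unfolding planted_law_def by (rule prob_space.prob_space_distr[OF prob_space_model_space observation_measurable])

lemma sets_planted_law: "sets (planted_law n lam \<rho>) = sets (PiM (entries n) (\<lambda>_. borel))"
  by (simp add: planted_law_def)

text \<open>The base N cancels against log N in the exponent, so the permitted time depends on D and
  C alone.\<close>

lemma time_bound_eq_exp:
  assumes "1 < N" shows "time_bound C N D = exp (real D / C)"
  using assms by (simp add: time_bound_def powr_def)

text \<open>Here q stands for (\<lambda>\<rho>n)^2, and 4 \<kappa> q is the exponent supplied by the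
  test. Of its four shares \<Delta> uses up one, by 30 \<rho>^2 \<le> \<kappa>, and the factor m
  another, by ln m \<le> \<kappa> (ln m)^2 \<le> \<kappa> q. Two shares remain.\<close>

lemma error_term_bound:
  fixes m q \<rho> \<kappa> \<Delta> M :: real
  assumes m: "1 \<le> m" "1 / \<kappa> \<le> ln m" and q: "(ln m)\<^sup>2 \<le> q" and \<kappa>: "0 < \<kappa>" "30 * \<rho>\<^sup>2 \<le> \<kappa>"
    and \<Delta>: "\<Delta> = exp (30 * \<rho>\<^sup>2 * q) + 1" and M: "M \<le> \<Delta> * m + 1"
  shows "(2 * M + 3) * exp (- (4 * \<kappa> * q)) \<le> 14 * exp (- (2 * \<kappa> * (ln m)\<^sup>2))"
proof -
  have q0: "0 \<le> q" using q zero_le_power2 order.trans by blast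
  have ln0: "0 \<le> ln m" using m by simp
  have E: "exp (30 * \<rho>\<^sup>2 * q) \<le> exp (\<kappa> * q)" using \<kappa> q0 by (simp add: mult_right_mono)
  have "1 \<le> exp (\<kappa> * q)" using \<kappa> q0 by simp
  then have \<Delta>2: "\<Delta> \<le> 2 * exp (\<kappa> * q)" unfolding \<Delta> using E by linarith
  have "m = exp (ln m)" using m by simp
  also have "\<dots> \<le> exp (\<kappa> * q)"
  proof -
    have "1 \<le> \<kappa> * ln m" using m \<kappa> by (simp add: field_simps)
    then have "1 * ln m \<le> \<kappa> * ln m * ln m" using ln0 by (intro mult_right_mono)
    also have "\<dots> = \<kappa> * (ln m)\<^sup>2" by (simp add: power2_eq_square)
    also have "\<dots> \<le> \<kappa> * q" using q \<kappa> by (intro mult_left_mono) auto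
    finally show ?thesis by simp
  qed
  finally have m2: "m \<le> exp (\<kappa> * q)" .
  have "1 \<le> \<Delta>" by (simp add: \<Delta>)
  then have \<Delta>m: "1 \<le> \<Delta> * m" using m mult_mono[of 1 \<Delta> 1 m] by simp
  have "2 * M + 3 \<le> 7 * (\<Delta> * m)" using M \<Delta>m by linarith
  also have "\<dots> \<le> 7 * ((2 * exp (\<kappa> * q)) * exp (\<kappa> * q))"
    using \<Delta>2 m2 m by (intro mult_left_mono mult_mono) auto
  also have "\<dots> = 14 * exp (2 * \<kappa> * q)" by (simp add: exp_add[symmetric] mult.assoc)
  finally have "(2 * M + 3) * exp (- (4 * \<kappa> * q)) \<le> 14 * exp (2 * \<kappa> * q) * exp (- (4 * \<kappa> * q))"
    by (intro mult_right_mono) auto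
  also have "\<dots> = 14 * exp (- (2 * \<kappa> * q))" by (simp add: exp_add[symmetric] mult.assoc)
  also have "\<dots> \<le> 14 * exp (- (2 * \<kappa> * (ln m)\<^sup>2))" using q \<kappa> by (simp add: mult_left_mono)
  finally show ?thesis .
qed

text \<open>Every factor is measured against \<Lambda> = \<lambda>^-2, the order of D. Powers of m
  are controlled by ln m \<le> \<epsilon> \<Lambda>, \<Delta> by the bound on \<lambda>^2 \<rho>^2
  m, and T by 1 / (ln m)^4 \<le> \<epsilon>. The total exponent is at most 40 \<epsilon> \<Lambda>,
  while D is at least \<Lambda> / 800 - \<epsilon> \<Lambda>, the lost 1 being at most \<epsilon>
  \<Lambda>. The third condition on \<epsilon> says precisely that C times the former is at most the
  latter.\<close>

lemma run_time_bound:
  fixes m lam \<rho> \<epsilon> C D \<Delta> M T :: real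
  assumes m: "1 \<le> m" "1 / \<epsilon> \<le> ln m" and \<epsilon>: "0 < \<epsilon>" "\<epsilon> \<le> 1" "\<epsilon> * (800 * (40 * C + 1)) \<le> 1"
    and lam: "0 < lam" and C: "0 < C"
    and x: "lam\<^sup>2 * \<rho>\<^sup>2 * m \<le> \<epsilon>" and l: "lam\<^sup>2 * ln m \<le> \<epsilon>"
    and T: "0 \<le> T" "T \<le> exp (1 / lam\<^sup>2 * (1 / ln m ^ 4))"
    and D: "1 / (800 * lam\<^sup>2) - 1 \<le> D"
    and \<Delta>: "\<Delta> = exp (30 * \<rho>\<^sup>2 * (lam * \<rho> * m)\<^sup>2) + 1" and M: "0 \<le> M" "M \<le> \<Delta> * m + 1"
  shows "M * (5 * T + 9 * m\<^sup>2 + 5) + 1 \<le> exp (D / C)"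
proof -
  define \<Lambda> where "\<Lambda> = 1 / lam\<^sup>2"
  have \<Lambda>: "0 < \<Lambda>" using lam by (simp add: \<Lambda>_def)
  have ln1: "1 \<le> ln m"
  proof -
    have "1 \<le> 1 / \<epsilon>" using \<epsilon> by simp
    then show ?thesis using m by linarith
  qed
  have ln\<Lambda>: "ln m \<le> \<epsilon> * \<Lambda>" using l lam by (simp add: \<Lambda>_def field_simps)
  have x0: "0 \<le> lam\<^sup>2 * \<rho>\<^sup>2 * m" using m by simp
  define U where "U = exp (30 * \<rho>\<^sup>2 * (lam * \<rho> * m)\<^sup>2)"
  define T' where "T' = exp (\<Lambda> * (1 / ln m ^ 4))"
  have U1: "1 \<le> U" by (simp add: U_def)
  have T1: "1 \<le> T'" using \<Lambda> ln1 by (simp add: T'_def)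
  have TT: "T \<le> T'" using T by (simp add: T'_def \<Lambda>_def)
  have m2: "1 \<le> m\<^sup>2" using m by simp
  have mT: "1 \<le> m\<^sup>2 * T'" using mult_mono[of 1 "m\<^sup>2" 1 T'] m2 T1 by simp
  have "5 * T + 9 * m\<^sup>2 + 5 \<le> 19 * (m\<^sup>2 * T')"
  proof -
    have "T' \<le> m\<^sup>2 * T'" using m2 T1 by (simp add: mult_le_cancel_right1)
    moreover have "m\<^sup>2 \<le> m\<^sup>2 * T'" using m2 T1 by (simp add: mult_le_cancel_left1)
    ultimately show ?thesis using TT mT by linarith
  qed
  then have "M * (5 * T + 9 * m\<^sup>2 + 5) + 1 \<le> M * (19 * (m\<^sup>2 * T')) + 19 * (m\<^sup>2 * T')"
    using M mT by (intro add_mono mult_left_mono) auto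
  also have "\<dots> = (M + 1) * (19 * (m\<^sup>2 * T'))" by (simp add: algebra_simps)
  also have "\<dots> \<le> (6 * (U * m)) * (19 * (m\<^sup>2 * T'))"
  proof (intro mult_right_mono)
    have "\<Delta> * m \<le> 2 * (U * m)" using mult_right_mono[OF U1, of m] m unfolding \<Delta> U_def[symmetric] by (simp add: distrib_right)
    moreover have "1 \<le> U * m" using mult_mono[of 1 U 1 m] U1 m by simp
    ultimately show "M + 1 \<le> 6 * (U * m)" using M by linarith
  qed (use mT in auto)
  also have "\<dots> = 114 * (m ^ 3 * (U * T'))" by (simp add: power2_eq_square power3_eq_cube)
  also have "\<dots> \<le> exp (6 * ln m) * (exp (3 * ln m) * (exp (30 * \<epsilon> * \<Lambda>) * exp (\<epsilon> * \<Lambda>)))"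
  proof (intro mult_mono)
    \<comment> \<open>The constant 114 = 6 * 19 is absorbed into m^6, since ln m \<ge> 1 and (5 /
      2)^6 > 114.\<close>
    have "(5 / 2 :: real) ^ 6 \<le> exp 1 ^ 6"
      using exp_lower_Taylor_quadratic[of 1] by (intro power_mono) auto
    also have "exp 1 ^ 6 = exp (6 :: real)" using exp_of_nat_mult[of 6 "1 :: real"] by simp
    also have "\<dots> \<le> exp (6 * ln m)" using ln1 by simp
    finally show "114 \<le> exp (6 * ln m)" by (simp add: power_divide)
    have "exp (3 * ln m) = exp (ln m) ^ 3" using exp_of_nat_mult[of 3 "ln m"] by simp
    then show "m ^ 3 \<le> exp (3 * ln m)" using m by simp
    show "U \<le> exp (30 * \<epsilon> * \<Lambda>)"
    \<comment> \<open>The exponent of \<Delta> is \<Lambda> times the square of the small quantity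
      \<lambda>^2 \<rho>^2 m. This identity is what allows a number of samples as large as \<Delta>
      n.\<close>
    proof -
      have "\<rho>\<^sup>2 * (lam * \<rho> * m)\<^sup>2 = \<Lambda> * (lam\<^sup>2 * \<rho>\<^sup>2 * m)\<^sup>2"
        using lam by (simp add: \<Lambda>_def power2_eq_square field_simps)
      also have "\<dots> \<le> \<Lambda> * (\<epsilon> * 1)"
        unfolding power2_eq_square[of "lam\<^sup>2 * \<rho>\<^sup>2 * m"] using x x0 \<epsilon> \<Lambda> by (intro mult_left_mono mult_mono) auto
      finally show ?thesis by (simp add: U_def mult_ac)
    qed
    show "T' \<le> exp (\<epsilon> * \<Lambda>)"
    proof -
      have "ln m ^ 1 \<le> ln m ^ 4" using ln1 by (intro power_increasing) auto
      then have "1 / \<epsilon> \<le> ln m ^ 4" using m by simp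
      then have "1 / ln m ^ 4 \<le> \<epsilon>" using \<epsilon> ln1 by (simp add: field_simps)
      then have "\<Lambda> * (1 / ln m ^ 4) \<le> \<Lambda> * \<epsilon>" using \<Lambda> by (intro mult_left_mono) auto
      then show ?thesis by (simp add: T'_def mult.commute)
    qed
  qed (use m U1 T1 in auto)
  also have "\<dots> = exp (9 * ln m + 31 * (\<epsilon> * \<Lambda>))"
    by (simp add: exp_add[symmetric])
  also have "\<dots> \<le> exp (D / C)"
  proof -
    have "9 * ln m + 31 * (\<epsilon> * \<Lambda>) \<le> 40 * (\<epsilon> * \<Lambda>)" using ln\<Lambda> by linarith
    also have "\<dots> \<le> (\<Lambda> / 800 - \<epsilon> * \<Lambda>) / C"
    proof -
      have "\<Lambda> * (\<epsilon> * (800 * (40 * C + 1))) \<le> \<Lambda> * 1" using \<epsilon> \<Lambda> by (intro mult_left_mono) auto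
      then show ?thesis using C by (simp add: field_simps)
    qed
    also have "\<dots> \<le> D / C"
    proof (intro divide_right_mono)
      have "\<Lambda> / 800 = 1 / (800 * lam\<^sup>2)" by (simp add: \<Lambda>_def)
      then show "\<Lambda> / 800 - \<epsilon> * \<Lambda> \<le> D" using D ln\<Lambda> ln1 by linarith
    qed (use C in simp)
    finally show ?thesis by simp
  qed
  finally show ?thesis .
qed

section \<open>Consequences of the parameter regime\<close>

locale regime =
  fixes lam \<rho> :: "nat \<Rightarrow> real"
  assumes lam_nonneg: "\<And>n. 0 \<le> lam n" and \<rho>_pos: "\<And>n. 0 < \<rho> n" and \<rho>_less: "\<And>n. \<rho> n < 1"
    and \<rho>_large: "(\<lambda>n. (ln (real n))\<^sup>2 / sqrt (real n)) \<in> o(\<rho>)"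
    and \<rho>_small: "\<rho> \<in> o(\<lambda>n. 1 / ln (real n))"
    and lam_small: "(\<lambda>n. (lam n)\<^sup>2 * (\<rho> n)\<^sup>2 * real n) \<in> o(\<lambda>n. 1 / (ln (real n))\<^sup>2)"
begin

lemma ln_at_top: "filterlim (\<lambda>n. ln (real n)) at_top sequentially"
  by (rule filterlim_compose[OF ln_at_top filterlim_real_sequentially])

lemma eventually_ln_ge: "\<forall>\<^sub>F n in sequentially. K \<le> ln (real n)"
  using ln_at_top by (simp add: filterlim_at_top)

lemma eventually_rho_sq: "\<forall>\<^sub>F n in sequentially. ln (real n) ^ 4 \<le> (\<rho> n)\<^sup>2 * real n"
  using landau_o.smallD[OF \<rho>_large zero_less_one] eventually_gt_at_top[of 0]
proof eventually_elim
  case (elim n)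
  have "(ln (real n))\<^sup>2 / sqrt (real n) \<le> \<rho> n" using elim \<rho>_pos[of n] by simp
  then have "(ln (real n))\<^sup>2 \<le> \<rho> n * sqrt (real n)" using elim by (simp add: pos_divide_le_eq)
  then have "((ln (real n))\<^sup>2)\<^sup>2 \<le> (\<rho> n * sqrt (real n))\<^sup>2" by (intro power_mono) auto
  then show ?case by (simp add: power_mult_distrib power_mult[symmetric])
qed

lemma eventually_rho_ln:
  assumes "0 < \<epsilon>" shows "\<forall>\<^sub>F n in sequentially. \<rho> n * ln (real n) \<le> \<epsilon>"
  using landau_o.smallD[OF \<rho>_small assms] eventually_ln_ge[of 1]
proof eventually_elim
  case (elim n)
  then have "\<rho> n \<le> \<epsilon> / ln (real n)" using \<rho>_pos[of n] by simp
  then show ?case using elim by (simp add: pos_le_divide_eq)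
qed

text \<open>The second bound follows from the first through ln n \<le> (ln n)^4 \<le> \<rho>^2 n. It
  says that \<lambda>^-2 dominates ln n, so factors polynomial in n are harmless in the running
  time.\<close>

lemma eventually_lam:
  assumes \<epsilon>: "0 < \<epsilon>"
  shows "\<forall>\<^sub>F n in sequentially. (lam n)\<^sup>2 * (\<rho> n)\<^sup>2 * real n \<le> \<epsilon> \<and> (lam n)\<^sup>2 * ln (real n) \<le> \<epsilon>"
  using landau_o.smallD[OF lam_small \<epsilon>] eventually_ln_ge[of 1] eventually_rho_sq
proof eventually_elim
  case (elim n)
  let ?l = "ln (real n)"
  have l2: "1 \<le> ?l\<^sup>2" using elim by simp
  have *: "(lam n)\<^sup>2 * (\<rho> n)\<^sup>2 * real n \<le> \<epsilon> / ?l\<^sup>2" using elim by simp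
  also have "\<dots> \<le> \<epsilon> / 1" using \<epsilon> l2 by (intro divide_left_mono) auto
  finally have 1: "(lam n)\<^sup>2 * (\<rho> n)\<^sup>2 * real n \<le> \<epsilon>" by simp
  have "?l ^ 1 \<le> ?l ^ 4" using elim by (intro power_increasing) auto
  then have "(lam n)\<^sup>2 * ?l \<le> (lam n)\<^sup>2 * ((\<rho> n)\<^sup>2 * real n)" using elim by (intro mult_left_mono) auto
  with 1 show ?case by (simp add: mult.assoc)
qed

lemma rho_sq_at_top: "filterlim (\<lambda>n. (\<rho> n)\<^sup>2 * real n) at_top sequentially"
proof (rule filterlim_at_top_mono[OF _ eventually_rho_sq])
  show "filterlim (\<lambda>n. ln (real n) ^ 4) at_top sequentially"
    by (rule filterlim_pow_at_top[OF _ ln_at_top]) simp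
qed

lemma rho_at_top: "filterlim (\<lambda>n. \<rho> n * real n) at_top sequentially"
proof (rule filterlim_at_top_mono[OF rho_sq_at_top always_eventually], rule allI)
  fix n
  have "(\<rho> n)\<^sup>2 \<le> \<rho> n" using \<rho>_pos[of n] \<rho>_less[of n] by (simp add: power2_eq_square mult_left_le)
  then show "(\<rho> n)\<^sup>2 * real n \<le> \<rho> n * real n" by (intro mult_right_mono) auto
qed

lemma exp_neg_tendsto_0:
  assumes "filterlim f at_top F" "0 < (k :: real)"
  shows "((\<lambda>n. exp (- (f n * k))) \<longlongrightarrow> 0) F"
  by (rule filterlim_compose[OF exp_at_bot])
     (intro filterlim_uminus_at_top[THEN iffD1] filterlim_at_top_mult_tendsto_pos[OF tendsto_const assms(2) assms(1)])

lemma rho_tendsto_0: "\<rho> \<longlonglongrightarrow> 0"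
proof (rule tendsto_sandwich[OF _ _ tendsto_const])
  show "\<forall>\<^sub>F n in sequentially. 0 \<le> \<rho> n" using \<rho>_pos by (intro always_eventually allI less_imp_le)
  show "\<forall>\<^sub>F n in sequentially. \<rho> n \<le> 1 / ln (real n)"
    using eventually_rho_ln[OF zero_less_one] eventually_ln_ge[of 1] by eventually_elim (auto simp: field_simps)
  show "(\<lambda>n. 1 / ln (real n)) \<longlonglongrightarrow> 0"
    by (rule tendsto_divide_0[OF tendsto_const filterlim_at_top_imp_at_infinity[OF ln_at_top]])
qed

lemma eventually_signal_strong:
  assumes c: "0 < c" and rec: "\<forall>\<^sub>F n in sequentially. c \<le> recovery_score n (lam n) (\<rho> n) (\<X> n)"
  shows "\<forall>\<^sub>F n in sequentially. ln (real n) < lam n * \<rho> n * real n"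
proof -
  \<comment> \<open>The bound of \<open>correlation_second_moment\<close> with its first exponent
    replaced by 8, its value for weak signals; the products are arranged to fit
    \<open>exp_neg_tendsto_0\<close>.\<close>
  define \<beta> where "\<beta> n = exp 8 * (64 * (\<rho> n)\<^sup>2 + 2 * exp (- (\<rho> n * real n * (1 / 10)))) + exp (- ((\<rho> n)\<^sup>2 * real n * 2))" for n
  have "\<beta> \<longlonglongrightarrow> exp 8 * (64 * 0\<^sup>2 + 2 * 0) + 0"
    unfolding \<beta>_def
    by (intro tendsto_intros rho_tendsto_0 exp_neg_tendsto_0 rho_at_top rho_sq_at_top) auto
  then have "\<beta> \<longlonglongrightarrow> 0" by simp
  then have \<beta>: "\<forall>\<^sub>F n in sequentially. \<beta> n < c\<^sup>2" using c by (intro order_tendstoD(2)) auto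
  show ?thesis
    using rec \<beta> eventually_rho_ln[OF zero_less_one] eventually_rho_sq eventually_ln_ge[of 5] eventually_gt_at_top[of 0]
  proof eventually_elim
    case (elim n)
    let ?l = "ln (real n)" and ?a = "real n * (\<rho> n)\<^sup>2"
    show ?case
    proof (rule ccontr)
      assume "\<not> ?case"
      then have s: "lam n * \<rho> n * real n \<le> ?l" by simp
      have s0: "0 \<le> lam n * \<rho> n * real n" using lam_nonneg[of n] \<rho>_pos[of n] by simp
      have l0: "0 < ?l" using elim by linarith
      have sq: "(lam n * \<rho> n * real n)\<^sup>2 \<le> ?l\<^sup>2" using s s0 by (intro power_mono)
      \<comment> \<open>From (ln n)^4 \<le> \<rho>^2 n one gets \<lambda>^2 n (ln n)^4 \<le>
        (\<lambda>\<rho>n)^2 \<le> (ln n)^2; then ln n \<ge> 5 is more than enough for 1 /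
        20.\<close>
      have lam1: "(lam n)\<^sup>2 * real n \<le> 1 / 20"
      proof -
        have "(lam n)\<^sup>2 * real n * ?l ^ 4 \<le> (lam n)\<^sup>2 * real n * ((\<rho> n)\<^sup>2 * real n)"
          using elim by (intro mult_left_mono) auto
        also have "\<dots> = (lam n * \<rho> n * real n)\<^sup>2" by (simp add: power2_eq_square)
        also have "\<dots> \<le> ?l\<^sup>2" by (rule sq)
        finally have "((lam n)\<^sup>2 * real n * ?l\<^sup>2) * ?l\<^sup>2 \<le> 1 * ?l\<^sup>2" by (simp add: power_add[symmetric] mult.assoc)
        then have "(lam n)\<^sup>2 * real n * ?l\<^sup>2 \<le> 1" using l0 by (simp add: mult_le_cancel_right)
        moreover have "20 \<le> ?l\<^sup>2" using power_mono[of 5 ?l 2] elim by simp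
        then have "(lam n)\<^sup>2 * real n * 20 \<le> (lam n)\<^sup>2 * real n * ?l\<^sup>2" by (intro mult_left_mono) auto
        ultimately show ?thesis by simp
      qed
      \<comment> \<open>The left side equals 8 (\<lambda>\<rho>n)^2 \<rho>^2, at most 8 (\<rho> ln
        n)^2. The assumption that \<rho> is small against 1 / ln n enters here.\<close>
      have la: "8 * (lam n)\<^sup>2 * ?a\<^sup>2 \<le> 8"
      proof -
        have "(lam n)\<^sup>2 * ?a\<^sup>2 = (lam n * \<rho> n * real n)\<^sup>2 * (\<rho> n)\<^sup>2" by (simp add: power2_eq_square)
        also have "\<dots> \<le> ?l\<^sup>2 * (\<rho> n)\<^sup>2" using sq by (intro mult_right_mono) auto
        also have "\<dots> = (\<rho> n * ?l)\<^sup>2" by (simp add: power_mult_distrib)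
        also have "\<dots> \<le> 1\<^sup>2" using elim \<rho>_pos[of n] l0 by (intro power_mono) auto
        finally show ?thesis by simp
      qed
      obtain \<omega> where \<omega>: "c \<le> det_score n (lam n) (\<rho> n) (\<lambda>y. run_prog (\<X> n) y \<omega>)"
        using derandomised_score elim(1) by blast
      let ?B = "pair_mean n (\<rho> n) (\<lambda>\<theta> \<theta>'. exp ((lam n)\<^sup>2 * (overlap n \<theta> \<theta>')\<^sup>2 / 2) *
           ((overlap n \<theta> \<theta>')\<^sup>2 / (overlap n \<theta> \<theta> * overlap n \<theta>' \<theta>')))"
      have "?B \<le> exp (8 * (lam n)\<^sup>2 * ?a\<^sup>2) * (64 * (\<rho> n)\<^sup>2 + 2 * exp (- (\<rho> n * real n / 10))) + exp (- 2 * ?a)"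
        by (rule correlation_second_moment[OF \<rho>_pos \<rho>_less lam1]) (use elim in simp)
      also have "\<dots> \<le> \<beta> n"
      proof -
        have "\<beta> n = exp 8 * (64 * (\<rho> n)\<^sup>2 + 2 * exp (- (\<rho> n * real n / 10))) + exp (- 2 * ?a)"
          by (simp add: \<beta>_def mult_ac)
        moreover have "exp (8 * (lam n)\<^sup>2 * ?a\<^sup>2) \<le> exp 8" using la by (simp only: exp_le_cancel_iff)
        moreover have "0 \<le> 64 * (\<rho> n)\<^sup>2 + 2 * exp (- (\<rho> n * real n / 10))" by simp
        ultimately show ?thesis by (metis add_mono mult_right_mono order.refl)
      qed
      finally have B: "?B < c\<^sup>2" using elim by simp
      \<comment> \<open>With the weight \<alpha> = c a score of at least c forces the second moment
        \<open>?B\<close> up to c^2.\<close>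
      have "c \<le> c / 2 + ?B / (2 * c)"
        by (rule order.trans[OF \<omega> det_score_le[OF run_prog_measurable lam_nonneg c]])
           (auto intro: measurable_PiM_apply)
      then have "c\<^sup>2 \<le> ?B" using c by (simp add: field_simps power2_eq_square)
      with B show False by simp
    qed
  qed
qed

end

section \<open>Contradiction along a sequence of dimensions\<close>

context regime
begin

lemma parameter_regime_compose:
  assumes m: "filterlim m at_top sequentially"
  shows "parameter_regime m (\<lambda>k. sqrt 2 * lam (m k)) (\<lambda>k. \<rho> (m k))"
proof -
  have "(\<lambda>k. 2 * ((lam (m k))\<^sup>2 * (\<rho> (m k))\<^sup>2 * real (m k))) \<in> o(\<lambda>k. 1 / (ln (real (m k)))\<^sup>2)"
    using landau_o.small.compose[OF lam_small m] by simp
  then have "(\<lambda>k. (sqrt 2 * lam (m k))\<^sup>2 * (\<rho> (m k))\<^sup>2 * real (m k)) \<in> o(\<lambda>k. 1 / (ln (real (m k)))\<^sup>2)"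
    by (simp add: power_mult_distrib mult.assoc)
  then show ?thesis
    unfolding parameter_regime_def
    using lam_nonneg \<rho>_pos \<rho>_less landau_o.small.compose[OF \<rho>_large m] landau_o.small.compose[OF \<rho>_small m]
    by simp
qed

text \<open>The hypotheses hold for every k and not just eventually, because the heuristic imposes
  its conditions on \<Delta> and M at every index. In particular 2 \<le> m k makes room for an
  integer M between \<Delta> n and n^2 \<Delta>.\<close>

lemma no_fast_recovery:
  fixes \<X> :: "nat \<Rightarrow> (nat \<times> nat, nat \<times> nat) prog" and m :: "nat \<Rightarrow> nat"
  assumes heur: "associated_heuristics" and c: "0 < c" and m: "filterlim m at_top sequentially"
    and m2: "\<And>k. 2 \<le> m k" and lam_pos: "\<And>k. 0 < lam (m k)"
    and strong: "\<And>k. ln (real (m k)) < lam (m k) * \<rho> (m k) * real (m k)"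
    and rec: "\<And>k. c \<le> recovery_score (m k) (lam (m k)) (\<rho> (m k)) (\<X> (m k))"
    and fast: "\<And>k. real (run_time (\<X> (m k))) \<le> exp (1 / (lam (m k))\<^sup>2 * (1 / ln (real (m k)) ^ 4))"
  shows False
proof -
  define l where "l k = sqrt 2 * lam (m k)" for k
  define r where "r k = \<rho> (m k)" for k
  define n where "n k = real (m k)" for k
  \<comment> \<open>800 is twice the 400 of \<open>truncated_chi_square\<close>, because the squared
    signal strength is doubled.\<close>
  define D where "D k = nat \<lfloor>1 / (800 * (lam (m k))\<^sup>2)\<rfloor>" for k
  \<comment> \<open>Likewise 30 is twice 15. The added 1 comes from the fluctuation part of the
    chi-square bound and also makes \<Delta> exceed 1.\<close>
  define \<Delta> where "\<Delta> k = exp (30 * (r k)\<^sup>2 * (lam (m k) * r k * n k)\<^sup>2) + 1" for k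
  \<comment> \<open>The factor n gives \<Delta> / M \<le> 1 / n, hence advantage tending to 1, while
    its logarithm is cheap in the union bound.\<close>
  define M where "M k = nat \<lceil>\<Delta> k * n k\<rceil>" for k
  let ?P = "\<lambda>k. planted_law (m k) (l k) (r k)" and ?N = "\<lambda>k. noise_law (m k)"
  have r: "0 < r k" "r k < 1" for k using \<rho>_pos \<rho>_less by (auto simp: r_def)
  have n2: "2 \<le> n k" for k using m2[of k] by (simp add: n_def)
  have l2: "(l k)\<^sup>2 = 2 * (lam (m k))\<^sup>2" for k by (simp add: l_def power_mult_distrib)
  have \<Delta>1: "1 < \<Delta> k" for k by (simp add: \<Delta>_def)
  have Dle: "real (D k) \<le> 1 / (800 * (lam (m k))\<^sup>2)" for k
    unfolding D_def by (simp add: floor_le_iff[symmetric])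
  have Dge: "1 / (800 * (lam (m k))\<^sup>2) - 1 \<le> real (D k)" for k
    unfolding D_def by linarith
  have A: "pair_mean (m k) (r k) (\<lambda>\<theta> \<theta>'. \<Sum>d\<le>D k. ((l k)\<^sup>2 * (overlap (m k) \<theta> \<theta>')\<^sup>2 / 2) ^ d / fact d) \<le> \<Delta> k" for k
  proof -
    have "400 * (l k)\<^sup>2 * real (D k) \<le> 1"
      using Dle[of k] lam_pos[of k] by (simp add: l2 field_simps)
    from truncated_chi_square[OF r this] have "pair_mean (m k) (r k) (\<lambda>\<theta> \<theta>'. \<Sum>d\<le>D k. ((l k)\<^sup>2 * (overlap (m k) \<theta> \<theta>')\<^sup>2 / 2) ^ d / fact d)
      \<le> exp (15 * ((l k)\<^sup>2 * (n k * (r k)\<^sup>2)\<^sup>2)) + 1" by (simp only: n_def)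
    also have "15 * ((l k)\<^sup>2 * (n k * (r k)\<^sup>2)\<^sup>2) = 30 * (r k)\<^sup>2 * (lam (m k) * r k * n k)\<^sup>2"
      by (simp only: l2) (simp add: power2_eq_square)
    finally show ?thesis by (simp add: \<Delta>_def)
  qed
  have Adv2: "(Adv (entries (m k)) (D k) (?P k) (?N k))\<^sup>2 \<le> ereal (\<Delta> k)" for k
  proof -
    let ?A = "Adv (entries (m k)) (D k) (?P k) (?N k)"
    have "?A \<le> ereal (sqrt (\<Delta> k))"
      using Adv_planted_le[of "m k" "D k" "l k" "r k"] A[of k]
      by (elim order.trans) (simp add: real_sqrt_le_iff)
    moreover have "1 \<le> ?A" by (rule Adv_ge_1[OF prob_space_planted_law prob_space_noise_law])
    ultimately obtain a where a: "?A = ereal a" "1 \<le> a" "a \<le> sqrt (\<Delta> k)"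
      by (cases ?A) (auto simp: one_ereal_def)
    then have "a\<^sup>2 \<le> (sqrt (\<Delta> k))\<^sup>2" by (intro power_mono) auto
    then show ?thesis using a \<Delta>1[of k] by simp
  qed
  have par: "parameter_regime m l r" unfolding l_def r_def by (rule parameter_regime_compose[OF m])
  \<comment> \<open>C may depend on \<Delta> and D, but the sample number is bound afresh here and
    comes after it.\<close>
  obtain C where C: "0 < C" and lowdeg: "\<And>M. (\<forall>k. 0 < M k \<and> real (M k) \<le> real (card (entries (m k))) * \<Delta> k) \<and> \<Delta> \<in> o(\<lambda>k. real (M k)) \<Longrightarrow>
       low_degree_heuristic C (\<lambda>k. {..<M k} \<times> entries (m k)) D
             (\<lambda>k. hidden_planted (M k) (entries (m k)) (?P k) (?N k))
             (\<lambda>k. hidden_null (M k) (entries (m k)) (?N k))"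
    using heur[unfolded associated_heuristics_def, rule_format, of m l r \<Delta> D] m par \<Delta>1 Adv2 by blast
  let ?I = "\<lambda>k. {..<M k} \<times> entries (m k)"
  let ?HP = "\<lambda>k. hidden_planted (M k) (entries (m k)) (?P k) (?N k)"
  let ?HN = "\<lambda>k. hidden_null (M k) (entries (m k)) (?N k)"
  have nD: "1 < \<Delta> k * n k" for k
    using mult_strict_mono[of 1 "\<Delta> k" 1 "n k"] \<Delta>1[of k] n2[of k] by simp
  have Mge: "\<Delta> k * n k \<le> real (M k)" and Mle: "real (M k) \<le> \<Delta> k * n k + 1" for k
    using nD[of k] unfolding M_def by linarith+
  have M0: "0 < M k" for k
  proof -
    have "0 < real (M k)" using Mge[of k] nD[of k] by linarith
    then show ?thesis by simp
  qed
  have Mcard: "real (M k) \<le> real (card (entries (m k))) * \<Delta> k" for k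
  proof -
    have "real (M k) \<le> 2 * (\<Delta> k * n k)" using Mle[of k] nD[of k] by linarith
    also have "\<dots> \<le> n k * (\<Delta> k * n k)" using n2[of k] nD[of k] by (intro mult_right_mono) auto
    finally show ?thesis by (simp add: n_def mult_ac)
  qed
  have ratio: "\<Delta> k / real (M k) \<le> 1 / n k" for k
    using Mge[of k] M0[of k] n2[of k] by (simp add: field_simps)
  have n_lim: "filterlim n at_top sequentially"
    unfolding n_def by (rule filterlim_compose[OF filterlim_real_sequentially m])
  have inv_n: "(\<lambda>k. 1 / n k) \<longlonglongrightarrow> 0"
    by (rule tendsto_divide_0[OF tendsto_const filterlim_at_top_imp_at_infinity[OF n_lim]])
  have small: "\<Delta> \<in> o(\<lambda>k. real (M k))"
  proof (rule smalloI_tendsto)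
    show "(\<lambda>k. \<Delta> k / real (M k)) \<longlonglongrightarrow> 0"
    proof (rule tendsto_sandwich[OF _ _ tendsto_const inv_n])
      show "\<forall>\<^sub>F k in sequentially. 0 \<le> \<Delta> k / real (M k)"
        using \<Delta>1 by (intro always_eventually allI divide_nonneg_nonneg) (auto intro: less_imp_le order.trans[OF zero_le_one])
      show "\<forall>\<^sub>F k in sequentially. \<Delta> k / real (M k) \<le> 1 / n k"
        using ratio by (intro always_eventually allI)
    qed
    show "\<forall>\<^sub>F k in sequentially. real (M k) \<noteq> 0"
      using M0 by (intro always_eventually allI) simp
  qed
  have "(\<lambda>k. Adv (?I k) (D k) (?HP k) (?HN k)) \<longlonglongrightarrow> 1"
  proof (rule tendsto_sandwich[OF _ _ tendsto_const])
    have T: "Measurable.pred (PiM (entries (m k)) (\<lambda>_. borel :: real measure)) (\<lambda>_. True)" for k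
      by simp
    have ph: "prob_space (?HP k)" for k
      by (rule hidden_planted_none_le(1)[OF prob_space_planted_law sets_planted_law prob_space_noise_law sets_noise_law T M0])
    have pn: "prob_space (?HN k)" for k
      unfolding hidden_null_def by (rule prob_space_samples_law) (auto simp: prob_space_noise_law)
    show "\<forall>\<^sub>F k in sequentially. 1 \<le> Adv (?I k) (D k) (?HP k) (?HN k)"
      by (intro always_eventually allI Adv_ge_1 ph pn)
    show "\<forall>\<^sub>F k in sequentially. Adv (?I k) (D k) (?HP k) (?HN k) \<le> ereal (sqrt (1 + 1 / n k))"
    proof (intro always_eventually allI)
      fix k
      have "pair_mean (m k) (r k) (\<lambda>\<theta> \<theta>'. \<Sum>d\<le>D k. ((l k)\<^sup>2 * (overlap (m k) \<theta> \<theta>')\<^sup>2 / 2) ^ d / fact d) / real (M k) \<le> 1 / n k"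
        by (rule order.trans[OF divide_right_mono[OF A] ratio]) simp
      then show "Adv (?I k) (D k) (?HP k) (?HN k) \<le> ereal (sqrt (1 + 1 / n k))"
        by (intro order.trans[OF Adv_hidden_le[OF M0]]) simp
    qed
    have "(\<lambda>k. sqrt (1 + 1 / n k)) \<longlonglongrightarrow> sqrt (1 + 0)"
      by (intro tendsto_intros inv_n)
    then show "(\<lambda>k. ereal (sqrt (1 + 1 / n k))) \<longlonglongrightarrow> 1"
      by (simp add: one_ereal_def)
  qed
  moreover have "low_degree_heuristic C ?I D
             ?HP
             ?HN"
    by (rule lowdeg) (intro conjI allI M0 Mcard small)
  \<comment> \<open>The second part of the heuristic is the one that fits: a score bounded below by
    c only gives a detector whose error sum stays a constant below 1.\<close>
  ultimately have hard: "\<not> (\<exists>A. runs_within A (\<lambda>k. time_bound C (card (?I k)) (D k)) \<and>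
      weak_detection A ?HP ?HN)"
    unfolding low_degree_heuristic_def by (elim conjE) (erule mp)
  define \<tau> where "\<tau> k = c * lam (m k) * (r k * n k) / 8" for k
  define seed where "seed k \<omega> z \<longleftrightarrow> real (M k) * measure (?N k) {y \<in> space (?N k). clone_test (m k) (\<tau> k) (\<lambda>y. run_prog (\<X> (m k)) y \<omega>) (clone_sum (m k) z y, clone_diff (m k) z y)}
      + measure (?P k) {y \<in> space (?P k). \<not> clone_test (m k) (\<tau> k) (\<lambda>y. run_prog (\<X> (m k)) y \<omega>) (clone_sum (m k) z y, clone_diff (m k) z y)}
      \<le> 1 - c / 2 + exp (- (r k * n k / 10)) + (2 * real (M k) + 3) * exp (- ((\<tau> k)\<^sup>2 / 4))" for k \<omega> z
  have "\<exists>\<omega> z. seed k \<omega> z" for k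
  proof -
    obtain \<omega> where \<omega>: "c \<le> det_score (m k) (lam (m k)) (r k) (\<lambda>y. run_prog (\<X> (m k)) y \<omega>)"
      using derandomised_score[OF rec[of k]] by (auto simp: r_def)
    have X: "(\<lambda>y. run_prog (\<X> (m k)) y \<omega> e) \<in> borel_measurable (PiM (entries (m k)) (\<lambda>_. borel))" for e
      by (intro run_prog_measurable measurable_PiM_apply) simp
    have mk: "0 < m k" using m2[of k] by simp
    have \<tau>: "\<tau> k = c * lam (m k) * (r k * real (m k)) / 8" by (simp add: \<tau>_def n_def)
    obtain z where "seed k \<omega> z"
      unfolding seed_def l_def n_def by (rule exists_clone_seed[OF X lam_pos r mk c \<omega> \<tau>])
    then show ?thesis by blast
  qed
  then obtain \<omega> z where "\<And>k. seed k (\<omega> k) (z k)" by metis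
  note err = this[unfolded seed_def]
  let ?A = "\<lambda>k. detector (m k) (z k) (\<omega> k) (\<tau> k) (\<X> (m k)) (M k)"
  note de = detector_error[OF prob_space_planted_law sets_planted_law prob_space_noise_law sets_noise_law M0]
  have ln_lim: "filterlim (\<lambda>k. ln (n k)) at_top sequentially"
    by (rule filterlim_compose[OF Transcendental.ln_at_top n_lim])
  have "weak_detection ?A ?HP ?HN"
    unfolding weak_detection_def
  proof (intro conjI allI exI[of _ "c / 4"])
    show "binary_valued (?A k)" for k by (rule de(1))
    show "0 < c / 4" using c by simp
    \<comment> \<open>With this value the exponent \<open>(\<tau> k)\<^sup>2 / 4\<close> of the test
      equals 4 \<kappa> (\<lambda>\<rho>n)^2. Of the margin c / 2, half is spent on the vanishing
      terms collected in \<open>\<beta>\<close>.\<close>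
    define \<kappa> where "\<kappa> = c\<^sup>2 / 1024"
    have \<kappa>: "0 < \<kappa>" using c by (simp add: \<kappa>_def)
    define \<beta> where "\<beta> k = exp (- (r k * n k * (1 / 10))) + 14 * exp (- ((ln (n k))\<^sup>2 * (2 * \<kappa>)))" for k
    have "filterlim (\<lambda>k. r k * n k) at_top sequentially"
      unfolding r_def n_def by (rule filterlim_compose[OF rho_at_top m])
    moreover have "filterlim (\<lambda>k. (ln (n k))\<^sup>2) at_top sequentially"
      by (rule filterlim_pow_at_top[OF _ ln_lim]) simp
    ultimately have "\<beta> \<longlonglongrightarrow> 0 + 14 * 0"
      unfolding \<beta>_def using \<kappa> by (intro tendsto_intros exp_neg_tendsto_0) auto
    then have "\<forall>\<^sub>F k in sequentially. \<beta> k < c / 4" using c by (intro order_tendstoD(2)) auto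
    moreover have "\<forall>\<^sub>F k in sequentially. 1 / \<kappa> \<le> ln (n k)"
      using ln_lim by (simp add: filterlim_at_top)
    moreover have "\<forall>\<^sub>F k in sequentially. (r k)\<^sup>2 < \<kappa> / 30"
    proof (rule order_tendstoD(2))
      have "r \<longlonglongrightarrow> 0" unfolding r_def by (rule filterlim_compose[OF rho_tendsto_0 m])
      then show "(\<lambda>k. (r k)\<^sup>2) \<longlonglongrightarrow> 0\<^sup>2" by (intro tendsto_intros)
    qed (use \<kappa> in simp)
    ultimately show "\<forall>\<^sub>F k in sequentially. error_sum (?A k) (?HP k) (?HN k) \<le> 1 - c / 4"
    proof eventually_elim
      case (elim k)
      let ?q = "(lam (m k) * r k * n k)\<^sup>2"
      have s: "ln (n k) \<le> lam (m k) * r k * n k" using strong[of k] by (simp add: r_def n_def less_imp_le)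
      have "0 \<le> ln (n k)" using n2[of k] by simp
      with s have q: "(ln (n k))\<^sup>2 \<le> ?q" by (intro power_mono)
      have "(2 * real (M k) + 3) * exp (- (4 * \<kappa> * ?q)) \<le> 14 * exp (- (2 * \<kappa> * (ln (n k))\<^sup>2))"
        by (rule error_term_bound[where \<Delta>="\<Delta> k" and \<rho>="r k"])
           (use n2[of k] elim q \<kappa> Mle[of k] in \<open>auto simp: \<Delta>_def\<close>)
      moreover have "(\<tau> k)\<^sup>2 / 4 = 4 * \<kappa> * ?q"
        by (simp add: \<tau>_def \<kappa>_def power2_eq_square)
      ultimately have "(2 * real (M k) + 3) * exp (- ((\<tau> k)\<^sup>2 / 4)) \<le> 14 * exp (- ((ln (n k))\<^sup>2 * (2 * \<kappa>)))"
        by (simp add: mult_ac)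
      then have "exp (- (r k * n k / 10)) + (2 * real (M k) + 3) * exp (- ((\<tau> k)\<^sup>2 / 4)) \<le> c / 4"
        using elim(1) by (simp add: \<beta>_def)
      moreover have "error_sum (?A k) (?HP k) (?HN k)
          \<le> 1 - c / 2 + exp (- (r k * n k / 10)) + (2 * real (M k) + 3) * exp (- ((\<tau> k)\<^sup>2 / 4))"
        by (rule order.trans, rule de(2), rule err)
      ultimately show ?case by linarith
    qed
  qed
  moreover have "runs_within ?A (\<lambda>k. time_bound C (card (?I k)) (D k))"
    unfolding runs_within_def
  proof -
    \<comment> \<open>The largest value that \<open>run_time_bound\<close> admits for this
      C.\<close>
    define \<epsilon> where "\<epsilon> = 1 / (800 * (40 * C + 1))"
    have \<epsilon>: "0 < \<epsilon>" "\<epsilon> \<le> 1" "\<epsilon> * (800 * (40 * C + 1)) \<le> 1" using C by (auto simp: \<epsilon>_def field_simps)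
    have "\<forall>\<^sub>F k in sequentially. (lam (m k))\<^sup>2 * (\<rho> (m k))\<^sup>2 * real (m k) \<le> \<epsilon> \<and> (lam (m k))\<^sup>2 * ln (real (m k)) \<le> \<epsilon>"
      using eventually_lam[OF \<epsilon>(1)] m by (rule eventually_compose_filterlim)
    moreover have "\<forall>\<^sub>F k in sequentially. 1 / \<epsilon> \<le> ln (n k)"
      using ln_lim by (simp add: filterlim_at_top)
    ultimately show "\<forall>\<^sub>F k in sequentially. real (run_time (?A k)) \<le> time_bound C (card (?I k)) (D k)"
    proof eventually_elim
      case (elim k)
      have "1 < card (?I k)"
      proof -
        have "1 * (2 * 2) \<le> M k * (m k * m k)" using M0[of k] m2[of k] by (intro mult_mono) auto
        then show ?thesis by (simp add: card_cartesian_product)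
      qed
      then have tb: "time_bound C (card (?I k)) (D k) = exp (real (D k) / C)"
        by (intro time_bound_eq_exp) simp
      have "real (run_time (?A k)) \<le> real (M k * (5 * run_time (\<X> (m k)) + 9 * (m k)\<^sup>2 + 5) + 1)"
        by (intro of_nat_mono run_time_detector)
      also have "\<dots> = real (M k) * (5 * real (run_time (\<X> (m k))) + 9 * (n k)\<^sup>2 + 5) + 1"
        by (simp add: n_def)
      also have "\<dots> \<le> exp (real (D k) / C)"
        by (rule run_time_bound[where \<rho>="r k" and lam="lam (m k)" and \<Delta>="\<Delta> k" and \<epsilon>=\<epsilon>])
           (use n2[of k] elim \<epsilon> lam_pos[of k] C fast[of k] Dge[of k] Mle[of k] in \<open>auto simp: \<Delta>_def n_def r_def\<close>)
      finally show ?case by (simp only: tb)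
    qed
  qed
  ultimately show False using hard by blast
qed

end

theorem theorem2p6:
  fixes lam \<rho> :: "nat \<Rightarrow> real"
    and \<X> :: "nat \<Rightarrow> (nat \<times> nat, nat \<times> nat) prog"
  assumes "\<And>n. 0 \<le> lam n" and "\<And>n. 0 < \<rho> n" and "\<And>n. \<rho> n < 1"
    and "(\<lambda>n. (ln (real n))\<^sup>2 / sqrt (real n)) \<in> o(\<rho>)"
    and "\<rho> \<in> o(\<lambda>n. 1 / ln (real n))"
    and "(\<lambda>n. (lam n)\<^sup>2 * (\<rho> n)\<^sup>2 * real n) \<in> o(\<lambda>n. 1 / (ln (real n))\<^sup>2)"
    and "associated_heuristics"
    and "weak_recovery lam \<rho> \<X>"
  shows "\<exists>c>0. \<forall>\<^sub>F n in sequentially.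
           real (run_time (\<X> n)) \<ge> exp (c * (1 / (lam n)\<^sup>2) * (1 / (ln (real n)) ^ 4))"
proof (rule ccontr)
  assume neg: "\<not> ?thesis"
  interpret regime lam \<rho> by unfold_locales (fact assms)+
  obtain c where c: "0 < c" and rec: "\<forall>\<^sub>F n in sequentially. c \<le> recovery_score n (lam n) (\<rho> n) (\<X> n)"
    using assms(8) unfolding weak_recovery_def by blast
  define good where "good n \<longleftrightarrow> 2 \<le> n \<and> ln (real n) < lam n * \<rho> n * real n \<and> c \<le> recovery_score n (lam n) (\<rho> n) (\<X> n)" for n
  have good: "\<forall>\<^sub>F n in sequentially. good n"
    unfolding good_def using eventually_ge_at_top[of 2] eventually_signal_strong[OF c rec] rec by eventually_elim auto
  \<comment> \<open>The constant 1 is attained: since (ln n)^-4 tends to 0, the estimator's time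
    bound is already exp (o(D)).\<close>
  let ?fast = "\<lambda>n. real (run_time (\<X> n)) < exp (1 * (1 / (lam n)\<^sup>2) * (1 / (ln (real n)) ^ 4))"
  have "\<exists>\<^sub>F n in sequentially. ?fast n"
  proof -
    have "\<not> (\<forall>\<^sub>F n in sequentially. real (run_time (\<X> n)) \<ge> exp (1 * (1 / (lam n)\<^sup>2) * (1 / (ln (real n)) ^ 4)))"
      using neg zero_less_one by blast
    then show ?thesis unfolding frequently_def not_less .
  qed
  then have "\<exists>\<^sub>F n in sequentially. ?fast n \<and> good n"
    using good by (rule frequently_eventually_frequently)
  then have inf: "infinite {n. ?fast n \<and> good n}"
    unfolding cofinite_eq_sequentially[symmetric] by (rule frequently_cofinite[THEN iffD1])
  \<comment> \<open>The negated claim yields only infinitely many bad dimensions. Their increasing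
    enumeration tends to infinity, as the heuristic demands.\<close>
  define m where "m = enumerate {n. ?fast n \<and> good n}"
  have mS: "?fast (m k) \<and> good (m k)" for k
    using enumerate_in_set[OF inf, of k] by (simp add: m_def)
  have lim: "filterlim m at_top sequentially"
    unfolding m_def by (rule filterlim_subseq[OF strict_mono_enumerate[OF inf]])
  show False
  proof (rule no_fast_recovery[OF assms(7) c lim])
    fix k
    show "2 \<le> m k" "ln (real (m k)) < lam (m k) * \<rho> (m k) * real (m k)"
      "c \<le> recovery_score (m k) (lam (m k)) (\<rho> (m k)) (\<X> (m k))"
      using mS[of k] by (auto simp: good_def)
    \<comment> \<open>From 0 \<le> ln m < \<lambda>\<rho>m. This excludes \<lambda> = 0, where 1 /
      \<lambda>^2 would be read as 0.\<close>
    then have "0 < lam (m k) * \<rho> (m k) * real (m k)"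
      by (intro order.strict_trans1[OF ln_ge_zero]) auto
    then show "0 < lam (m k)" using assms(1)[of "m k"] by (cases "lam (m k) = 0") auto
    show "real (run_time (\<X> (m k))) \<le> exp (1 / (lam (m k))\<^sup>2 * (1 / ln (real (m k)) ^ 4))"
      using mS[of k] by simp
  qed
qed

end
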